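(* Let $\eta>0$ be small enough that the Euler–Maruyama chain $\tilde X^\eta$ has a unique invariant probability measure $\tilde\mu_\eta$. (i) For every bounded measurable $h:\mathbb R^d\to\mathbb R$ and $x\in\mathbb R^d$, $\sqrt n\,[\mathcal E^{\eta,x}_n(h)-\tilde\mu_\eta(h)]$ converges weakly as $n\to\infty$ to $\mathcal N(0,\tilde{\mathcal V}(h))$ with $\tilde{\mathcal V}(h)=\langle f,f\rangle_{\tilde\mu_\eta}-\langle\tilde{\mathcal P}_\eta f,\tilde{\mathcal P}_\eta f\rangle_{\tilde\mu_\eta}$, where $f=-\sum_{k=0}^\infty\tilde{\mathcal P}^k_\eta(h-\tilde\mu_\eta(h))$ is the solution of $\tilde{\mathcal P}_\eta f-f=h-\tilde\mu_\eta(h)$. Moreover $$\tilde{\mathcal V}(h)=\langle h-\tilde\mu_\eta(h),h-\tilde\mu_\eta(h)\rangle_{\tilde\mu_\eta}+2\sum_{k=1}^\infty\langle\tilde{\mathcal P}^k_\eta h,h-\tilde\mu_\eta(h)\rangle_{\tilde\mu_\eta}.$$ (ii) For every bounded measurable $h$, $x\in\mathbb R^d$, every sequence $a_n\to\infty$ with $a_n/\sqrt n\to0$ and every measurable $A\subset\mathbb R$, $$-\inf_{z\in A^{\mathrm o}}\frac{z^2}{2\tilde{\mathcal V}(h)}\le\liminf_{n\to\infty}\frac1{a_n^2}\log\mathbb P\Big(\tfrac{\sqrt n}{a_n}[\mathcal E^{\eta,x}_n(h)-\tilde\mu_\eta(h)]\in A\Big)\le\limsup_{n\to\infty}\frac1{a_n^2}\log\mathbb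 P\Big(\tfrac{\sqrt n}{a_n}[\mathcal E^{\eta,x}_n(h)-\tilde\mu_\eta(h)]\in A\Big)\le-\inf_{z\in\bar A}\frac{z^2}{2\tilde{\mathcal V}(h)}.$$
   Context: Fix $d\ge1$, $\alpha>0$, $\beta\in\mathbb R$, $p\in\mathbb R^d$ with nonnegative entries summing to $1$, $\mathrm e=(1,\dots,1)'$, positive rates $v$, a sub-stochastic matrix $P$ with $P_{ii}=0$ and $I-P$ invertible; $R=(I-P')\mathrm{diag}(v)$, assume $\mathrm e'R^{-1}p=1$, $\gamma=R^{-1}p$. $\sigma$ is a $d\times d$ matrix with $\sigma\sigma'=\mathrm{diag}(p)c_a^2+H^{(0)}+\sum_{k}\gamma_kv_kH^{(k)}+(I-P')\mathrm{diag}(v)\mathrm{diag}(\gamma)(I-P)$, $c_a^2>0$, $H^{(k)}_{ii}=P_{ki}(1-P_{ki})$, $H^{(k)}_{ij}=-P_{ki}P_{kj}$ ($i\ne j$), $H^{(0)}_{ii}=p_i(1-p_i)$, $H^{(0)}_{ij}=-p_ip_j$ ($i\ne j$), and $\xi'\sigma\sigma'\xi\ge c\,\xi'\xi$ for some $c>0$. $g(x)=-\beta p-Rx+(R-\alpha I)p(\mathrm e'x)^+$. The Euler–Maruyama chain is $\tilde X^\eta_{k+1}=\tilde X^\eta_k+g(\tilde X^\eta_k)\eta+\sqrt\eta\sigma\xi_{k+1}$ with i.i.d. standard Gaussian $\xi_k$; $\tilde X^{\eta,x}$ denotes it started at $x$; $\tilde{\mathcal P}_\eta\varphi(x)=\mathbb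 E\varphi(\tilde X^{\eta,x}_1)$, $\tilde{\mathcal P}^k_\eta$ its $k$-th iterate; $\mathcal E^{\eta,x}_n(h)=\frac1n\sum_{k=1}^nh(\tilde X^{\eta,x}_k)$; $\langle f_1,f_2\rangle_\nu=\int f_1f_2\,\mathrm d\nu$; $A^{\mathrm o},\bar A$ are interior and closure. *)

theory Defs
  imports "HOL-Probability.Probability"
begin

definition diag_mat :: "real^'d \<Rightarrow> real^'d^'d" where
  "diag_mat v = (\<chi> i j. if i = j then v$i else 0)"

definition ones :: "real^'d" where
  "ones = (\<chi> i. 1)"

definition H0 :: "real^'d \<Rightarrow> real^'d^'d" where
  "H0 p = (\<chi> i j. if i = j then p$i * (1 - p$i) else - (p$i * p$j))"

definition Hk :: "real^'d^'d \<Rightarrow> 'd \<Rightarrow> real^'d^'d" where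
  "Hk P k = (\<chi> i j. if i = j then P$k$i * (1 - P$k$i) else - (P$k$i * P$k$j))"

definition drift :: "real \<Rightarrow> real \<Rightarrow> real^'d \<Rightarrow> real^'d^'d \<Rightarrow> real^'d \<Rightarrow> real^'d" where
  "drift \<alpha> \<beta> p R x = - (\<beta> *\<^sub>R p) - R *v x
      + max 0 (ones \<bullet> x) *\<^sub>R ((R - \<alpha> *\<^sub>R mat 1) *v p)"

definition std_gauss :: "(real^'d) measure" where
  "std_gauss = distr (PiM (UNIV::'d set) (\<lambda>_. density lborel (normal_density 0 1)))
                     borel (\<lambda>\<omega>. \<chi> i. \<omega> i)"

definition em_kernel :: "(real^'d \<Rightarrow> real^'d) \<Rightarrow> real^'d^'d \<Rightarrow> real \<Rightarrow> real^'d \<Rightarrow> (real^'d) measure" where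
  "em_kernel g \<sigma> \<eta> x = distr std_gauss borel (\<lambda>z. x + \<eta> *\<^sub>R g x + sqrt \<eta> *\<^sub>R (\<sigma> *v z))"

definition em_op :: "(real^'d \<Rightarrow> real^'d) \<Rightarrow> real^'d^'d \<Rightarrow> real \<Rightarrow> (real^'d \<Rightarrow> real) \<Rightarrow> real^'d \<Rightarrow> real" where
  "em_op g \<sigma> \<eta> \<phi> x = (\<integral>y. \<phi> y \<partial>em_kernel g \<sigma> \<eta> x)"

text \<open>Probability space carrying the i.i.d. Gaussian innovations xi_1, xi_2, ...
  (xi_k is the k-th coordinate; coordinate 0 is unused).\<close>
definition path_space :: "(nat \<Rightarrow> real^'d) measure" where
  "path_space = PiM (UNIV::nat set) (\<lambda>_. std_gauss)"

primrec em_chain :: "(real^'d \<Rightarrow> real^'d) \<Rightarrow> real^'d^'d \<Rightarrow> real \<Rightarrow> real^'d \<Rightarrow> nat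
      \<Rightarrow> (nat \<Rightarrow> real^'d) \<Rightarrow> real^'d" where
  "em_chain g \<sigma> \<eta> x 0 \<omega> = x"
| "em_chain g \<sigma> \<eta> x (Suc k) \<omega> =
     em_chain g \<sigma> \<eta> x k \<omega> + \<eta> *\<^sub>R g (em_chain g \<sigma> \<eta> x k \<omega>)
       + sqrt \<eta> *\<^sub>R (\<sigma> *v \<omega> (Suc k))"

definition emp_avg :: "(real^'d \<Rightarrow> real^'d) \<Rightarrow> real^'d^'d \<Rightarrow> real \<Rightarrow> real^'d
      \<Rightarrow> (real^'d \<Rightarrow> real) \<Rightarrow> nat \<Rightarrow> (nat \<Rightarrow> real^'d) \<Rightarrow> real" where
  "emp_avg g \<sigma> \<eta> x h n \<omega> = (\<Sum>k=1..n. h (em_chain g \<sigma> \<eta> x k \<omega>)) / real n"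

definition invariant_prob :: "(real^'d \<Rightarrow> real^'d) \<Rightarrow> real^'d^'d \<Rightarrow> real \<Rightarrow> (real^'d) measure \<Rightarrow> bool" where
  "invariant_prob g \<sigma> \<eta> \<mu> \<longleftrightarrow> prob_space \<mu> \<and> sets \<mu> = sets borel \<and>
     (\<forall>B\<in>sets borel. emeasure \<mu> B = (\<integral>\<^sup>+x. emeasure (em_kernel g \<sigma> \<eta> x) B \<partial>\<mu>))"

definition gauss_law :: "real \<Rightarrow> real measure" where
  "gauss_law V = (if V = 0 then return lborel 0 else density lborel (normal_density 0 (sqrt V)))"

definition mdp_rate :: "real \<Rightarrow> real \<Rightarrow> ereal" where
  "mdp_rate V z = (if V = 0 then (if z = 0 then 0 else \<infinity>) else ereal (z^2 / (2 * V)))"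

definition elog :: "real \<Rightarrow> ereal" where
  "elog t = (if t = 0 then -\<infinity> else ereal (ln t))"

end

theory Submission
  imports Defs
begin

text \<open>
  The noiseless Euler step is, up to a constant, a positively homogeneous map that does not increase the
  \<open>l1\<close> norm of \<open>x - p (e'x)\<^sup>+\<close>. LaSalle's principle and compactness of the sphere turn this into a Lipschitz
  Lyapunov function, and the Gaussian noise minorizes the kernel on bounded sets, so Harris' theorem gives
  geometric ergodicity in a weighted supremum norm, hence the invariant law and the Poisson equation.

  For a bounded centred observable \<open>g\<close> and a small complex \<open>t\<close>, the moments \<open>E exp (t (g X\<^sub>1 + \<dots> + g X\<^sub>n))\<close> are
  iterates of the kernel weighted by \<open>exp (t g)\<close>. A second order expansion of the normalized iterates gives
  \<open>exp (n t\<^sup>2 V / 2 + O(t\<^sup>2 + n t\<^sup>3)) (1 + O(t))\<close> uniformly in \<open>n\<close>. With \<open>t = i u / sqrt n\<close> this is the central limit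
  theorem by Levy continuity; with \<open>t = l a\<^sub>n / sqrt n\<close> it is the limit of logarithmic moments from which the
  moderate deviation bounds follow by exponential tilting.
\<close>

section \<open>Large deviations from a quadratic limit of logarithmic moments\<close>

text \<open>The difficulty is uniformity in \<open>n\<close>. With \<open>t\<close> of order
  \<open>a n / sqrt n\<close> the exponent \<open>n t^2 V / 2\<close> diverges, so an expansion for
  each fixed \<open>n\<close> is useless: the error of one step must be third order in
  \<open>t\<close>, up to terms summable over the steps. Normalizing to mean one achieves this. The
  correction then has invariant mean 0, its recursion is driven by centred terms, and the kernel
  contracts those geometrically, so corrections do not accumulate. Allowing complex \<open>t\<close>
  lets one expansion serve both limit theorems.

  For the drift, the switch (e'x)^+ makes the noiseless step piecewise linear, and a Lyapunov
  function has to fit both regimes and every crossing between them. The \<open>l1\<close> quantity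
  does, but it can stay constant over many steps and does not control the queue. Hence the equality
  case is analysed along whole orbits, the queue is treated as a perturbed contraction, and a strict
  one-step decrease is recovered only for a weighted sum of norms along the orbit.\<close>

lemma elog_le: "0 \<le> q \<Longrightarrow> q \<le> exp r \<Longrightarrow> elog q \<le> ereal r"
  by (auto simp: elog_def) (metis exp_le_cancel_iff exp_ln le_less)

lemma elog_ge: "exp r \<le> q \<Longrightarrow> ereal r \<le> elog q"
  by (auto simp: elog_def) (metis exp_gt_zero exp_le_cancel_iff exp_ln order_less_le_trans)

lemma exp_half_diff_le: "exp b / 2 \<le> exp a * q \<Longrightarrow> exp (b - a) / 2 \<le> (q::real)"
  by (simp add: exp_diff field_simps)

locale quadratic_mgf = prob_space M for M :: "'a measure" +
  fixes Y :: "nat \<Rightarrow> 'a \<Rightarrow> real" and s :: "nat \<Rightarrow> real" and V :: real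
  assumes Y_meas[measurable]: "Y n \<in> borel_measurable M"
    and s_top: "filterlim s at_top sequentially"
    and Vnn: "V \<ge> 0"
    and mgf_int: "integrable M (\<lambda>\<omega>. exp (l * s n * Y n \<omega>))"
    and mgf_lim: "(\<lambda>n. ln (\<integral>\<omega>. exp (l * s n * Y n \<omega>) \<partial>M) / s n) \<longlonglongrightarrow> l\<^sup>2 * V / 2"
begin

definition mgf where "mgf n l = (\<integral>\<omega>. exp (l * s n * Y n \<omega>) \<partial>M)"

lemma mgf_pos: "mgf n l > 0"
proof -
  have nn: "AE \<omega> in M. 0 \<le> exp (l * s n * Y n \<omega>)" by simp
  have "mgf n l \<noteq> 0"
  proof
    assume "mgf n l = 0"
    then have "AE \<omega> in M. exp (l * s n * Y n \<omega>) = 0"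
      unfolding mgf_def integral_nonneg_eq_0_iff_AE[OF mgf_int nn] .
    then show False by simp
  qed
  moreover have "mgf n l \<ge> 0" unfolding mgf_def by (rule integral_nonneg_AE[OF nn])
  ultimately show ?thesis by simp
qed

lemma s_pos: "eventually (\<lambda>n. s n > 0) sequentially"
  using s_top by (simp add: filterlim_at_top_dense)

lemma mgf_upper:
  assumes "l\<^sup>2 * V / 2 < r"
  shows "eventually (\<lambda>n. mgf n l \<le> exp (s n * r)) sequentially"
proof -
  have "eventually (\<lambda>n. ln (mgf n l) / s n < r) sequentially"
    using order_tendstoD(2)[OF mgf_lim assms] by (simp add: mgf_def)
  with s_pos show ?thesis
  proof eventually_elim
    case (elim n)
    then have "ln (mgf n l) \<le> s n * r" by (simp add: field_simps)
    then show ?case using mgf_pos[of n l] by (metis exp_le_cancel_iff exp_ln)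
  qed
qed

lemma mgf_lower:
  assumes "r < l\<^sup>2 * V / 2"
  shows "eventually (\<lambda>n. exp (s n * r) \<le> mgf n l) sequentially"
proof -
  have "eventually (\<lambda>n. r < ln (mgf n l) / s n) sequentially"
    using order_tendstoD(1)[OF mgf_lim assms] by (simp add: mgf_def)
  with s_pos show ?thesis
  proof eventually_elim
    case (elim n)
    then have "ln (mgf n l) \<ge> s n * r" by (simp add: field_simps)
    then show ?case using mgf_pos[of n l] by (metis exp_le_cancel_iff exp_ln)
  qed
qed

text \<open>Chernoff's bound under the weight \<open>exp (l * s n * Y n \<omega>)\<close>. The sign
  of \<open>k\<close> selects the half line, so both tails are covered; \<open>l = 0\<close> gives
  the untilted bound.\<close>

lemma tilted_markov:
  assumes D: "D \<in> sets M" and s: "s n > 0" and k: "\<And>\<omega>. \<omega> \<in> D \<Longrightarrow> b \<le> k * Y n \<omega>"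
  shows "(\<integral>\<omega>. exp (l * s n * Y n \<omega>) * indicator D \<omega> \<partial>M) \<le> exp (- s n * b) * mgf n (l + k)"
proof -
  have "(\<integral>\<omega>. exp (l * s n * Y n \<omega>) * indicator D \<omega> \<partial>M)
      \<le> (\<integral>\<omega>. exp (- s n * b) * exp ((l + k) * s n * Y n \<omega>) \<partial>M)"
  proof (rule integral_mono)
    show "integrable M (\<lambda>\<omega>. exp (l * s n * Y n \<omega>) * indicator D \<omega>)"
      using D by (intro integrable_mult_indicator[where 'b=real, simplified mult.commute real_scaleR_def] mgf_int)
    show "integrable M (\<lambda>\<omega>. exp (- s n * b) * exp ((l + k) * s n * Y n \<omega>))"
      by (intro integrable_mult_right mgf_int)
    fix \<omega> show "exp (l * s n * Y n \<omega>) * indicator D \<omega> \<le> exp (- s n * b) * exp ((l + k) * s n * Y n \<omega>)"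
    proof (cases "\<omega> \<in> D")
      case True
      then have "s n * b \<le> s n * (k * Y n \<omega>)" using k s by (intro mult_left_mono) auto
      then show ?thesis using True by (simp add: exp_add[symmetric] algebra_simps)
    qed simp
  qed
  then show ?thesis by (simp add: mgf_def)
qed

lemma tail_upper:
  assumes k: "\<And>n. {\<omega> \<in> space M. b \<le> k * Y n \<omega>} \<in> sets M" and r: "(l + k)\<^sup>2 * V / 2 - b < r"
  shows "eventually (\<lambda>n. (\<integral>\<omega>. exp (l * s n * Y n \<omega>) * indicator {\<omega> \<in> space M. b \<le> k * Y n \<omega>} \<omega> \<partial>M)
     \<le> exp (s n * r)) sequentially"
proof -
  have "eventually (\<lambda>n. mgf n (l + k) \<le> exp (s n * (r + b))) sequentially"
    by (rule mgf_upper) (use r in linarith)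
  with s_pos show ?thesis
  proof eventually_elim
    case (elim n)
    have "(\<integral>\<omega>. exp (l * s n * Y n \<omega>) * indicator {\<omega> \<in> space M. b \<le> k * Y n \<omega>} \<omega> \<partial>M)
       \<le> exp (- s n * b) * mgf n (l + k)"
      using elim k by (intro tilted_markov) auto
    also have "\<dots> \<le> exp (- s n * b) * exp (s n * (r + b))" using elim by (intro mult_left_mono) auto
    also have "\<dots> = exp (s n * r)" by (simp add: exp_add[symmetric] algebra_simps)
    finally show ?case .
  qed
qed

lemma tail_prob:
  assumes "k\<^sup>2 * V / 2 - b < r"
  shows "eventually (\<lambda>n. prob {\<omega> \<in> space M. b \<le> k * Y n \<omega>} \<le> exp (s n * r)) sequentially"
proof -
  have [measurable]: "{\<omega> \<in> space M. b \<le> k * Y n \<omega>} \<in> sets M" for n by measurable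
  show ?thesis using tail_upper[of b k 0 r] assms by simp
qed

lemma two_sided_tail:
  assumes l: "l \<ge> 0" and r: "l\<^sup>2 * V / 2 - l * \<delta> < r"
  shows "eventually (\<lambda>n. prob {\<omega> \<in> space M. \<delta> \<le> \<bar>Y n \<omega>\<bar>} \<le> 2 * exp (s n * r)) sequentially"
proof -
  have 1: "eventually (\<lambda>n. prob {\<omega> \<in> space M. l * \<delta> \<le> l * Y n \<omega>} \<le> exp (s n * r)) sequentially"
    by (rule tail_prob) (rule r)
  have 2: "eventually (\<lambda>n. prob {\<omega> \<in> space M. l * \<delta> \<le> - l * Y n \<omega>} \<le> exp (s n * r)) sequentially"
    by (rule tail_prob) (use r in simp)
  from 1 2 show ?thesis
  proof eventually_elim
    case (elim n)
    have "prob {\<omega> \<in> space M. \<delta> \<le> \<bar>Y n \<omega>\<bar>} \<le>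
      prob ({\<omega> \<in> space M. l * \<delta> \<le> l * Y n \<omega>} \<union> {\<omega> \<in> space M. l * \<delta> \<le> - l * Y n \<omega>})"
    proof (intro finite_measure_mono subsetI)
      fix \<omega> assume "\<omega> \<in> {\<omega> \<in> space M. \<delta> \<le> \<bar>Y n \<omega>\<bar>}"
      then have "\<omega> \<in> space M" "\<delta> \<le> Y n \<omega> \<or> \<delta> \<le> - Y n \<omega>" by auto
      then show "\<omega> \<in> {\<omega> \<in> space M. l * \<delta> \<le> l * Y n \<omega>} \<union> {\<omega> \<in> space M. l * \<delta> \<le> - l * Y n \<omega>}"
        using mult_left_mono[OF _ l, of \<delta> "Y n \<omega>"] mult_left_mono[OF _ l, of \<delta> "- Y n \<omega>"] by auto
    qed measurable
    also have "\<dots> \<le> prob {\<omega> \<in> space M. l * \<delta> \<le> l * Y n \<omega>} + prob {\<omega> \<in> space M. l * \<delta> \<le> - l * Y n \<omega>}"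
      by (intro measure_Un_le) measurable
    finally show ?case using elim by linarith
  qed
qed

text \<open>Cramer's change of measure: under the weight \<open>exp (l * s n * Y n \<omega>)\<close>
  the variable concentrates at \<open>l * V\<close>, the derivative of
  \<open>l\<^sup>2 * V / 2\<close>. The mass outside the window is exponentially smaller than the
  total, and inside it the weight is at most
  \<open>exp (s n * (l * z + \<bar>l\<bar> * \<epsilon>))\<close>; dividing by this bounds the
  probability from below.\<close>

lemma local_lower:
  assumes z: "z = l * V" and e: "\<epsilon> > 0" and r: "r < - (l\<^sup>2 * V / 2) - \<bar>l\<bar> * \<epsilon>"
  shows "eventually (\<lambda>n. exp (s n * r) \<le> prob {\<omega> \<in> space M. \<bar>Y n \<omega> - z\<bar> < \<epsilon>}) sequentially"
proof -
  \<comment> \<open>The best second tilt would be \<open>\<epsilon> / V\<close>; the added 1 keeps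
    the choice meaningful for \<open>V = 0\<close> and still leaves a strict gain.\<close>
  define k where "k = \<epsilon> / (V + 1)"
  have k: "k > 0" "k * V < \<epsilon>" "k\<^sup>2 * V / 2 - k * \<epsilon> < 0"
  proof -
    show "k > 0" using e Vnn by (simp add: k_def)
    show *: "k * V < \<epsilon>" using e Vnn by (simp add: k_def field_simps)
    have "k * (k * V) / 2 < k * \<epsilon>" using mult_strict_left_mono[OF * \<open>k > 0\<close>] \<open>k > 0\<close> e by (simp add: field_simps)
    then show "k\<^sup>2 * V / 2 - k * \<epsilon> < 0" by (simp add: power2_eq_square mult.assoc)
  qed
  define L where "L = l\<^sup>2 * V / 2"
  define d where "d = (k * \<epsilon> - k\<^sup>2 * V / 2)"
  have d: "d > 0" using k by (simp add: d_def)
  define G where "G = - (l\<^sup>2 * V / 2) - \<bar>l\<bar> * \<epsilon>"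
  have rG: "r < G" using r by (simp add: G_def)
  \<comment> \<open>\<open>d\<close> is the exponential gain of the tails, \<open>G - r\<close> the
    slack in the claim. A quarter of the smaller one separates the tails
    (\<open>L - 2 * \<delta>\<close>) from the total mass (\<open>L - \<delta>\<close>) and leaves
    another \<open>\<delta>\<close> to pay for a factor 1/2.\<close>
  define \<delta> where "\<delta> = min d (G - r) / 4"
  have \<delta>: "\<delta> > 0" "\<delta> \<le> d / 4" "r + 2 * \<delta> \<le> G"
  proof -
    have "\<delta> \<le> (G - r) / 4" by (simp add: \<delta>_def)
    then show "r + 2 * \<delta> \<le> G" using rG by argo
  qed (use d rG in \<open>auto simp: \<delta>_def\<close>)
  have b1: "(l + k)\<^sup>2 * V / 2 - k * (z + \<epsilon>) = L - d"
    unfolding z L_def d_def power2_eq_square by (simp add: algebra_simps add_divide_distrib diff_divide_distrib)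
  have b2: "(l + - k)\<^sup>2 * V / 2 - - k * (z - \<epsilon>) = L - d"
    unfolding z L_def d_def power2_eq_square by (simp add: algebra_simps add_divide_distrib diff_divide_distrib)
  define U where "U n = {\<omega> \<in> space M. k * (z + \<epsilon>) \<le> k * Y n \<omega>}" for n
  define D where "D n = {\<omega> \<in> space M. - k * (z - \<epsilon>) \<le> - k * Y n \<omega>}" for n
  define B where "B n = {\<omega> \<in> space M. \<bar>Y n \<omega> - z\<bar> < \<epsilon>}" for n
  have [measurable]: "U n \<in> sets M" "D n \<in> sets M" "B n \<in> sets M" for n
    unfolding U_def D_def B_def by measurable
  have E1: "eventually (\<lambda>n. (\<integral>\<omega>. exp (l * s n * Y n \<omega>) * indicator (U n) \<omega> \<partial>M) \<le> exp (s n * (L - 2 * \<delta>))) sequentially"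
    unfolding U_def
  proof (rule tail_upper)
    show "(l + k)\<^sup>2 * V / 2 - k * (z + \<epsilon>) < L - 2 * \<delta>" unfolding b1 using \<delta> d by linarith
  qed measurable
  have E2: "eventually (\<lambda>n. (\<integral>\<omega>. exp (l * s n * Y n \<omega>) * indicator (D n) \<omega> \<partial>M) \<le> exp (s n * (L - 2 * \<delta>))) sequentially"
    unfolding D_def
  proof (rule tail_upper)
    show "(l + - k)\<^sup>2 * V / 2 - - k * (z - \<epsilon>) < L - 2 * \<delta>" unfolding b2 using \<delta> d by linarith
  qed measurable
  have E3: "eventually (\<lambda>n. exp (s n * (L - \<delta>)) \<le> mgf n l) sequentially"
    by (rule mgf_lower) (use \<delta> in \<open>simp add: L_def\<close>)
  \<comment> \<open>Once \<open>exp (s n * \<delta>)\<close> is at least 4, the two tails together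
    take at most half of the tilted mass.\<close>
  have E4: "eventually (\<lambda>n. ln 4 / \<delta> \<le> s n) sequentially"
    using s_top by (simp add: filterlim_at_top)
  from E1 E2 E3 E4 s_pos have "eventually (\<lambda>n. exp (s n * r) \<le> prob (B n)) sequentially"
  proof eventually_elim
    case (elim n)
    let ?f = "\<lambda>\<omega>. exp (l * s n * Y n \<omega>)"
    have ii: "integrable M (\<lambda>\<omega>. ?f \<omega> * indicator X \<omega>)" if "X \<in> sets M" for X
      using that by (intro integrable_mult_indicator[where 'b=real, simplified mult.commute real_scaleR_def] mgf_int)
    have "mgf n l \<le> (\<integral>\<omega>. ?f \<omega> * indicator (B n) \<omega> + ?f \<omega> * indicator (U n) \<omega> + ?f \<omega> * indicator (D n) \<omega> \<partial>M)"
      unfolding mgf_def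
    proof (rule integral_mono_AE[OF mgf_int])
      show "integrable M (\<lambda>\<omega>. ?f \<omega> * indicator (B n) \<omega> + ?f \<omega> * indicator (U n) \<omega> + ?f \<omega> * indicator (D n) \<omega>)"
        by (intro Bochner_Integration.integrable_add ii) auto
      show "AE \<omega> in M. ?f \<omega> \<le> ?f \<omega> * indicator (B n) \<omega> + ?f \<omega> * indicator (U n) \<omega> + ?f \<omega> * indicator (D n) \<omega>"
      proof (rule AE_I2)
        fix \<omega> assume w: "\<omega> \<in> space M"
        consider "\<omega> \<in> B n" | "\<omega> \<in> U n" | "\<omega> \<in> D n"
          using w k(1) unfolding B_def U_def D_def by fastforce
        then show "?f \<omega> \<le> ?f \<omega> * indicator (B n) \<omega> + ?f \<omega> * indicator (U n) \<omega> + ?f \<omega> * indicator (D n) \<omega>"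
          by cases (auto simp: indicator_def)
      qed
    qed
    also have "\<dots> = (\<integral>\<omega>. ?f \<omega> * indicator (B n) \<omega> \<partial>M) + (\<integral>\<omega>. ?f \<omega> * indicator (U n) \<omega> \<partial>M)
       + (\<integral>\<omega>. ?f \<omega> * indicator (D n) \<omega> \<partial>M)"
      by (simp add: ii)
    finally have A: "exp (s n * (L - \<delta>)) - 2 * exp (s n * (L - 2 * \<delta>)) \<le> (\<integral>\<omega>. ?f \<omega> * indicator (B n) \<omega> \<partial>M)"
      using elim by linarith
    have "(\<integral>\<omega>. ?f \<omega> * indicator (B n) \<omega> \<partial>M) \<le> (\<integral>\<omega>. exp (s n * (l * z + \<bar>l\<bar> * \<epsilon>)) * indicator (B n) \<omega> \<partial>M)"
    proof (rule integral_mono[OF ii])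
      fix \<omega>
      show "?f \<omega> * indicator (B n) \<omega> \<le> exp (s n * (l * z + \<bar>l\<bar> * \<epsilon>)) * indicator (B n) \<omega>"
      proof (cases "\<omega> \<in> B n")
        case True
        then have "l * (Y n \<omega> - z) \<le> \<bar>l\<bar> * \<epsilon>"
          by (metis (mono_tags, lifting) B_def abs_ge_self abs_ge_zero abs_mult less_imp_le mem_Collect_eq mult_left_mono order_trans)
        then have "s n * (l * Y n \<omega>) \<le> s n * (l * z + \<bar>l\<bar> * \<epsilon>)"
          using elim by (intro mult_left_mono) (auto simp: algebra_simps)
        then show ?thesis using True by (simp add: mult_ac)
      qed simp
      show "integrable M (\<lambda>\<omega>. exp (s n * (l * z + \<bar>l\<bar> * \<epsilon>)) * indicator (B n) \<omega>)"
        by (intro integrable_mult_right integrable_real_indicator) (simp_all add: emeasure_eq_measure)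
    qed simp
    also have "\<dots> = exp (s n * (l * z + \<bar>l\<bar> * \<epsilon>)) * prob (B n)" by simp
    finally have B: "(\<integral>\<omega>. ?f \<omega> * indicator (B n) \<omega> \<partial>M) \<le> exp (s n * (l * z + \<bar>l\<bar> * \<epsilon>)) * prob (B n)" .
    have "ln 4 \<le> s n * \<delta>" using elim \<delta>(1) by (simp add: field_simps)
    then have "4 \<le> exp (s n * \<delta>)" by (metis exp_gt_zero ln_exp ln_le_cancel_iff zero_less_numeral)
    then have "4 * exp (s n * (L - 2 * \<delta>)) \<le> exp (s n * \<delta>) * exp (s n * (L - 2 * \<delta>))"
      by (intro mult_right_mono) auto
    also have "\<dots> = exp (s n * (L - \<delta>))" by (simp add: exp_add[symmetric] algebra_simps)
    finally have "2 * exp (s n * (L - 2 * \<delta>)) \<le> exp (s n * (L - \<delta>)) - 2 * exp (s n * (L - 2 * \<delta>))" by simp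
    with A B have "exp (s n * (L - \<delta>)) / 2 \<le> exp (s n * (l * z + \<bar>l\<bar> * \<epsilon>)) * prob (B n)"
      using \<open>4 * exp (s n * (L - 2 * \<delta>)) \<le> exp (s n * \<delta>) * exp (s n * (L - 2 * \<delta>))\<close>
        \<open>exp (s n * \<delta>) * exp (s n * (L - 2 * \<delta>)) = exp (s n * (L - \<delta>))\<close> by linarith
    then have "exp (s n * (L - \<delta>) - s n * (l * z + \<bar>l\<bar> * \<epsilon>)) / 2 \<le> prob (B n)"
      by (rule exp_half_diff_le)
    then have C: "exp (s n * (L - \<delta> - (l * z + \<bar>l\<bar> * \<epsilon>))) / 2 \<le> prob (B n)"
      by (simp only: right_diff_distrib)
    have "2 * exp (s n * r) \<le> exp (s n * \<delta>) * exp (s n * r)"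
      using \<open>4 \<le> exp (s n * \<delta>)\<close> by (intro mult_right_mono) auto
    also have "\<dots> = exp (s n * (r + \<delta>))" by (simp add: exp_add[symmetric] algebra_simps)
    also have "\<dots> \<le> exp (s n * (L - \<delta> - (l * z + \<bar>l\<bar> * \<epsilon>)))"
    proof -
      have "L - l * z = - (l\<^sup>2 * V / 2)" by (simp add: L_def z power2_eq_square)
      then have "r + \<delta> \<le> L - \<delta> - (l * z + \<bar>l\<bar> * \<epsilon>)"
        using \<delta>(3) unfolding G_def by linarith
      then show ?thesis using elim by simp
    qed
    finally show ?case using C by simp
  qed
  then show ?thesis by (simp add: B_def)
qed

text \<open>The points of finite rate are those of the form \<open>l * V\<close>, the centres
  reachable by a tilt. For \<open>V = 0\<close> only 0 remains and any \<open>l\<close> represents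
  it, which is harmless because the window is chosen after \<open>l\<close>.\<close>

lemma ldp_lower:
  assumes A: "A \<in> sets borel"
  shows "- (INF z\<in>interior A. mdp_rate V z)
     \<le> liminf (\<lambda>n. elog (prob {\<omega> \<in> space M. Y n \<omega> \<in> A}) / ereal (s n))"
proof -
  have "- mdp_rate V z \<le> liminf (\<lambda>n. elog (prob {\<omega> \<in> space M. Y n \<omega> \<in> A}) / ereal (s n))"
    (is "_ \<le> ?L") if z: "z \<in> interior A" for z
  proof (cases "\<exists>l. z = l * V")
    case False
    then have "V = 0" "z \<noteq> 0" by (metis nonzero_divide_eq_eq) (metis False mult_zero_left)
    then show ?thesis by (simp add: mdp_rate_def)
  next
    case True
    then obtain l where l: "z = l * V" by blast
    have rate: "mdp_rate V z = ereal (l\<^sup>2 * V / 2)"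
      by (auto simp: mdp_rate_def l power2_eq_square zero_ereal_def)
    obtain e where e: "e > 0" "ball z e \<subseteq> A" using z by (auto simp: mem_interior)
    show ?thesis unfolding rate
    proof (rule ereal_le_epsilon2)
      fix d :: real assume d: "d > 0"
      \<comment> \<open>The cap by \<open>e\<close> keeps the window inside \<open>A\<close>; adding
        1 to \<open>\<bar>l\<bar>\<close> avoids a zero divisor.\<close>
      define \<epsilon> where "\<epsilon> = min e (d / (2 * (\<bar>l\<bar> + 1)))"
      have \<epsilon>: "\<epsilon> > 0" "\<epsilon> \<le> e" using e d by (auto simp: \<epsilon>_def)
      have "\<bar>l\<bar> * \<epsilon> \<le> (\<bar>l\<bar> + 1) * (d / (2 * (\<bar>l\<bar> + 1)))"
        using \<epsilon>(1) by (intro mult_mono) (auto simp: \<epsilon>_def)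
      also have "\<dots> = d / 2" by (simp add: field_simps)
      finally have le: "\<bar>l\<bar> * \<epsilon> \<le> d / 2" .
      have "eventually (\<lambda>n. exp (s n * (- (l\<^sup>2 * V / 2) - d)) \<le> prob {\<omega> \<in> space M. \<bar>Y n \<omega> - z\<bar> < \<epsilon>}) sequentially"
        using le d by (intro local_lower[OF l \<epsilon>(1)]) linarith
      with s_pos have "eventually (\<lambda>n. ereal (- (l\<^sup>2 * V / 2) - d)
          \<le> elog (prob {\<omega> \<in> space M. Y n \<omega> \<in> A}) / ereal (s n)) sequentially"
      proof eventually_elim
        case (elim n)
        have "prob {\<omega> \<in> space M. \<bar>Y n \<omega> - z\<bar> < \<epsilon>} \<le> prob {\<omega> \<in> space M. Y n \<omega> \<in> A}"
        proof (rule finite_measure_mono)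
          show "{\<omega> \<in> space M. Y n \<omega> \<in> A} \<in> sets M" using A by measurable
          have "y \<in> A" if "\<bar>y - z\<bar> < \<epsilon>" for y
            using that e(2) \<epsilon>(2) by (auto simp: dist_real_def subset_iff abs_minus_commute)
          then show "{\<omega> \<in> space M. \<bar>Y n \<omega> - z\<bar> < \<epsilon>} \<subseteq> {\<omega> \<in> space M. Y n \<omega> \<in> A}" by auto
        qed
        with elim have "ereal (s n * (- (l\<^sup>2 * V / 2) - d)) \<le> elog (prob {\<omega> \<in> space M. Y n \<omega> \<in> A})"
          by (intro elog_ge) linarith
        then show ?case using elim(1) by (subst ereal_le_divide_pos) auto
      qed
      then have "ereal (- (l\<^sup>2 * V / 2) - d) \<le> ?L" by (rule Liminf_bounded)
      then show "- ereal (l\<^sup>2 * V / 2) \<le> ?L + ereal d"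
        by (cases ?L) auto
    qed
  qed
  then show ?thesis
    unfolding ereal_uminus_le_reorder[of _ "liminf _"] by (rule INF_greatest)
qed

text \<open>The rate is monotone in the distance to 0, so its infimum over \<open>closure A\<close>
  is attained at a nearest point, and the two-sided tail beyond that distance suffices; no covering
  by half lines or compact sets is required. The empty set has no nearest point and is treated
  separately.\<close>

lemma ldp_upper:
  assumes A: "A \<in> sets borel"
  shows "limsup (\<lambda>n. elog (prob {\<omega> \<in> space M. Y n \<omega> \<in> A}) / ereal (s n))
     \<le> - (INF z\<in>closure A. mdp_rate V z)" (is "?L \<le> _")
proof (cases "A = {}")
  case True
  have "eventually (\<lambda>n. elog (prob {\<omega> \<in> space M. Y n \<omega> \<in> A}) / ereal (s n) \<le> -\<infinity>) sequentially"
    using s_pos by eventually_elim (simp add: True elog_def)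
  then have "?L \<le> -\<infinity>" by (rule Limsup_bounded)
  then show ?thesis by simp
next
  case False
  then obtain z where z: "z \<in> closure A" "\<And>y. y \<in> closure A \<Longrightarrow> dist 0 z \<le> dist 0 y"
    using distance_attains_inf[of "closure A" 0] closure_subset[of A] by blast
  define \<delta> where "\<delta> = \<bar>z\<bar>"
  have \<delta>: "\<delta> \<ge> 0" "\<And>y. y \<in> A \<Longrightarrow> \<delta> \<le> \<bar>y\<bar>"
    using z closure_subset[of A] by (auto simp: \<delta>_def dist_real_def)
  have main: "?L \<le> ereal r" if l: "l \<ge> 0" and r: "l\<^sup>2 * V / 2 - l * \<delta> < r" for l r
  proof -
    \<comment> \<open>The midpoint leaves room to absorb the factor 2 of the union bound.\<close>
    define r' where "r' = (r + (l\<^sup>2 * V / 2 - l * \<delta>)) / 2"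
    have r': "l\<^sup>2 * V / 2 - l * \<delta> < r'" "r' < r" unfolding r'_def using r by argo+
    have E: "eventually (\<lambda>n. ln 2 / (r - r') \<le> s n) sequentially"
      using s_top by (simp add: filterlim_at_top)
    have "eventually (\<lambda>n. elog (prob {\<omega> \<in> space M. Y n \<omega> \<in> A}) / ereal (s n) \<le> ereal r) sequentially"
      using s_pos two_sided_tail[OF l r'(1)] E
    proof eventually_elim
      case (elim n)
      have "prob {\<omega> \<in> space M. Y n \<omega> \<in> A} \<le> prob {\<omega> \<in> space M. \<delta> \<le> \<bar>Y n \<omega>\<bar>}"
        using \<delta>(2) by (intro finite_measure_mono) auto
      also have "\<dots> \<le> 2 * exp (s n * r')" by (rule elim)
      also have "\<dots> = exp (ln 2 + s n * r')" by (simp add: exp_add)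
      also have "\<dots> \<le> exp (s n * r)" using elim(3) r' by (simp add: field_simps)
      finally have "elog (prob {\<omega> \<in> space M. Y n \<omega> \<in> A}) \<le> ereal (s n * r)" by (intro elog_le) auto
      then show ?case using elim(1) by (subst ereal_divide_le_pos) auto
    qed
    then show ?thesis by (rule Limsup_bounded)
  qed
  have "?L \<le> - mdp_rate V z"
  proof (cases "V = 0")
    case V: True
    show ?thesis
    proof (cases "z = 0")
      case True
      have "?L \<le> 0 + ereal e" if "e > 0" for e using main[of 0 e] that by simp
      then have "?L \<le> 0" by (rule ereal_le_epsilon2)
      then show ?thesis using True V by (simp add: mdp_rate_def)
    next
      case False
      then have "\<delta> > 0" by (simp add: \<delta>_def)
      \<comment> \<open>Without variance a tilt has no quadratic cost, so large tilts give
        arbitrarily fast decay.\<close>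
      have "?L \<le> ereal B" for B
        using main[of "(\<bar>B\<bar> + 1) / \<delta>" B] V \<open>\<delta> > 0\<close> by simp
      then have "?L = -\<infinity>" by (rule ereal_bot)
      then show ?thesis by simp
    qed
  next
    case False
    then have V: "V > 0" using Vnn by simp
    \<comment> \<open>The tilt \<open>\<delta> / V\<close> minimizes
      \<open>l\<^sup>2 * V / 2 - l * \<delta>\<close>.\<close>
    have eq: "(\<delta> / V)\<^sup>2 * V / 2 - \<delta> / V * \<delta> = - (\<delta>\<^sup>2 / (2 * V))"
      using V by (simp add: power2_eq_square field_simps)
    have "?L \<le> ereal (- (\<delta>\<^sup>2 / (2 * V))) + ereal e" if "e > 0" for e
      using main[of "\<delta> / V" "- (\<delta>\<^sup>2 / (2 * V)) + e"] that V \<delta>(1) unfolding eq by simp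
    then have "?L \<le> ereal (- (\<delta>\<^sup>2 / (2 * V)))" by (rule ereal_le_epsilon2)
    then show ?thesis using V by (simp add: mdp_rate_def \<delta>_def)
  qed
  also have "\<dots> \<le> - (INF z\<in>closure A. mdp_rate V z)"
    using z(1) by (simp add: INF_lower)
  finally show ?thesis .
qed

end

section \<open>Harris chains\<close>

text \<open>Geometric drift together with minorization on every sublevel set of \<open>W\<close>:
  quantifying over \<open>R\<close> lets \<open>contraction\<close> choose the set after the drift
  constants are known.\<close>

locale harris_chain =
  fixes K :: "'a::topological_space \<Rightarrow> 'a measure" and W :: "'a \<Rightarrow> real" and \<gamma> C :: real
  assumes K_meas[measurable]: "K \<in> borel \<rightarrow>\<^sub>M subprob_algebra borel"
    and K_prob: "prob_space (K x)"
    and W_meas[measurable]: "W \<in> borel_measurable borel"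
    and W_ge1: "1 \<le> W x"
    and W_int: "integrable (K x) W"
    and \<gamma>01: "0 \<le> \<gamma>" "\<gamma> < 1" and C0: "0 \<le> C"
    and drift: "(\<integral>y. W y \<partial>K x) \<le> \<gamma> * W x + C"
    and minorization: "\<exists>\<epsilon>>0. \<exists>\<nu>. prob_space \<nu> \<and> sets \<nu> = sets borel \<and>
      (\<forall>x \<phi>. W x \<le> R \<longrightarrow> \<phi> \<in> borel_measurable borel \<longrightarrow>
         ennreal \<epsilon> * (\<integral>\<^sup>+y. \<phi> y \<partial>\<nu>) \<le> (\<integral>\<^sup>+y. \<phi> y \<partial>K x))"
begin

text \<open>Banach-valued arguments let one operator serve real observables and the complex weights
  of the transforms.\<close>

definition T :: "('a \<Rightarrow> 'b::{banach, second_countable_topology}) \<Rightarrow> 'a \<Rightarrow> 'b" where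
  "T \<phi> x = (\<integral>y. \<phi> y \<partial>K x)"

text \<open>Working with the square root of the Lyapunov function makes \<open>V\<close>-dominated functions square integrable
  under the invariant law, while \<open>V\<close> still satisfies a drift condition.\<close>

definition V :: "'a \<Rightarrow> real" where "V x = sqrt (W x)"

text \<open>The ball of radius \<open>c\<close> in the \<open>V\<close>-weighted supremum
  norm.\<close>

definition bnd :: "real \<Rightarrow> ('a \<Rightarrow> 'b::{banach, second_countable_topology}) \<Rightarrow> bool" where
  "bnd c \<phi> \<longleftrightarrow> \<phi> \<in> borel_measurable borel \<and> (\<forall>x. norm (\<phi> x) \<le> c * V x)"

definition invariant :: "'a measure \<Rightarrow> bool" where
  "invariant \<mu> \<longleftrightarrow> prob_space \<mu> \<and> sets \<mu> = sets borel \<and>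
     (\<forall>B\<in>sets borel. emeasure \<mu> B = (\<integral>\<^sup>+x. emeasure (K x) B \<partial>\<mu>))"

section \<open>The kernel as an operator on the weighted supremum norm\<close>

lemma sets_K[measurable_cong, simp]: "sets (K x) = sets borel"
  by (rule sets_kernel[OF K_meas]) simp

lemma space_K[simp]: "space (K x) = UNIV"
  using sets_eq_imp_space_eq[OF sets_K] by simp

lemma V_meas[measurable]: "V \<in> borel_measurable borel"
  unfolding V_def by measurable

lemma V_ge1: "1 \<le> V x"
  using W_ge1[of x] by (simp add: V_def)

lemma V_sq: "(V x)\<^sup>2 = W x"
  using W_ge1[of x] by (simp add: V_def)

lemma V_le_W: "V x \<le> W x"
  using self_le_power[OF V_ge1[of x], of 2] by (simp add: V_sq)

lemma V_int: "integrable (K x) V"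
proof (rule Bochner_Integration.integrable_bound[OF W_int])
  show "AE y in K x. norm (V y) \<le> norm (W y)"
    using V_ge1 V_le_W W_ge1 by (intro AE_I2) (smt (verit) real_norm_def)
qed simp

lemma bndI: "\<phi> \<in> borel_measurable borel \<Longrightarrow> (\<And>x. norm (\<phi> x) \<le> c * V x) \<Longrightarrow> bnd c \<phi>"
  by (simp add: bnd_def)

lemma bnd_meas: "bnd c \<phi> \<Longrightarrow> \<phi> \<in> borel_measurable borel"
  by (simp add: bnd_def)

lemma bndD: "bnd c \<phi> \<Longrightarrow> norm (\<phi> x) \<le> c * V x"
  by (simp add: bnd_def)

lemma bnd_nonneg: "bnd c \<phi> \<Longrightarrow> 0 \<le> c"
  using bndD[of c \<phi> undefined] V_ge1[of undefined] by (smt (verit) norm_ge_zero zero_le_mult_iff)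

lemma bnd_mono: "bnd c \<phi> \<Longrightarrow> c \<le> c' \<Longrightarrow> bnd c' \<phi>"
  unfolding bnd_def using V_ge1 by (meson mult_right_mono order_trans zero_le_one)

lemma bnd_bounded: "\<phi> \<in> borel_measurable borel \<Longrightarrow> 0 \<le> c \<Longrightarrow> (\<And>x. norm (\<phi> x) \<le> c) \<Longrightarrow> bnd c \<phi>"
  using V_ge1 by (intro bndI) (auto intro: order_trans[of _ c] simp: mult_le_cancel_left1)

lemma bnd_V: "bnd 1 V"
  using V_ge1 by (intro bndI) (auto simp: order_trans[OF zero_le_one])

lemma bnd_const: "bnd (norm a) (\<lambda>_. a)"
  by (rule bnd_bounded) auto

lemma bnd_add: "bnd c \<phi> \<Longrightarrow> bnd c' \<psi> \<Longrightarrow> bnd (c + c') (\<lambda>x. \<phi> x + \<psi> x)"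
  by (auto simp: bnd_def distrib_right intro!: order_trans[OF norm_triangle_ineq] add_mono)

lemma bnd_diff: "bnd c \<phi> \<Longrightarrow> bnd c' \<psi> \<Longrightarrow> bnd (c + c') (\<lambda>x. \<phi> x - \<psi> x)"
  by (auto simp: bnd_def distrib_right intro!: order_trans[OF norm_triangle_ineq4] add_mono)

lemma bnd_mult:
  fixes \<phi> \<psi> :: "'a \<Rightarrow> 'b::{banach, second_countable_topology, real_normed_algebra}"
  assumes "\<phi> \<in> borel_measurable borel" "\<And>x. norm (\<phi> x) \<le> b" "bnd c \<psi>"
  shows "bnd (b * c) (\<lambda>x. \<phi> x * \<psi> x)"
proof (rule bndI)
  have [measurable]: "\<psi> \<in> borel_measurable borel" using assms by (simp add: bnd_meas)
  show "(\<lambda>x. \<phi> x * \<psi> x) \<in> borel_measurable borel" using assms(1) by measurable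
  have "0 \<le> b" using assms(2) norm_ge_zero order_trans by blast
  then show "norm (\<phi> x * \<psi> x) \<le> b * c * V x" for x
    unfolding mult.assoc
    by (intro order_trans[OF norm_mult_ineq] mult_mono assms(2) bndD[OF assms(3)]) auto
qed

lemma bnd_int:
  assumes "bnd c \<phi>" shows "integrable (K x) \<phi>"
proof (rule Bochner_Integration.integrable_bound)
  show "integrable (K x) (\<lambda>y. c * V y)" using V_int by simp
  show "\<phi> \<in> borel_measurable (K x)" using bnd_meas[OF assms] by simp
  show "AE y in K x. norm (\<phi> y) \<le> norm (c * V y)"
    using bndD[OF assms] by (intro AE_I2) (metis abs_ge_self order_trans real_norm_def)
qed

lemma T_meas[measurable]:
  assumes [measurable]: "\<phi> \<in> borel_measurable borel" shows "T \<phi> \<in> borel_measurable borel"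
  unfolding T_def by (rule measurable_compose[OF K_meas]) measurable

lemma T_const[simp]: "T (\<lambda>_. a) = (\<lambda>_. a)"
  unfolding T_def using prob_space.prob_space[OF K_prob] by simp

lemma T_add: "bnd c \<phi> \<Longrightarrow> bnd c' \<psi> \<Longrightarrow> T (\<lambda>x. \<phi> x + \<psi> x) = (\<lambda>x. T \<phi> x + T \<psi> x)"
  unfolding T_def by (simp add: bnd_int)

lemma T_diff: "bnd c \<phi> \<Longrightarrow> bnd c' \<psi> \<Longrightarrow> T (\<lambda>x. \<phi> x - \<psi> x) = (\<lambda>x. T \<phi> x - T \<psi> x)"
  unfolding T_def by (simp add: bnd_int)

lemma T_cmult:
  fixes \<phi> :: "'a \<Rightarrow> 'b::{banach, second_countable_topology, real_normed_field}"
  shows "T (\<lambda>x. a * \<phi> x) = (\<lambda>x. a * T \<phi> x)"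
  unfolding T_def by simp

lemma T_mono:
  fixes \<phi> :: "'a \<Rightarrow> 'b::{banach, second_countable_topology}"
  assumes \<phi>: "\<phi> \<in> borel_measurable borel" and le: "\<And>x. norm (\<phi> x) \<le> U x" and U: "integrable (K x) U"
  shows "norm (T \<phi> x) \<le> T U x"
proof -
  have "integrable (K x) \<phi>"
  proof (rule Bochner_Integration.integrable_bound[OF U])
    show "\<phi> \<in> borel_measurable (K x)" using \<phi> by simp
    show "AE y in K x. norm (\<phi> y) \<le> norm (U y)"
      using le by (intro AE_I2) (metis abs_ge_self order_trans real_norm_def)
  qed
  then show ?thesis
    unfolding T_def by (intro order_trans[OF integral_norm_bound] integral_mono U integrable_norm le)
qed

section \<open>Drift of the square root and of iterates\<close>

definition \<kappa> where "\<kappa> = sqrt \<gamma>"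
text \<open>The added 1 makes \<open>L\<close> positive, since \<open>contraction\<close> divides by
  it.\<close>

definition L where "L = sqrt C + 1"

lemma \<kappa>01: "0 \<le> \<kappa>" "\<kappa> < 1" and L_pos: "0 < L"
  using \<gamma>01 C0 by (auto simp: \<kappa>_def L_def add_nonneg_pos)

text \<open>Jensen's inequality, as nonnegativity of a variance, bounds
  \<open>(T V x)\<^sup>2\<close> by \<open>T W x\<close>; subadditivity of the square root then
  splits the drift bound.\<close>

lemma TV: "T V x \<le> \<kappa> * V x + L"
proof -
  interpret prob_space "K x" by (rule K_prob)
  have "0 \<le> expectation (\<lambda>y. (V y)\<^sup>2) - (expectation V)\<^sup>2"
    using variance_positive[of V] variance_eq[OF V_int] W_int[of x] by (simp add: V_sq)
  then have "(T V x)\<^sup>2 \<le> T W x" by (simp add: T_def V_sq)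
  also have "\<dots> \<le> \<gamma> * W x + C" unfolding T_def by (rule drift)
  finally have "T V x \<le> sqrt (\<gamma> * W x + C)" by (rule real_le_rsqrt)
  also have "\<dots> \<le> sqrt (\<gamma> * W x) + sqrt C"
    using \<gamma>01 C0 W_ge1[of x] by (intro sqrt_add_le_add_sqrt) auto
  also have "\<dots> \<le> \<kappa> * V x + L" by (simp add: \<kappa>_def V_def L_def real_sqrt_mult)
  finally show ?thesis .
qed

lemma TV_le: "T V x \<le> (\<kappa> + L) * V x"
proof -
  have "L * 1 \<le> L * V x" using L_pos V_ge1[of x] by (intro mult_left_mono) auto
  then show ?thesis using TV[of x] by (simp add: algebra_simps)
qed

lemma bnd_T: "bnd c \<phi> \<Longrightarrow> bnd ((\<kappa> + L) * c) (T \<phi>)"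
proof (rule bndI)
  assume b: "bnd c \<phi>"
  show "T \<phi> \<in> borel_measurable borel" using bnd_meas[OF b] by measurable
  fix x
  have "norm (T \<phi> x) \<le> T (\<lambda>y. c * V y) x"
    using b by (intro T_mono integrable_mult_right V_int) (auto simp: bnd_def)
  also have "\<dots> = c * T V x" by (simp add: T_cmult)
  also have "\<dots> \<le> c * ((\<kappa> + L) * V x)" by (intro mult_left_mono TV_le bnd_nonneg[OF b])
  finally show "norm (T \<phi> x) \<le> (\<kappa> + L) * c * V x" by (simp add: mult_ac)
qed

lemma bnd_Tpow: "bnd c \<phi> \<Longrightarrow> bnd ((\<kappa> + L) ^ k * c) ((T ^^ k) \<phi>)"
  by (induction k) (auto simp: mult.assoc dest: bnd_T)

lemma Tpow_meas[measurable]: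
  "\<phi> \<in> borel_measurable borel \<Longrightarrow> (T ^^ k) \<phi> \<in> borel_measurable borel"
  by (induction k) auto

lemma Tpow_const[simp]: "(T ^^ k) (\<lambda>_. a) = (\<lambda>_. a)"
  by (induction k) auto

lemma Tpow_add: "bnd c \<phi> \<Longrightarrow> bnd c' \<psi> \<Longrightarrow>
    (T ^^ k) (\<lambda>x. \<phi> x + \<psi> x) = (\<lambda>x. (T ^^ k) \<phi> x + (T ^^ k) \<psi> x)"
  by (induction k) (auto simp: T_add[OF bnd_Tpow bnd_Tpow])

lemma Tpow_diff: "bnd c \<phi> \<Longrightarrow> bnd c' \<psi> \<Longrightarrow>
    (T ^^ k) (\<lambda>x. \<phi> x - \<psi> x) = (\<lambda>x. (T ^^ k) \<phi> x - (T ^^ k) \<psi> x)"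
  by (induction k) (auto simp: T_diff[OF bnd_Tpow bnd_Tpow])

lemma Tpow_cmult:
  fixes \<phi> :: "'a \<Rightarrow> 'b::{banach, second_countable_topology, real_normed_field}"
  shows "(T ^^ k) (\<lambda>x. a * \<phi> x) = (\<lambda>x. a * (T ^^ k) \<phi> x)"
  by (induction k) (auto simp: T_cmult)

lemma T_bounded:
  assumes "\<phi> \<in> borel_measurable borel" "\<And>x. norm (\<phi> x) \<le> c" shows "norm (T \<phi> x) \<le> c"
  using T_mono[of \<phi> "\<lambda>_. c" x, OF assms] prob_space.finite_measure[OF K_prob, of x]
  by (simp add: finite_measure.integrable_const)

lemma Tpow_bounded:
  assumes "\<phi> \<in> borel_measurable borel" "\<And>x. norm (\<phi> x) \<le> c" shows "norm ((T ^^ k) \<phi> x) \<le> c"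
  using assms by (induction k arbitrary: x) (auto intro!: T_bounded)

lemma T_Re: "bnd c \<phi> \<Longrightarrow> T (\<lambda>x. Re (\<phi> x)) = (\<lambda>x. Re (T \<phi> x))"
  and T_Im: "bnd c \<phi> \<Longrightarrow> T (\<lambda>x. Im (\<phi> x)) = (\<lambda>x. Im (T \<phi> x))"
  unfolding T_def by (simp_all add: bnd_int)

lemma Tpow_Re: "bnd c \<phi> \<Longrightarrow> (T ^^ k) (\<lambda>x. Re (\<phi> x)) = (\<lambda>x. Re ((T ^^ k) \<phi> x))"
  and Tpow_Im: "bnd c \<phi> \<Longrightarrow> (T ^^ k) (\<lambda>x. Im (\<phi> x)) = (\<lambda>x. Im ((T ^^ k) \<phi> x))"
  by (induction k) (auto simp: T_Re[OF bnd_Tpow] T_Im[OF bnd_Tpow])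

lemma T_of_real: "T (\<lambda>x. of_real (\<phi> x) :: complex) = (\<lambda>x. of_real (T \<phi> x))"
  unfolding T_def by simp

lemma Tpow_of_real: "(T ^^ k) (\<lambda>x. of_real (\<phi> x) :: complex) = (\<lambda>x. of_real ((T ^^ k) \<phi> x))"
  by (induction k) (auto simp: T_of_real)

text \<open>Iterating the drift sums a geometric series. Integrability of every iterate is carried
  through the induction, since the integral of a nonintegrable function is 0 by convention and
  monotonicity would fail.\<close>

lemma Tpow_lyapunov:
  fixes U :: "'a \<Rightarrow> real"
  assumes U: "U \<in> borel_measurable borel" "\<And>x. 0 \<le> U x" "\<And>x. integrable (K x) U"
    and a: "0 \<le> a" "a < 1" "0 \<le> b" "\<And>x. T U x \<le> a * U x + b"
  shows "integrable (K x) ((T ^^ k) U) \<and> 0 \<le> (T ^^ k) U x \<and> (T ^^ k) U x \<le> U x + b / (1 - a)"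
proof -
  have fm: "finite_measure (K x)" for x by (rule prob_space.finite_measure[OF K_prob])
  have "integrable (K x) ((T ^^ k) U) \<and> 0 \<le> (T ^^ k) U x \<and> (T ^^ k) U x \<le> a ^ k * U x + b * (\<Sum>i<k. a ^ i)" for x
  proof (induction k arbitrary: x)
    case 0
    then show ?case using U a by auto
  next
    case (Suc k)
    let ?B = "\<lambda>k y. a ^ k * U y + b * (\<Sum>i<k. a ^ i)"
    have B_int: "integrable (K x) (?B k)" for x k
      using U(3) fm by (auto intro!: integrable_mult_right simp: finite_measure.integrable_const)
    have nn: "0 \<le> T ((T ^^ k) U) x" for x
      unfolding T_def[of "(T ^^ k) U"] using Suc by (intro integral_nonneg_AE) auto
    have up: "T ((T ^^ k) U) x \<le> ?B (Suc k) x" for x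
    proof -
      have "T ((T ^^ k) U) x \<le> T (?B k) x"
        unfolding T_def[of "(T ^^ k) U"] T_def[of "?B k"] using Suc B_int by (intro integral_mono) auto
      also have "\<dots> = a ^ k * T U x + b * (\<Sum>i<k. a ^ i)"
        using U(3)[of x] fm prob_space.prob_space[OF K_prob, of x]
        by (simp add: T_def finite_measure.integrable_const)
      also have "\<dots> \<le> a ^ k * (a * U x + b) + b * (\<Sum>i<k. a ^ i)"
        using a by (intro add_right_mono mult_left_mono) auto
      also have "\<dots> = ?B (Suc k) x" by (simp add: algebra_simps)
      finally show ?thesis .
    qed
    have "integrable (K x) ((T ^^ Suc k) U)"
    proof (rule Bochner_Integration.integrable_bound[OF B_int[of x "Suc k"]])
      show "(T ^^ Suc k) U \<in> borel_measurable (K x)" using Tpow_meas[OF U(1), of "Suc k"] by simp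
      show "AE y in K x. norm ((T ^^ Suc k) U y) \<le> norm (?B (Suc k) y)"
      proof (rule AE_I2)
        fix y show "norm ((T ^^ Suc k) U y) \<le> norm (?B (Suc k) y)"
          using nn[of y] up[of y] by (simp only: funpow.simps o_apply real_norm_def)
      qed
    qed
    then show ?case using nn up by simp
  qed
  moreover have "a ^ k * U x \<le> U x" using U a by (simp add: mult_left_le_one_le power_le_one)
  moreover have "b * (\<Sum>i<k. a ^ i) \<le> b / (1 - a)"
    using a by (simp add: sum_gp_strict divide_right_mono mult_left_le)
  ultimately show ?thesis by (meson add_mono order_trans)
qed

text \<open>By assumption every \<open>h x - G x\<close> lies below every \<open>h y + G y\<close>,
  so the supremum of the former fits in between. This passes from an oscillation bound to a weighted
  supremum bound modulo constants.\<close>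

lemma oscillation_centre:
  fixes h G :: "'b \<Rightarrow> real"
  assumes "\<And>x y. \<bar>h x - h y\<bar> \<le> G x + G y"
  shows "\<exists>c. \<forall>x. \<bar>h x - c\<bar> \<le> G x"
proof (intro exI allI)
  define c where "c = (SUP x. h x - G x)"
  have b: "h x - G x \<le> h y + G y" for x y using assms[of x y] by linarith
  have "bdd_above (range (\<lambda>x. h x - G x))" using b by (intro bdd_aboveI2[where M="h undefined + G undefined"])
  then have "h x - G x \<le> c" for x unfolding c_def by (rule cSUP_upper[rotated]) simp
  moreover have "c \<le> h y + G y" for y unfolding c_def using b by (intro cSUP_least) auto
  ultimately show "\<bar>h x - c\<bar> \<le> G x" for x by (smt (verit))
qed

lemma TV_real_le:
  assumes "bnd c h" "\<And>x. \<bar>h x\<bar> \<le> c0 + c1 * V x" "0 \<le> c1"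
  shows "\<bar>T h x\<bar> \<le> c0 + c1 * (\<kappa> * V x + L)"
proof -
  have fm: "finite_measure (K x)" for x by (rule prob_space.finite_measure[OF K_prob])
  have "norm (T h x) \<le> T (\<lambda>x. c0 + c1 * V x) x"
    using assms fm V_int by (intro T_mono bnd_meas[OF assms(1)] Bochner_Integration.integrable_add)
      (auto simp: finite_measure.integrable_const)
  also have "\<dots> = c0 + c1 * T V x"
    using V_int[of x] fm prob_space.prob_space[OF K_prob, of x]
    by (simp add: T_def finite_measure.integrable_const)
  also have "\<dots> \<le> c0 + c1 * (\<kappa> * V x + L)"
    using assms by (intro add_left_mono mult_left_mono TV)
  finally show ?thesis by simp
qed

text \<open>Hairer and Mattingly's form of Harris' theorem: for a suitable small \<open>\<beta>\<close> the kernel contracts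
  oscillations measured in the distance \<open>2 + \<beta> (V x + V y)\<close>. Far from the centre the drift condition
  contracts, near it the minorizing measure does.\<close>

lemma contraction:
  "\<exists>\<beta> \<rho>. 0 < \<beta> \<and> 0 < \<rho> \<and> \<rho> < 1 \<and>
    (\<forall>h b c x y. bnd b h \<longrightarrow> 0 \<le> c \<longrightarrow> (\<forall>x y. \<bar>h x - h y\<bar> \<le> c * (2 + \<beta> * (V x + V y))) \<longrightarrow>
      \<bar>T h x - T h y\<bar> \<le> \<rho> * c * (2 + \<beta> * (V x + V y)))"
proof -
  \<comment> \<open>Chosen so that, once \<open>V x + V y \<ge> R\<close>, the additive drift
    \<open>2 * L\<close> takes at most half of the gap
    \<open>(1 - \<kappa>) * (V x + V y)\<close>.\<close>
  define R where "R = 4 * L / (1 - \<kappa>)"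
  have R: "R > 0" "2 * L = (1 - \<kappa>) / 2 * R" using \<kappa>01 L_pos by (auto simp: R_def field_simps)
  obtain \<epsilon> \<nu> where \<epsilon>: "\<epsilon> > 0" and \<nu>: "prob_space \<nu>" "sets \<nu> = sets borel"
    and min: "\<And>x \<phi>. W x \<le> R\<^sup>2 \<Longrightarrow> \<phi> \<in> borel_measurable borel \<Longrightarrow>
         ennreal \<epsilon> * (\<integral>\<^sup>+y. \<phi> y \<partial>\<nu>) \<le> (\<integral>\<^sup>+y. \<phi> y \<partial>K x)"
    using minorization[of "R\<^sup>2"] by metis
  interpret \<nu>: prob_space \<nu> by (rule \<nu>)
  have [measurable_cong]: "sets \<nu> = sets borel" by (rule \<nu>)
  \<comment> \<open>With this weight the drift constants cost exactly \<open>\<epsilon>\<close> near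
    the centre, half of the \<open>2 * \<epsilon>\<close> gained from the minorization.\<close>
  define \<beta> where "\<beta> = \<epsilon> / (2 * L)"
  have \<beta>: "\<beta> > 0" "2 * \<beta> * L = \<epsilon>" using \<epsilon> L_pos by (auto simp: \<beta>_def)
  define \<kappa>' where "\<kappa>' = (1 + \<kappa>) / 2"
  have \<kappa>': "0 < \<kappa>'" "\<kappa>' < 1" using \<kappa>01 by (auto simp: \<kappa>'_def)
  \<comment> \<open>The contraction ratio at \<open>S = R\<close>; for larger \<open>S\<close> the
    quotient of \<open>2 + \<beta> * \<kappa>' * S\<close> by \<open>2 + \<beta> * S\<close> only
    decreases.\<close>
  define r where "r = (2 + \<beta> * \<kappa>' * R) / (2 + \<beta> * R)"
  have bR: "0 < \<beta> * R" using \<beta> R by simp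
  have "\<beta> * R * \<kappa>' < \<beta> * R * 1" using \<kappa>' bR by (intro mult_strict_left_mono) auto
  then have r: "\<kappa>' \<le> r" "r < 1" "r * (2 + \<beta> * R) = 2 + \<beta> * \<kappa>' * R"
    using \<kappa>' bR by (auto simp: r_def field_simps add_pos_pos)
  define \<rho> where "\<rho> = max (1 - \<epsilon> / 2) r"
  have \<rho>: "0 < \<rho>" "\<rho> < 1" "r \<le> \<rho>" "1 - \<epsilon> / 2 \<le> \<rho>" "\<kappa> \<le> \<rho>"
    using r \<epsilon> \<kappa>' \<kappa>01 by (auto simp: \<rho>_def \<kappa>'_def)
  have "\<bar>T h x - T h y\<bar> \<le> \<rho> * c * (2 + \<beta> * (V x + V y))"
    if h: "bnd b h" and c: "0 \<le> c" and osc: "\<forall>x y. \<bar>h x - h y\<bar> \<le> c * (2 + \<beta> * (V x + V y))"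
    for h b c x y
  proof -
    \<comment> \<open>Centring by \<open>a\<close> leaves \<open>T h x - T h y\<close> unchanged and
      turns the oscillation bound into a pointwise one.\<close>
    obtain a where a: "\<And>x. \<bar>h x - a\<bar> \<le> c * (1 + \<beta> * V x)"
      using oscillation_centre[of h "\<lambda>x. c * (1 + \<beta> * V x)"] osc by (auto simp: algebra_simps)
    define g where "g x = h x - a" for x
    define b' where "b' = b + norm a"
    have g_bnd: "bnd b' g"
      unfolding g_def b'_def by (intro bnd_diff h bnd_const)
    have [measurable]: "g \<in> borel_measurable borel" by (rule bnd_meas[OF g_bnd])
    have g_le: "\<bar>g x\<bar> \<le> c + c * \<beta> * V x" for x using a[of x] by (simp add: g_def algebra_simps)
    have Tg: "T g = (\<lambda>x. T h x - a)"
      unfolding g_def using T_diff[OF h bnd_const[of a]] by simp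
    have diff: "\<bar>T h x - T h y\<bar> = \<bar>T g x - T g y\<bar>" by (simp add: Tg)
    have c\<beta>: "0 \<le> c * \<beta>" using c \<beta> by simp
    define S where "S = V x + V y"
    show ?thesis
    proof (cases "S \<ge> R")
      case True
      have "\<bar>T g x - T g y\<bar> \<le> c + c * \<beta> * (\<kappa> * V x + L) + (c + c * \<beta> * (\<kappa> * V y + L))"
        using TV_real_le[OF g_bnd g_le c\<beta>, of x] TV_real_le[OF g_bnd g_le c\<beta>, of y] by linarith
      also have "\<dots> = c * (2 + \<beta> * (\<kappa> * S + 2 * L))" by (simp add: S_def algebra_simps)
      also have "\<dots> \<le> c * (2 + \<beta> * (\<kappa>' * S))"
      proof -
        have "2 * L \<le> (1 - \<kappa>) / 2 * S" unfolding R(2) using True \<kappa>01 by (intro mult_left_mono) auto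
        also have "\<dots> = \<kappa>' * S - \<kappa> * S" by (simp add: \<kappa>'_def field_simps)
        finally show ?thesis using c \<beta> by (intro mult_left_mono add_left_mono) auto
      qed
      also have "\<dots> \<le> c * (r * (2 + \<beta> * S))"
      proof -
        have "0 \<le> (r - \<kappa>') * (\<beta> * (S - R))" using r \<beta> True by simp
        then have "2 + \<beta> * (\<kappa>' * S) \<le> r * (2 + \<beta> * R) - \<beta> * \<kappa>' * R + \<beta> * (\<kappa>' * S) + (r - \<kappa>') * (\<beta> * (S - R))"
          unfolding r(3) by simp
        also have "\<dots> = r * (2 + \<beta> * S)" by (simp add: algebra_simps)
        finally show ?thesis using c by (rule mult_left_mono)
      qed
      also have "\<dots> \<le> c * (\<rho> * (2 + \<beta> * S))"
        using c \<rho> \<beta> True R by (intro mult_left_mono mult_right_mono) auto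
      finally show ?thesis by (simp add: diff S_def mult_ac)
    next
      case False
      have small: "W z \<le> R\<^sup>2" if "z = x \<or> z = y" for z
      proof -
        have "V z \<le> R" using False V_ge1[of x] V_ge1[of y] that by (auto simp: S_def)
        then show ?thesis using V_ge1[of z] by (simp flip: V_sq add: power_mono)
      qed
      have fm: "finite_measure (K x)" for x by (rule prob_space.finite_measure[OF K_prob])
      have \<nu>le: "integrable \<nu> \<phi> \<and> \<epsilon> * (\<integral>u. \<phi> u \<partial>\<nu>) \<le> T \<phi> z"
        if z: "z = x \<or> z = y" and \<phi>: "\<phi> \<in> borel_measurable borel" "\<And>u. 0 \<le> \<phi> u" "integrable (K z) \<phi>" for \<phi> z
      proof -
        have "ennreal \<epsilon> * (\<integral>\<^sup>+u. ennreal (\<phi> u) \<partial>\<nu>) \<le> (\<integral>\<^sup>+u. ennreal (\<phi> u) \<partial>K z)"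
          using \<phi>(1) by (intro min small z) auto
        also have "\<dots> = ennreal (T \<phi> z)"
          unfolding T_def using \<phi> by (intro nn_integral_eq_integral) auto
        finally have *: "ennreal \<epsilon> * (\<integral>\<^sup>+u. ennreal (\<phi> u) \<partial>\<nu>) \<le> ennreal (T \<phi> z)" .
        then have "(\<integral>\<^sup>+u. ennreal (\<phi> u) \<partial>\<nu>) < \<infinity>"
          using \<epsilon> by (cases "(\<integral>\<^sup>+u. ennreal (\<phi> u) \<partial>\<nu>)") (auto simp: ennreal_mult_top top_unique)
        then have i: "integrable \<nu> \<phi>"
          using \<phi> by (intro integrableI_nonneg) auto
        have Tnn: "0 \<le> T \<phi> z" unfolding T_def using \<phi> by simp
        have "ennreal (\<epsilon> * (\<integral>u. \<phi> u \<partial>\<nu>)) \<le> ennreal (T \<phi> z)"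
          using * \<epsilon> \<phi> i by (subst (asm) nn_integral_eq_integral) (auto simp: ennreal_mult')
        then show ?thesis using i Tnn by simp
      qed
      define G where "G u = c + c * \<beta> * V u" for u
      have [measurable]: "G \<in> borel_measurable borel" unfolding G_def by measurable
      have G: "integrable (K z) G" "0 \<le> G z" "c \<le> G z" for z
        unfolding G_def using V_int[of z] fm c c\<beta> V_ge1[of z]
        by (auto simp: finite_measure.integrable_const intro!: integrable_mult_right add_nonneg_nonneg mult_nonneg_nonneg)
      have gi: "integrable (K z) g" for z by (rule bnd_int[OF g_bnd])
      have TG: "T G z \<le> c + c * \<beta> * (\<kappa> * V z + L)" for z
      proof -
        have "bnd (c + c * \<beta>) G"
          using bnd_add[OF bnd_const[of c] bnd_mono[OF bnd_mult[of "\<lambda>_. c * \<beta>" "c * \<beta>" 1 V]]] c c\<beta> bnd_V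
          unfolding G_def by simp
        then have "\<bar>T G z\<bar> \<le> c + c * \<beta> * (\<kappa> * V z + L)"
          by (rule TV_real_le) (use G c\<beta> in \<open>auto simp: G_def\<close>)
        then show ?thesis by linarith
      qed
      \<comment> \<open>Both \<open>G + g\<close> and \<open>G - g\<close> are nonnegative, so the
        minorization applies to each. The \<open>\<nu>\<close>-integral of \<open>g\<close> is
        common to \<open>x\<close> and \<open>y\<close> and cancels between them, while
        \<open>G \<ge> c\<close> yields the gain \<open>\<epsilon> * c\<close> at each
        point.\<close>
      have near: "\<bar>T g z - \<epsilon> * (\<integral>u. g u \<partial>\<nu>)\<bar> \<le> T G z - \<epsilon> * c" if z: "z = x \<or> z = y" for z
      proof -
        have gG: "\<bar>g u\<bar> \<le> G u" for u using g_le[of u] by (simp add: G_def)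
        have 1: "integrable \<nu> (\<lambda>u. G u + g u) \<and> \<epsilon> * (\<integral>u. G u + g u \<partial>\<nu>) \<le> T (\<lambda>u. G u + g u) z"
          by (rule \<nu>le[OF z]) (use G gi gG in \<open>auto simp: abs_le_iff\<close>, smt (verit, best) gG)
        have 2: "integrable \<nu> (\<lambda>u. G u - g u) \<and> \<epsilon> * (\<integral>u. G u - g u \<partial>\<nu>) \<le> T (\<lambda>u. G u - g u) z"
          by (rule \<nu>le[OF z]) (use G gi gG in \<open>auto simp: abs_le_iff\<close>)
        have iG: "integrable \<nu> G" using \<nu>le[OF z, of G] G by auto
        have ig: "integrable \<nu> g"
          using Bochner_Integration.integrable_diff[OF conjunct1[OF 1] iG] by simp
        have "c \<le> (\<integral>u. G u \<partial>\<nu>)"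
          using integral_mono[OF \<nu>.integrable_const[of c] iG] G by (simp add: \<nu>.prob_space)
        then have 3: "\<epsilon> * c \<le> \<epsilon> * (\<integral>u. G u \<partial>\<nu>)" using \<epsilon> by simp
        have "\<epsilon> * (\<integral>u. G u \<partial>\<nu>) + \<epsilon> * (\<integral>u. g u \<partial>\<nu>) \<le> T G z + T g z"
          using 1 iG ig G gi by (simp add: T_def distrib_left)
        moreover have "\<epsilon> * (\<integral>u. G u \<partial>\<nu>) - \<epsilon> * (\<integral>u. g u \<partial>\<nu>) \<le> T G z - T g z"
          using 2 iG ig G gi by (simp add: T_def right_diff_distrib)
        ultimately show ?thesis using 3 by linarith
      qed
      have "\<bar>T g x - T g y\<bar> \<le> (T G x - \<epsilon> * c) + (T G y - \<epsilon> * c)"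
        using near[of x] near[of y] by simp
      also have "\<dots> \<le> (c + c * \<beta> * (\<kappa> * V x + L) - \<epsilon> * c) + (c + c * \<beta> * (\<kappa> * V y + L) - \<epsilon> * c)"
        using TG[of x] TG[of y] by linarith
      also have "\<dots> = c * (2 - 2 * \<epsilon> + (2 * \<beta> * L) + \<kappa> * (\<beta> * S))" by (simp add: S_def algebra_simps)
      also have "\<dots> = c * ((1 - \<epsilon> / 2) * 2 + \<kappa> * (\<beta> * S))" unfolding \<beta>(2) by (simp add: algebra_simps)
      also have "\<dots> \<le> c * (\<rho> * 2 + \<rho> * (\<beta> * S))"
        using c \<rho> \<beta> V_ge1[of x] V_ge1[of y] by (intro mult_left_mono add_mono mult_right_mono) (auto simp: S_def)
      finally show ?thesis by (simp add: diff S_def algebra_simps)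
    qed
  qed
  then show ?thesis using \<beta> \<rho> by blast
qed

text \<open>Since \<open>V \<ge> 1\<close>, the weights \<open>2 + \<beta> * (V x + V y)\<close> and
  \<open>V x + V y\<close> are comparable. Changing to the first and back costs
  \<open>(1 + \<beta>) / \<beta>\<close> once, not at every step.\<close>

lemma geometric:
  "\<exists>D \<rho>. 0 < D \<and> 0 < \<rho> \<and> \<rho> < 1 \<and> (\<forall>(h::'a \<Rightarrow> real) c k x y. bnd c h \<longrightarrow>
     \<bar>(T ^^ k) h x - (T ^^ k) h y\<bar> \<le> D * c * \<rho> ^ k * (V x + V y))"
proof -
  obtain \<beta> \<rho> where \<beta>: "0 < \<beta>" "0 < \<rho>" "\<rho> < 1" and contr:
    "\<And>h b c x y. bnd b h \<Longrightarrow> 0 \<le> c \<Longrightarrow> (\<forall>x y. \<bar>h x - h y\<bar> \<le> c * (2 + \<beta> * (V x + V y))) \<Longrightarrow>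
      \<bar>T h x - T h y\<bar> \<le> \<rho> * c * (2 + \<beta> * (V x + V y))"
    using contraction by blast
  have "\<bar>(T ^^ k) h x - (T ^^ k) h y\<bar> \<le> ((1 + \<beta>) / \<beta>) * c * \<rho> ^ k * (V x + V y)"
    if h: "bnd c h" for h :: "'a \<Rightarrow> real" and c k x y
  proof -
    have c: "0 \<le> c" by (rule bnd_nonneg[OF h])
    have "\<bar>(T ^^ k) h x - (T ^^ k) h y\<bar> \<le> \<rho> ^ k * (c / \<beta>) * (2 + \<beta> * (V x + V y))" for x y
    proof (induction k arbitrary: x y)
      case 0
      have "\<bar>h x - h y\<bar> \<le> c * V x + c * V y" using bndD[OF h, of x] bndD[OF h, of y] by auto
      also have "\<dots> = (c / \<beta>) * (\<beta> * (V x + V y))" using \<beta> by (simp add: field_simps)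
      also have "\<dots> \<le> (c / \<beta>) * (2 + \<beta> * (V x + V y))" using c \<beta> by (intro mult_left_mono) auto
      finally show ?case by simp
    next
      case (Suc k)
      show ?case using contr[OF bnd_Tpow[OF h], of "\<rho> ^ k * (c / \<beta>)" k x y] Suc c \<beta> by (simp add: mult_ac)
    qed
    from this[of x y] have "\<bar>(T ^^ k) h x - (T ^^ k) h y\<bar> \<le> \<rho> ^ k * (c / \<beta>) * (2 + \<beta> * (V x + V y))" .
    also have "\<dots> \<le> \<rho> ^ k * (c / \<beta>) * ((1 + \<beta>) * (V x + V y))"
      using c \<beta> V_ge1[of x] V_ge1[of y] by (intro mult_left_mono) (auto simp: algebra_simps)
    also have "\<dots> = ((1 + \<beta>) / \<beta>) * c * \<rho> ^ k * (V x + V y)" by (simp add: mult_ac)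
    finally show ?thesis .
  qed
  then show ?thesis using \<beta> by (intro exI[of _ "(1 + \<beta>) / \<beta>"] exI[of _ \<rho>]) auto
qed

text \<open>Both constants are witnesses of one existential statement and are therefore chosen
  together; once fixed, they can enter later definitions.\<close>

definition rate_pair :: "real \<times> real" where
  "rate_pair = (SOME p. 0 < fst p \<and> 0 < snd p \<and> snd p < 1 \<and> (\<forall>(h::'a \<Rightarrow> real) c k x y. bnd c h \<longrightarrow>
     \<bar>(T ^^ k) h x - (T ^^ k) h y\<bar> \<le> fst p * c * snd p ^ k * (V x + V y)))"

definition D where "D = fst rate_pair"
definition \<rho> where "\<rho> = snd rate_pair"

lemma D_pos: "0 < D" and \<rho>01: "0 < \<rho>" "\<rho> < 1"
  and osc_decay: "bnd c h \<Longrightarrow> \<bar>(T ^^ k) h x - (T ^^ k) h y\<bar> \<le> D * c * \<rho> ^ k * (V x + V y)"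
proof -
  have "0 < fst rate_pair \<and> 0 < snd rate_pair \<and> snd rate_pair < 1 \<and> (\<forall>(h::'a \<Rightarrow> real) c k x y. bnd c h \<longrightarrow>
     \<bar>(T ^^ k) h x - (T ^^ k) h y\<bar> \<le> fst rate_pair * c * snd rate_pair ^ k * (V x + V y))"
    unfolding rate_pair_def by (rule someI_ex) (use geometric in auto)
  then show "0 < D" "0 < \<rho>" "\<rho> < 1" "bnd c h \<Longrightarrow> \<bar>(T ^^ k) h x - (T ^^ k) h y\<bar> \<le> D * c * \<rho> ^ k * (V x + V y)"
    by (auto simp: D_def \<rho>_def)
qed

end

context harris_chain begin

section \<open>Existence and uniqueness of the invariant law\<close>

lemma Tpow_mono:
  assumes "bnd c \<phi>" "bnd c' U" "\<And>x. norm (\<phi> x) \<le> U x"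
  shows "norm ((T ^^ k) \<phi> x) \<le> (T ^^ k) U x"
proof (induction k arbitrary: x)
  case (Suc k)
  show ?case
    using T_mono[OF bnd_meas[OF bnd_Tpow[OF assms(1)]] Suc bnd_int[OF bnd_Tpow[OF assms(2)]]] by simp
qed (use assms in auto)

lemma Tpow_V: "(T ^^ k) V x \<le> V x + L / (1 - \<kappa>)"
  using Tpow_lyapunov[where U=V and a="\<kappa>" and b=L and k=k and x=x] V_int TV \<kappa>01 L_pos V_ge1 by (simp add: order_trans[OF zero_le_one])

lemma Tpow_W: "(T ^^ k) W x \<le> W x + C / (1 - \<gamma>)"
  using Tpow_lyapunov[where U=W and a="\<gamma>" and b=C and k=k and x=x] W_int drift \<gamma>01 C0 W_ge1 unfolding T_def[of W, abs_def]
  by (simp add: order_trans[OF zero_le_one])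

lemma Tpow_dct:
  fixes f :: "nat \<Rightarrow> 'a \<Rightarrow> real"
  assumes [measurable]: "\<And>n. f n \<in> borel_measurable borel" "g \<in> borel_measurable borel"
    and le: "\<And>n x. \<bar>f n x\<bar> \<le> c" and lim: "\<And>x. (\<lambda>n. f n x) \<longlonglongrightarrow> g x"
  shows "(\<lambda>n. (T ^^ k) (f n) x) \<longlonglongrightarrow> (T ^^ k) g x"
proof (induction k arbitrary: x)
  case 0
  then show ?case using lim by simp
next
  case (Suc k)
  have [measurable]: "(T ^^ k) (f n) \<in> borel_measurable borel" "(T ^^ k) g \<in> borel_measurable borel" for n
    by (rule Tpow_meas, measurable)+
  have "(\<lambda>n. \<integral>y. (T ^^ k) (f n) y \<partial>K x) \<longlonglongrightarrow> (\<integral>y. (T ^^ k) g y \<partial>K x)"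
  proof (rule integral_dominated_convergence)
    show "integrable (K x) (\<lambda>_. c)"
      using prob_space.finite_measure[OF K_prob, of x] by (simp add: finite_measure.integrable_const)
    show "AE y in K x. (\<lambda>n. (T ^^ k) (f n) y) \<longlonglongrightarrow> (T ^^ k) g y" using Suc by simp
    show "AE y in K x. norm ((T ^^ k) (f n) y) \<le> c" for n
      using le by (intro AE_I2 Tpow_bounded) auto
  qed measurable
  then show ?case by (simp add: T_def[of "(T ^^ k) _"])
qed

text \<open>With \<open>g = (T ^^ k) h\<close> the increment is the \<open>j\<close>-step average of
  \<open>g - g x\<close>, which is controlled by the decayed oscillation of \<open>g\<close>. The
  bound is uniform in \<open>j\<close> because \<open>(T ^^ j) V x\<close> stays bounded, so the
  iterates at a point are Cauchy.\<close>

lemma Tpow_increment: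
  fixes h :: "'a \<Rightarrow> real"
  assumes h: "h \<in> borel_measurable borel" "\<And>x. \<bar>h x\<bar> \<le> c"
  shows "\<bar>(T ^^ (k + j)) h x - (T ^^ k) h x\<bar> \<le> D * (2 * V x + L / (1 - \<kappa>)) * c * \<rho> ^ k"
proof -
  have c: "0 \<le> c" using h(2)[of x] by linarith
  have b: "bnd c h" using h c by (intro bnd_bounded) auto
  define g where "g = (T ^^ k) h"
  have gb: "bnd ((\<kappa> + L) ^ k * c) g" unfolding g_def by (rule bnd_Tpow[OF b])
  define A where "A = D * c * \<rho> ^ k"
  have A: "0 \<le> A" using D_pos c \<rho>01 by (simp add: A_def)
  have Ub: "bnd (A * (1 + norm (V x))) (\<lambda>y. A * (V y + V x))"
    using A by (intro bnd_mult[of "\<lambda>_. A"] bnd_add bnd_V bnd_const) auto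
  have "(T ^^ (k + j)) h x - (T ^^ k) h x = (T ^^ j) (\<lambda>y. g y - g x) x"
    using Tpow_diff[OF gb bnd_const[of "g x"], of j] by (simp add: g_def funpow_add add.commute)
  also have "norm \<dots> \<le> (T ^^ j) (\<lambda>y. A * (V y + V x)) x"
    using osc_decay[OF b, of k]
    by (intro Tpow_mono[OF bnd_diff[OF gb bnd_const] Ub]) (simp add: g_def A_def)
  also have "\<dots> = A * ((T ^^ j) V x + V x)"
    using Tpow_add[OF bnd_V bnd_const[of "V x"], of j] by (simp add: Tpow_cmult)
  also have "\<dots> \<le> A * (V x + L / (1 - \<kappa>) + V x)"
    using A Tpow_V[of j x] by (intro mult_left_mono) auto
  finally show ?thesis by (simp add: A_def mult_ac)
qed

text \<open>The limits of \<open>(T ^^ k) h x0\<close> form a positive linear functional on bounded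
  measurable functions. Convergence is uniform over functions with a common bound, and each finite
  iterate respects bounded pointwise limits; hence so does the functional, which yields countable
  additivity without tightness or compactness.\<close>

lemma exists_invariant: "\<exists>\<mu>. invariant \<mu>"
proof -
  \<comment> \<open>Any base point serves; \<open>undefined\<close> is merely some element of the
    type.\<close>
  define x0 :: 'a where "x0 = undefined"
  define E where "E = D * (2 * V x0 + L / (1 - \<kappa>))"
  have E: "E \<ge> 0" using D_pos V_ge1[of x0] L_pos \<kappa>01 by (auto simp: E_def intro!: mult_nonneg_nonneg add_nonneg_nonneg)
  define ell :: "('a \<Rightarrow> real) \<Rightarrow> real" where "ell h = lim (\<lambda>k. (T ^^ k) h x0)" for h
  define B where "B c h \<longleftrightarrow> h \<in> borel_measurable borel \<and> (\<forall>x. \<bar>h x\<bar> \<le> c)" for c and h :: "'a \<Rightarrow> real"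
  have B0: "0 \<le> c" if "B c h" for c h using that by (auto simp: B_def intro: order_trans[OF abs_ge_zero])
  have Bb: "bnd c h" if "B c h" for c h using that B0[OF that] by (intro bnd_bounded) (auto simp: B_def)
  have inc: "\<bar>(T ^^ (k + j)) h x0 - (T ^^ k) h x0\<bar> \<le> E * c * \<rho> ^ k" if "B c h" for h c k j
    using Tpow_increment[of h c k j x0] that by (simp add: B_def E_def)
  have small: "\<exists>k. E * c * \<rho> ^ k < e" if "0 < e" for c e
  proof -
    have "(\<lambda>k. E * c * \<rho> ^ k) \<longlonglongrightarrow> E * c * 0"
      using \<rho>01 by (intro tendsto_intros LIMSEQ_realpow_zero) auto
    then show ?thesis using order_tendstoD(2)[of "\<lambda>k. E * c * \<rho> ^ k" 0 sequentially e] that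
      by (auto dest: eventually_happens)
  qed
  have conv: "(\<lambda>k. (T ^^ k) h x0) \<longlonglongrightarrow> ell h" if h: "B c h" for h c
  proof -
    have "Cauchy (\<lambda>k. (T ^^ k) h x0)"
    proof (rule CauchyI')
      fix e :: real assume "0 < e"
      then obtain M where M: "E * c * \<rho> ^ M < e" using small by blast
      show "\<exists>M. \<forall>m\<ge>M. \<forall>n>m. dist ((T ^^ m) h x0) ((T ^^ n) h x0) < e"
      proof (intro exI[of _ M] allI impI)
        fix m n assume mn: "M \<le> m" "m < n"
        have "dist ((T ^^ m) h x0) ((T ^^ n) h x0) \<le> E * c * \<rho> ^ m"
          using inc[OF h, of m "n - m"] mn by (simp add: dist_real_def abs_minus_commute)
        also have "\<dots> \<le> E * c * \<rho> ^ M" using mn \<rho>01 E B0[OF h] by (intro mult_left_mono power_decreasing) auto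
        finally show "dist ((T ^^ m) h x0) ((T ^^ n) h x0) < e" using M by simp
      qed
    qed
    then show ?thesis unfolding ell_def by (simp add: Cauchy_convergent convergent_LIMSEQ_iff[symmetric])
  qed
  have dist: "\<bar>ell h - (T ^^ k) h x0\<bar> \<le> E * c * \<rho> ^ k" if h: "B c h" for h c k
  proof (rule tendsto_upperbound)
    show "(\<lambda>j. \<bar>(T ^^ (j + k)) h x0 - (T ^^ k) h x0\<bar>) \<longlonglongrightarrow> \<bar>ell h - (T ^^ k) h x0\<bar>"
      by (intro tendsto_intros LIMSEQ_ignore_initial_segment[OF conv[OF h]])
    show "eventually (\<lambda>j. \<bar>(T ^^ (j + k)) h x0 - (T ^^ k) h x0\<bar> \<le> E * c * \<rho> ^ k) sequentially"
      using inc[OF h, of k] by (simp add: add.commute)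
  qed simp
  have ell_add: "ell (\<lambda>x. g x + h x) = ell g + ell h" if g: "B c g" and h: "B c' h" for g h c c'
  proof (rule LIMSEQ_unique)
    show "(\<lambda>k. (T ^^ k) (\<lambda>x. g x + h x) x0) \<longlonglongrightarrow> ell (\<lambda>x. g x + h x)"
      using g h by (intro conv[of "c + c'"]) (auto simp: B_def intro!: order_trans[OF abs_triangle_ineq] add_mono)
    show "(\<lambda>k. (T ^^ k) (\<lambda>x. g x + h x) x0) \<longlonglongrightarrow> ell g + ell h"
      using tendsto_add[OF conv[OF g] conv[OF h]] by (simp add: Tpow_add[OF Bb[OF g] Bb[OF h]])
  qed
  have ell_cmult: "ell (\<lambda>x. a * h x) = a * ell h" if h: "B c h" for a h c
  proof (rule LIMSEQ_unique)
    show "(\<lambda>k. (T ^^ k) (\<lambda>x. a * h x) x0) \<longlonglongrightarrow> ell (\<lambda>x. a * h x)"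
      using h by (intro conv[of "\<bar>a\<bar> * c"]) (auto simp: B_def abs_mult intro!: mult_left_mono)
    show "(\<lambda>k. (T ^^ k) (\<lambda>x. a * h x) x0) \<longlonglongrightarrow> a * ell h"
      using tendsto_mult_left[OF conv[OF h], of a] by (simp add: Tpow_cmult)
  qed
  have ell_dct: "(\<lambda>n. ell (f n)) \<longlonglongrightarrow> ell g"
    if f: "\<And>n. B c (f n)" and g: "g \<in> borel_measurable borel" and lim: "\<And>x. (\<lambda>n. f n x) \<longlonglongrightarrow> g x" for f g c
  proof (rule LIMSEQ_I)
    fix e :: real assume e: "0 < e"
    have "\<bar>g x\<bar> \<le> c" for x
      by (rule tendsto_upperbound[OF tendsto_rabs[OF lim]]) (use f in \<open>auto simp: B_def\<close>)
    then have gB: "B c g" using g by (simp add: B_def)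
    \<comment> \<open>One \<open>k\<close> works for all \<open>f n\<close> at once; dominated
      convergence is then applied to this single iterate.\<close>
    obtain k where k: "E * c * \<rho> ^ k < e / 4" using small[of "e / 4"] e by auto
    have "(\<lambda>n. (T ^^ k) (f n) x0) \<longlonglongrightarrow> (T ^^ k) g x0"
      using f g lim by (intro Tpow_dct) (auto simp: B_def)
    then obtain N where N: "\<And>n. n \<ge> N \<Longrightarrow> \<bar>(T ^^ k) (f n) x0 - (T ^^ k) g x0\<bar> < e / 4"
      using LIMSEQ_D[of _ "(T ^^ k) g x0" "e / 4"] e by fastforce
    show "\<exists>N. \<forall>n\<ge>N. norm (ell (f n) - ell g) < e"
    proof (intro exI[of _ N] allI impI)
      fix n assume "N \<le> n"
      then show "norm (ell (f n) - ell g) < e"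
        using N[of n] dist[OF f[of n], of k] dist[OF gB, of k] k e by (simp add: abs_if split: if_splits)
    qed
  qed
  have B_ind: "B 1 (indicator A)" if "A \<in> sets borel" for A :: "'a set"
    using that by (auto simp: B_def indicator_def)
  have ell_nonneg: "0 \<le> ell h" if h: "B c h" "\<And>x. 0 \<le> h x" for c h
  proof (rule tendsto_lowerbound[OF conv[OF h(1)]])
    have "0 \<le> (T ^^ k) h x" for k x
      by (induction k arbitrary: x) (use h(2) in \<open>auto simp: T_def[of "(T ^^ _) h"] intro!: integral_nonneg_AE\<close>)
    then show "\<forall>\<^sub>F k in sequentially. 0 \<le> (T ^^ k) h x0" by simp
  qed simp
  define m :: "'a set \<Rightarrow> ennreal" where "m A = ennreal (ell (indicator A))" for A
  define \<mu> where "\<mu> = measure_of UNIV (sets borel) m"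
  have sets_\<mu>[measurable_cong]: "sets \<mu> = sets (borel :: 'a measure)"
    unfolding \<mu>_def using sets.sigma_sets_eq[of "borel :: 'a measure"] by (simp add: sets_measure_of)
  have ell0: "ell (indicator {}) = 0"
  proof -
    have "indicat_real {} = (\<lambda>_::'a. 0)" by auto
    then show ?thesis using conv[OF B_ind[of "{}"]] by (simp add: LIMSEQ_const_iff)
  qed
  have ca: "countably_additive (sets borel) m"
  proof (rule sets.empty_continuous_imp_countably_additive)
    show "positive (sets borel) m" by (simp add: positive_def m_def ell0)
    show "additive (sets borel) m"
      unfolding additive_def
    proof (intro ballI impI)
      fix A A' :: "'a set" assume A: "A \<in> sets borel" "A' \<in> sets borel" "A \<inter> A' = {}"
      have "ell (indicator (A \<union> A')) = ell (\<lambda>x. indicator A x + indicator A' x)"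
        using A(3) by (intro arg_cong[of _ _ ell]) (auto simp: indicator_def fun_eq_iff)
      also have "\<dots> = ell (indicator A) + ell (indicator A')" by (rule ell_add[OF B_ind[OF A(1)] B_ind[OF A(2)]])
      finally show "m (A \<union> A') = m A + m A'"
        using A by (simp add: m_def ell_nonneg[OF B_ind] ennreal_plus)
    qed
    show "\<forall>A\<in>sets borel. m A \<noteq> \<infinity>" by (simp add: m_def)
    fix A :: "nat \<Rightarrow> 'a set" assume A: "range A \<subseteq> sets borel" "decseq A" "(\<Inter>i. A i) = {}"
    have "(\<lambda>n. ell (indicator (A n))) \<longlonglongrightarrow> ell (indicator {})"
    proof (rule ell_dct)
      show "B 1 (indicator (A n))" for n using A by (intro B_ind) auto
      show "(\<lambda>n. indicat_real (A n) x) \<longlonglongrightarrow> indicator {} x" for x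
        using LIMSEQ_indicator_decseq[OF A(2), of x] unfolding A(3) by simp
    qed simp
    then show "(\<lambda>i. m (A i)) \<longlonglongrightarrow> 0" unfolding m_def ell0 by (metis ennreal_0 tendsto_ennrealI)
  qed
  have em: "emeasure \<mu> A = ennreal (ell (indicator A))" if "A \<in> sets borel" for A
    unfolding m_def[symmetric]
  proof (rule emeasure_measure_of[OF \<mu>_def])
    show "positive (sets \<mu>) m" by (simp add: positive_def m_def ell0)
    show "countably_additive (sets \<mu>) m" using ca by (simp add: sets_\<mu>)
  qed (use that in \<open>auto simp: sets_\<mu>\<close>)
  have space_\<mu>: "space \<mu> = UNIV" using sets_eq_imp_space_eq[OF sets_\<mu>] by simp
  have "ell (indicator UNIV) = 1"
    using conv[OF B_ind[of UNIV]] by (simp add: LIMSEQ_const_iff indicator_def[abs_def])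
  then have \<mu>: "prob_space \<mu>" by (intro prob_spaceI) (simp add: space_\<mu> em)
  interpret \<mu>: prob_space \<mu> by (rule \<mu>)
  \<comment> \<open>Invariance is read off at the function sending \<open>x\<close> to the mass that
    \<open>K x\<close> gives to \<open>A\<close>, so the functional has to be identified with
    integration for more than indicators.\<close>
  have rep: "B c u \<longrightarrow> ell u = (\<integral>x. u x \<partial>\<mu>)" if "u \<in> borel_measurable borel" "\<And>x. 0 \<le> u x" for u c
    using that
  proof (induction u arbitrary: c rule: borel_measurable_induct_real)
    case (set A)
    then show ?case
      using ell_nonneg[OF B_ind[of A]] em[of A] by (simp add: measure_def sets_\<mu> space_\<mu>)
  next
    case (mult u a)
    show ?case
    proof (cases "a = 0")
      case True
      then show ?thesis using ell0 by (simp add: indicator_def[abs_def])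
    next
      case False
      have "B (c / a) u" if "B c (\<lambda>x. a * u x)"
        using that False mult by (auto simp: B_def abs_mult field_simps)
      then show ?thesis using mult.IH ell_cmult[of _ u a] by auto
    qed
  next
    case (add u v)
    show ?case
    proof
      assume b: "B c (\<lambda>x. v x + u x)"
      have bu: "B c u" "B c v"
        using b add by (auto simp: B_def) (smt (verit))+
      then have "integrable \<mu> u" "integrable \<mu> v"
        by (auto simp: B_def intro!: \<mu>.integrable_const_bound[of _ c])
      then show "ell (\<lambda>x. v x + u x) = (\<integral>x. v x + u x \<partial>\<mu>)"
        using bu add.IH by (simp add: ell_add)
    qed
  next
    case (seq U)
    show ?case
    proof
      assume b: "B c u"
      have le: "U i x \<le> u x" for i x
        using incseq_le[OF _ seq(4)[of x]] seq(3) by (auto simp: incseq_def le_fun_def)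
      have BU: "B c (U i)" for i
        using b le[of i] seq(1,2) by (auto simp: B_def) (smt (verit, ccfv_SIG) abs_le_iff order_trans)
      have [measurable]: "U i \<in> borel_measurable borel" "u \<in> borel_measurable borel" for i
        using BU b by (auto simp: B_def)
      have "(\<lambda>i. ell (U i)) \<longlonglongrightarrow> ell u" using BU seq(4) by (intro ell_dct) auto
      moreover have "(\<lambda>i. \<integral>x. U i x \<partial>\<mu>) \<longlonglongrightarrow> (\<integral>x. u x \<partial>\<mu>)"
        by (rule integral_dominated_convergence[where w="\<lambda>_. c"])
          (use BU seq(4) in \<open>auto simp: B_def\<close>)
      ultimately show "ell u = (\<integral>x. u x \<partial>\<mu>)"
        using LIMSEQ_unique by (simp add: seq.IH[rule_format, OF BU])
    qed
  qed
  have "emeasure \<mu> A = (\<integral>\<^sup>+x. emeasure (K x) A \<partial>\<mu>)" if A: "A \<in> sets borel" for A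
  proof -
    let ?h = "T (indicator A) :: 'a \<Rightarrow> real"
    have [measurable]: "(indicator A :: 'a \<Rightarrow> real) \<in> borel_measurable borel" using A by simp
    have hm[measurable]: "?h \<in> borel_measurable borel" by measurable
    have h: "?h x = measure (K x) A" for x using A by (simp add: T_def)
    have hb: "B 1 ?h" using hm prob_space.prob_le_1[OF K_prob] by (auto simp: B_def h)
    \<comment> \<open>Shifting the sequence of iterates by one does not change its limit.\<close>
    have "ell (indicator A) = ell ?h"
    proof (rule LIMSEQ_unique)
      show "(\<lambda>k. (T ^^ Suc k) (indicator A) x0) \<longlonglongrightarrow> ell (indicator A)"
        by (rule LIMSEQ_Suc[OF conv[OF B_ind[OF A]]])
      show "(\<lambda>k. (T ^^ Suc k) (indicator A) x0) \<longlonglongrightarrow> ell ?h"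
        using conv[OF hb] by (simp add: funpow_swap1)
    qed
    also have "\<dots> = (\<integral>x. ?h x \<partial>\<mu>)" using rep[of ?h 1] hb hm by (simp add: h)
    finally have "emeasure \<mu> A = ennreal (\<integral>x. ?h x \<partial>\<mu>)" by (simp add: em[OF A])
    also have "\<dots> = (\<integral>\<^sup>+x. ennreal (?h x) \<partial>\<mu>)"
    proof (intro nn_integral_eq_integral[symmetric] \<mu>.integrable_const_bound[of _ 1])
      show "AE x in \<mu>. norm (?h x) \<le> 1" using hb by (simp add: B_def)
      show "?h \<in> borel_measurable \<mu>" by measurable
    qed (simp add: h)
    also have "\<dots> = (\<integral>\<^sup>+x. emeasure (K x) A \<partial>\<mu>)"
      using prob_space.finite_measure[OF K_prob] by (simp add: h finite_measure.emeasure_eq_measure)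
    finally show ?thesis .
  qed
  then show ?thesis using \<mu> sets_\<mu> unfolding invariant_def by blast
qed

lemma integrable_prob_bounded:
  fixes h :: "'a \<Rightarrow> 'b::{banach, second_countable_topology}"
  assumes "prob_space \<mu>" "sets \<mu> = sets borel" "h \<in> borel_measurable borel" "\<And>x. norm (h x) \<le> c"
  shows "integrable \<mu> h"
  using assms by (intro finite_measure.integrable_const_bound[of _ _ c] prob_space.finite_measure)
    (auto cong: measurable_cong_sets)

lemma Tpow_tends_mean:
  fixes h :: "'a \<Rightarrow> real"
  assumes inv: "invariant \<mu>" and h: "h \<in> borel_measurable borel" "\<And>x. \<bar>h x\<bar> \<le> c"
  shows "(\<lambda>k. (T ^^ k) h x) \<longlonglongrightarrow> (\<integral>y. h y \<partial>\<mu>)"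
    and "(\<integral>y. h y \<partial>\<mu>) = (\<integral>y. T h y \<partial>\<mu>)"
proof -
  interpret \<mu>: prob_space \<mu> using inv by (simp add: invariant_def)
  have sets_\<mu>[measurable_cong]: "sets \<mu> = sets borel" using inv by (simp add: invariant_def)
  have K': "K \<in> \<mu> \<rightarrow>\<^sub>M subprob_algebra borel" by measurable
  have space_\<mu>: "space \<mu> = UNIV" using sets_eq_imp_space_eq[OF sets_\<mu>] by simp
  have bind: "\<mu> = \<mu> \<bind> K"
  proof (rule measure_eqI)
    have "sets (\<mu> \<bind> K) = sets borel" by (rule sets_bind[OF sets_K]) (simp add: space_\<mu>)
    then show "sets \<mu> = sets (\<mu> \<bind> K)" by (simp add: sets_\<mu>)
    fix A assume "A \<in> sets \<mu>"
    then show "emeasure \<mu> A = emeasure (\<mu> \<bind> K) A"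
      using inv by (subst emeasure_bind[OF _ K']) (auto simp: invariant_def space_\<mu> sets_\<mu>)
  qed
  have step: "(\<integral>y. g y \<partial>\<mu>) = (\<integral>y. T g y \<partial>\<mu>)"
    if g: "g \<in> borel_measurable borel" "\<And>x. \<bar>g x\<bar> \<le> c" for g :: "'a \<Rightarrow> real"
  proof -
    have "(\<integral>y. g y \<partial>\<mu>) = (\<integral>y. g y \<partial>(\<mu> \<bind> K))" using bind by simp
    also have "\<dots> = (\<integral>y. T g y \<partial>\<mu>)" unfolding T_def
      using g prob_space.emeasure_space_1[OF K_prob]
      by (intro integral_bind[OF _ _ K', where B=c and B'=1] \<mu>.finite_measure_axioms) auto
    finally show ?thesis .
  qed
  have pow: "(\<integral>y. (T ^^ k) h y \<partial>\<mu>) = (\<integral>y. h y \<partial>\<mu>)" for k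
  proof (induction k)
    case (Suc k)
    then show ?case using step[of "(T ^^ k) h"] h Tpow_bounded[of h c k] by simp
  qed simp
  have c: "0 \<le> c" using h(2)[of x] by linarith
  have b: "bnd c h" using h c by (intro bnd_bounded) auto
  have [measurable]: "(T ^^ k) h \<in> borel_measurable borel" for k using h(1) by (rule Tpow_meas)
  have int: "integrable \<mu> ((T ^^ k) h)" for k
    using h by (intro integrable_prob_bounded[of _ _ c] \<mu>.prob_space_axioms sets_\<mu> Tpow_bounded) auto
  have "(\<lambda>k. \<integral>y. (T ^^ k) h y - (T ^^ k) h x \<partial>\<mu>) \<longlonglongrightarrow> (\<integral>y. 0 \<partial>\<mu>)"
  proof (rule integral_dominated_convergence[where w="\<lambda>_. 2 * c"])
    show "AE y in \<mu>. (\<lambda>k. (T ^^ k) h y - (T ^^ k) h x) \<longlonglongrightarrow> 0"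
    proof (rule AE_I2)
      fix y
      have "(\<lambda>k. D * c * \<rho> ^ k * (V y + V x)) \<longlonglongrightarrow> D * c * 0 * (V y + V x)"
        using \<rho>01 by (intro tendsto_intros LIMSEQ_realpow_zero) auto
      then have lim: "(\<lambda>k. D * c * \<rho> ^ k * (V y + V x)) \<longlonglongrightarrow> 0" by simp
      show "(\<lambda>k. (T ^^ k) h y - (T ^^ k) h x) \<longlonglongrightarrow> 0"
        by (rule Lim_null_comparison[OF _ lim]) (use osc_decay[OF b, of _ y x] in auto)
    qed
    show "AE y in \<mu>. norm ((T ^^ k) h y - (T ^^ k) h x) \<le> 2 * c" for k
    proof (rule AE_I2)
      fix y
      have "\<bar>(T ^^ k) h y\<bar> \<le> c" "\<bar>(T ^^ k) h x\<bar> \<le> c"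
        using Tpow_bounded[of h c k y] Tpow_bounded[of h c k x] h by auto
      then show "norm ((T ^^ k) h y - (T ^^ k) h x) \<le> 2 * c" unfolding real_norm_def by linarith
    qed
  qed auto
  then have "(\<lambda>k. (\<integral>y. h y \<partial>\<mu>) - (T ^^ k) h x) \<longlonglongrightarrow> 0"
    using int by (simp add: pow \<mu>.prob_space)
  from tendsto_diff[OF tendsto_const this, of "\<integral>y. h y \<partial>\<mu>"]
  show "(\<lambda>k. (T ^^ k) h x) \<longlonglongrightarrow> (\<integral>y. h y \<partial>\<mu>)" by simp
  show "(\<integral>y. h y \<partial>\<mu>) = (\<integral>y. T h y \<partial>\<mu>)" by (rule step[OF h])
qed

text \<open>The means under both laws are limits of the same sequence of iterates.\<close>

lemma invariant_unique:
  assumes "invariant \<mu>" "invariant \<mu>'" shows "\<mu> = \<mu>'"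
proof (rule measure_eqI)
  show s: "sets \<mu> = sets \<mu>'" using assms by (simp add: invariant_def)
  fix A assume "A \<in> sets \<mu>"
  then have A: "A \<in> sets borel" using assms by (simp add: invariant_def)
  have *: "emeasure \<nu> A = ennreal (\<integral>y. indicator A y \<partial>\<nu>)" if "invariant \<nu>" for \<nu>
  proof -
    have \<nu>: "prob_space \<nu>" "sets \<nu> = sets borel" using that by (auto simp: invariant_def)
    have "space \<nu> = UNIV" using sets_eq_imp_space_eq[OF \<nu>(2)] by simp
    then show ?thesis using \<nu>
      using A by (simp add: finite_measure.emeasure_eq_measure prob_space.finite_measure)
  qed
  have "(\<integral>y. indicat_real A y \<partial>\<mu>) = (\<integral>y. indicat_real A y \<partial>\<mu>')"
    by (rule LIMSEQ_unique[OF Tpow_tends_mean(1)[OF assms(1), where c=1] Tpow_tends_mean(1)[OF assms(2), where c=1]])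
      (use A in \<open>auto simp: indicator_def\<close>)
  then show "emeasure \<mu> A = emeasure \<mu>' A" using * assms by metis
qed

end

section \<open>Moments of the invariant law and geometric ergodicity\<close>

locale stationary_chain = harris_chain +
  fixes \<mu> :: "'a measure"
  assumes inv: "invariant \<mu>"
begin

sublocale \<mu>: prob_space \<mu> using inv by (simp add: invariant_def)

lemma sets_\<mu>[measurable_cong, simp]: "sets \<mu> = sets borel"
  using inv by (simp add: invariant_def)

lemma space_\<mu>[simp]: "space \<mu> = UNIV"
  using sets_eq_imp_space_eq[OF sets_\<mu>] by simp

lemma prob_UNIV[simp]: "\<mu>.prob UNIV = 1"
  using \<mu>.prob_space by simp

text \<open>Truncations of \<open>W\<close> are bounded, so their means are limits of iterates,
  which the drift bounds by \<open>W x0 + C / (1 - \<gamma>)\<close> at every truncation level.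
  Fatou's lemma removes the truncation.\<close>

lemma W_int_\<mu>: "integrable \<mu> W"
proof (rule integrableI_nonneg)
  define x0 :: 'a where "x0 = undefined"
  define B where "B = W x0 + C / (1 - \<gamma>)"
  have le: "(\<integral>\<^sup>+x. ennreal (min (W x) (real n)) \<partial>\<mu>) \<le> ennreal B" for n
  proof -
    let ?h = "\<lambda>x. min (W x) (real n)"
    have h: "?h \<in> borel_measurable borel" "\<bar>?h x\<bar> \<le> real n" "0 \<le> ?h x" for x
      using W_ge1[of x] by auto
    have "(T ^^ k) ?h x0 \<le> B" for k
    proof -
      have "norm ((T ^^ k) ?h x) \<le> (T ^^ k) W x \<and> integrable (K x) ((T ^^ k) W)" for x
      proof (induction k arbitrary: x)
        case 0
        then show ?case using W_ge1 W_int by (auto simp: min_def abs_if split: if_splits) (smt (verit) W_ge1)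
      next
        case (Suc k)
        have i: "integrable (K x) ((T ^^ j) W)" for j x
          using Tpow_lyapunov[where U=W and a=\<gamma> and b=C and k=j and x=x] W_int drift \<gamma>01 C0 W_ge1
          unfolding T_def[of W, abs_def] by (simp add: order_trans[OF zero_le_one])
        show ?case
          using T_mono[OF Tpow_meas[OF h(1)] _ i, of k "k" x] Suc i[of x "Suc k"] by simp
      qed
      then have "norm ((T ^^ k) ?h x0) \<le> (T ^^ k) W x0" by blast
      then show ?thesis using Tpow_W[of k x0] by (simp add: B_def)
    qed
    then have "(\<integral>x. ?h x \<partial>\<mu>) \<le> B"
      by (intro tendsto_upperbound[OF Tpow_tends_mean(1)[OF inv h(1,2), of x0]]) auto
    moreover have "(\<integral>\<^sup>+x. ennreal (?h x) \<partial>\<mu>) = ennreal (\<integral>x. ?h x \<partial>\<mu>)"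
      using h by (intro nn_integral_eq_integral integrable_prob_bounded[of _ _ "real n"] \<mu>.prob_space_axioms) auto
    ultimately show ?thesis by (simp add: ennreal_leI)
  qed
  have "(\<integral>\<^sup>+x. ennreal (W x) \<partial>\<mu>) = (\<integral>\<^sup>+x. liminf (\<lambda>n. ennreal (min (W x) (real n))) \<partial>\<mu>)"
  proof (rule nn_integral_cong)
    fix x
    obtain N where "W x \<le> real N" using real_arch_simple by blast
    then have "eventually (\<lambda>n. ennreal (min (W x) (real n)) = ennreal (W x)) sequentially"
      by (auto intro!: eventually_sequentiallyI[of N])
    then have "(\<lambda>n. ennreal (min (W x) (real n))) \<longlonglongrightarrow> ennreal (W x)" by (rule tendsto_eventually)
    from lim_imp_Liminf[OF _ this] show "ennreal (W x) = liminf (\<lambda>n. ennreal (min (W x) (real n)))" by simp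
  qed
  also have "\<dots> \<le> liminf (\<lambda>n. \<integral>\<^sup>+x. ennreal (min (W x) (real n)) \<partial>\<mu>)"
    by (rule nn_integral_liminf) measurable
  also have "\<dots> \<le> ennreal B"
    using le by (intro Liminf_le) auto
  finally show "(\<integral>\<^sup>+x. ennreal (W x) \<partial>\<mu>) < \<infinity>" by (simp add: order_le_less_trans)
  show "AE x in \<mu>. 0 \<le> W x" using W_ge1 by (simp add: order_trans[OF zero_le_one])
qed measurable

lemma V_int_\<mu>: "integrable \<mu> V"
  by (rule Bochner_Integration.integrable_bound[OF W_int_\<mu>])
    (use V_ge1 V_le_W W_ge1 in \<open>auto intro!: AE_I2 simp: order_trans[OF zero_le_one]\<close>)

lemma bnd_int_\<mu>:
  assumes "bnd c \<phi>" shows "integrable \<mu> \<phi>"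
proof (rule Bochner_Integration.integrable_bound)
  show "integrable \<mu> (\<lambda>y. c * V y)" using V_int_\<mu> by simp
  show "\<phi> \<in> borel_measurable \<mu>" using bnd_meas[OF assms] by simp
  show "AE y in \<mu>. norm (\<phi> y) \<le> norm (c * V y)"
    using bndD[OF assms] by (intro AE_I2) (metis abs_ge_self order_trans real_norm_def)
qed

definition mV where "mV = (\<integral>x. V x \<partial>\<mu>)"

lemma mV_ge1: "1 \<le> mV"
  using integral_mono[OF \<mu>.integrable_const[of 1] V_int_\<mu>] V_ge1 by (simp add: mV_def \<mu>.prob_space)

lemma norm_mean_le:
  assumes "bnd c \<phi>" shows "norm (\<integral>x. \<phi> x \<partial>\<mu>) \<le> c * mV"
proof -
  have "norm (\<integral>x. \<phi> x \<partial>\<mu>) \<le> (\<integral>x. c * V x \<partial>\<mu>)"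
    using assms by (intro order_trans[OF integral_norm_bound] integral_mono integrable_norm bnd_int_\<mu> integrable_mult_right V_int_\<mu>)
      (auto simp: bnd_def)
  then show ?thesis by (simp add: mV_def)
qed

lemma mean_T_real:
  fixes h :: "'a \<Rightarrow> real"
  assumes "h \<in> borel_measurable borel" "\<And>x. \<bar>h x\<bar> \<le> c"
  shows "(\<integral>x. T h x \<partial>\<mu>) = (\<integral>x. h x \<partial>\<mu>)"
  using Tpow_tends_mean(2)[OF inv assms] by simp

lemma mean_T:
  fixes h :: "'a \<Rightarrow> complex"
  assumes h: "h \<in> borel_measurable borel" "\<And>x. norm (h x) \<le> c"
  shows "(\<integral>x. T h x \<partial>\<mu>) = (\<integral>x. h x \<partial>\<mu>)"
proof -
  have c: "0 \<le> c" using h(2) norm_ge_zero order_trans by blast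
  have b: "bnd c h" using h c by (intro bnd_bounded)
  have [measurable]: "h \<in> borel_measurable borel" by (rule h)
  have Re: "(\<integral>x. T (\<lambda>x. Re (h x)) x \<partial>\<mu>) = (\<integral>x. Re (h x) \<partial>\<mu>)"
    by (rule mean_T_real[of _ c]) (auto intro: order_trans[OF abs_Re_le_cmod h(2)])
  have Im: "(\<integral>x. T (\<lambda>x. Im (h x)) x \<partial>\<mu>) = (\<integral>x. Im (h x) \<partial>\<mu>)"
    by (rule mean_T_real[of _ c]) (auto intro: order_trans[OF abs_Im_le_cmod h(2)])
  show ?thesis
    using Re Im by (intro complex_eqI) (simp_all add: T_Re[OF b] T_Im[OF b] bnd_int_\<mu>[OF b] bnd_int_\<mu>[OF bnd_T[OF b]])
qed

text \<open>The real estimate carries a factor 2 from \<open>V x + mV \<le> 2 * mV * V x\<close>;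
  adding real and imaginary parts doubles it.\<close>

definition D' where "D' = 4 * D * mV"

lemma D'_pos: "0 < D'" using D_pos mV_ge1 by (simp add: D'_def)

text \<open>The distance to the mean is an average of oscillations over \<mu>. The bound
  \<open>c'\<close> secures invariance of the mean, whereas the rate is proportional to the weighted
  bound \<open>c\<close>, which in the perturbation argument is a power of the small
  parameter.\<close>

lemma ergodic_real:
  fixes h :: "'a \<Rightarrow> real"
  assumes b: "bnd c h" and bd: "\<And>x. \<bar>h x\<bar> \<le> c'"
  shows "\<bar>(T ^^ k) h x - (\<integral>y. h y \<partial>\<mu>)\<bar> \<le> 2 * D * mV * c * \<rho> ^ k * V x"
proof -
  have c: "0 \<le> c" by (rule bnd_nonneg[OF b])
  have [measurable]: "h \<in> borel_measurable borel" by (rule bnd_meas[OF b])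
  have mean: "(\<integral>y. (T ^^ k) h y \<partial>\<mu>) = (\<integral>y. h y \<partial>\<mu>)"
  proof (induction k)
    case (Suc k)
    then show ?case using mean_T_real[of "(T ^^ k) h" c'] Tpow_bounded[of h c'] bd by simp
  qed simp
  have "(T ^^ k) h x - (\<integral>y. h y \<partial>\<mu>) = (\<integral>y. (T ^^ k) h x - (T ^^ k) h y \<partial>\<mu>)"
    using bnd_int_\<mu>[OF bnd_Tpow[OF b, of k]] mean by (simp add: \<mu>.prob_space)
  also have "\<bar>\<dots>\<bar> \<le> (\<integral>y. D * c * \<rho> ^ k * (V x + V y) \<partial>\<mu>)"
    unfolding real_norm_def[symmetric] using bnd_int_\<mu>[OF bnd_Tpow[OF b, of k]] osc_decay[OF b] V_int_\<mu>
    by (intro order_trans[OF integral_norm_bound] integral_mono integrable_norm) auto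
  also have "\<dots> = D * c * \<rho> ^ k * (V x + mV)"
    using V_int_\<mu> by (simp add: mV_def \<mu>.prob_space)
  also have "\<dots> \<le> D * c * \<rho> ^ k * (2 * mV * V x)"
  proof (rule mult_left_mono)
    have "V x \<le> mV * V x" "mV \<le> mV * V x"
      using mV_ge1 V_ge1[of x] by (auto simp: mult_le_cancel_left1 mult_le_cancel_right1)
    then show "V x + mV \<le> 2 * mV * V x" by linarith
  qed (use D_pos c \<rho>01 in auto)
  finally show ?thesis by (simp add: mult_ac)
qed

lemma ergodic:
  fixes h :: "'a \<Rightarrow> complex"
  assumes b: "bnd c h" and bd: "\<And>x. norm (h x) \<le> c'"
  shows "norm ((T ^^ k) h x - (\<integral>y. h y \<partial>\<mu>)) \<le> D' * c * \<rho> ^ k * V x"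
proof -
  have [measurable]: "h \<in> borel_measurable borel" by (rule bnd_meas[OF b])
  have R: "bnd c (\<lambda>x. Re (h x))" "bnd c (\<lambda>x. Im (h x))"
  proof -
    have "\<bar>Re (h x)\<bar> \<le> c * V x" "\<bar>Im (h x)\<bar> \<le> c * V x" for x
      using bndD[OF b, of x] abs_Re_le_cmod[of "h x"] abs_Im_le_cmod[of "h x"] by linarith+
    then show "bnd c (\<lambda>x. Re (h x))" "bnd c (\<lambda>x. Im (h x))" by (auto intro!: bndI)
  qed
  have bd': "\<bar>Re (h x)\<bar> \<le> c'" "\<bar>Im (h x)\<bar> \<le> c'" for x
    using bd[of x] abs_Re_le_cmod[of "h x"] abs_Im_le_cmod[of "h x"] by linarith+
  have "norm ((T ^^ k) h x - (\<integral>y. h y \<partial>\<mu>)) \<le>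
     \<bar>Re ((T ^^ k) h x - (\<integral>y. h y \<partial>\<mu>))\<bar> + \<bar>Im ((T ^^ k) h x - (\<integral>y. h y \<partial>\<mu>))\<bar>" by (rule cmod_le)
  also have "\<dots> \<le> 2 * D * mV * c * \<rho> ^ k * V x + 2 * D * mV * c * \<rho> ^ k * V x"
    using ergodic_real[OF R(1) bd'(1), of k x] ergodic_real[OF R(2) bd'(2), of k x] bnd_int_\<mu>[OF b]
    by (intro add_mono) (simp_all add: Tpow_Re[OF b] Tpow_Im[OF b])
  finally show ?thesis by (simp add: D'_def mult_ac)
qed

end

section \<open>Exponential perturbation of a Harris chain\<close>

text \<open>The constant 3 bounds \<open>exp 1\<close>.\<close>

lemma exp_remainders:
  fixes z :: complex assumes "norm z \<le> 1"
  shows "norm (exp z - 1) \<le> 3 * norm z" "norm (exp z - 1 - z) \<le> 3 * (norm z)\<^sup>2"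
    "norm (exp z - 1 - z - z\<^sup>2 / 2) \<le> 3 * norm z ^ 3"
proof -
  have e: "exp (norm z) \<le> 3" using assms exp_le by (meson exp_le_cancel_iff order_trans)
  have b: "exp (norm z) * x \<le> 3 * x" if "0 \<le> x" for x using mult_right_mono[OF e that] .
  show "norm (exp z - 1) \<le> 3 * norm z"
    using Taylor_exp_field[of z 0] b[of "norm z"] by simp
  show "norm (exp z - 1 - z) \<le> 3 * (norm z)\<^sup>2"
    using Taylor_exp_field[of z 1] b[of "(norm z)\<^sup>2"] by (simp add: numeral_2_eq_2 algebra_simps)
  have "norm (exp z - 1 - z - z\<^sup>2 / 2) \<le> exp (norm z) * norm z ^ 3 / 2"
    using Taylor_exp_field[of z 2] by (simp add: numeral_2_eq_2 numeral_3_eq_3 algebra_simps)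
  also have "\<dots> \<le> 3 * norm z ^ 3" using b[of "norm z ^ 3"] by (smt (verit) divide_le_eq norm_ge_zero zero_le_power mult_nonneg_nonneg exp_ge_zero half_bounded_equal field_sum_of_halves)
  finally show "norm (exp z - 1 - z - z\<^sup>2 / 2) \<le> 3 * norm z ^ 3" .
qed

locale centred_observable = stationary_chain +
  fixes g :: "'a \<Rightarrow> real" and H :: real
  assumes g_meas[measurable]: "g \<in> borel_measurable borel"
    and g_le: "\<bar>g x\<bar> \<le> H" and H_ge1: "1 \<le> H" and g_mean: "(\<integral>x. g x \<partial>\<mu>) = 0"
begin

text \<open>The weight sits at the arrival point, so the iterate at \<open>x\<close> is the
  transform of \<open>g X\<^sub>1 + \<dots> + g X\<^sub>n\<close>, without the initial
  state.\<close>

definition tilted :: "complex \<Rightarrow> nat \<Rightarrow> 'a \<Rightarrow> complex" where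
  "tilted t n = ((\<lambda>\<phi>. T (\<lambda>y. exp (t * of_real (g y)) * \<phi> y)) ^^ n) (\<lambda>_. 1)"

definition cov :: "nat \<Rightarrow> real" where "cov k = (\<integral>x. g x * (T ^^ k) g x \<partial>\<mu>)"

text \<open>The Green-Kubo form of the variance; \<open>poisson_variance\<close> identifies it with
  the form built from the Poisson solution.\<close>

definition asymp_var :: real where "asymp_var = cov 0 + 2 * (\<Sum>k. cov (Suc k))"

text \<open>Boundedness with an untracked constant: enough for linearity of integrals and invariance
  of means. Quantitative estimates go through \<open>bnd\<close>.\<close>

definition tame :: "('a \<Rightarrow> complex) \<Rightarrow> bool" where
  "tame \<phi> \<longleftrightarrow> \<phi> \<in> borel_measurable borel \<and> (\<exists>b. \<forall>x. norm (\<phi> x) \<le> b)"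

lemma tameI: "\<phi> \<in> borel_measurable borel \<Longrightarrow> (\<And>x. norm (\<phi> x) \<le> b) \<Longrightarrow> tame \<phi>"
  by (auto simp: tame_def)

lemma tame_meas: "tame \<phi> \<Longrightarrow> \<phi> \<in> borel_measurable borel" by (simp add: tame_def)

lemma tame_bnd: "tame \<phi> \<Longrightarrow> \<exists>c. bnd c \<phi>"
  unfolding tame_def by (meson bnd_bounded norm_ge_zero order_trans)

lemma tame_bnd': assumes "tame \<phi>" "\<And>x. norm (\<phi> x) \<le> c * V x" shows "bnd c \<phi>"
  using assms by (simp add: tame_def bnd_def)

lemma tame_const: "tame (\<lambda>_. a)" by (rule tameI[of _ "norm a"]) auto

lemma tame_g: "tame (\<lambda>x. of_real (g x))"
  using g_le by (intro tameI[of _ H]) auto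

lemma tame_add: "tame \<phi> \<Longrightarrow> tame \<psi> \<Longrightarrow> tame (\<lambda>x. \<phi> x + \<psi> x)"
  unfolding tame_def by (auto intro!: exI order_trans[OF norm_triangle_ineq] add_mono)

lemma tame_diff: "tame \<phi> \<Longrightarrow> tame \<psi> \<Longrightarrow> tame (\<lambda>x. \<phi> x - \<psi> x)"
  unfolding tame_def by (auto intro!: exI order_trans[OF norm_triangle_ineq4] add_mono)

lemma tame_mult:
  assumes "tame \<phi>" "tame \<psi>" shows "tame (\<lambda>x. \<phi> x * \<psi> x)"
proof -
  obtain a b where "\<And>x. norm (\<phi> x) \<le> a" "\<And>x. norm (\<psi> x) \<le> b" using assms by (auto simp: tame_def)
  then have "norm (\<phi> x * \<psi> x) \<le> a * b" for x
    unfolding norm_mult by (intro mult_mono) (auto intro: order_trans[OF norm_ge_zero])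
  then show ?thesis using assms by (auto simp: tame_def)
qed

lemma tame_cmult: "tame \<phi> \<Longrightarrow> tame (\<lambda>x. a * \<phi> x)"
  by (intro tame_mult tame_const)

lemma tame_divide: "tame \<phi> \<Longrightarrow> tame (\<lambda>x. \<phi> x / a)"
  using tame_cmult[of \<phi> "inverse a"] by (simp add: divide_inverse mult.commute)

lemma tame_T: "tame \<phi> \<Longrightarrow> tame (T \<phi>)"
  unfolding tame_def using T_bounded by (auto intro!: exI)

lemma tame_Tpow: "tame \<phi> \<Longrightarrow> tame ((T ^^ k) \<phi>)"
  by (induction k) (auto intro: tame_T)

lemma tame_sum: "(\<And>i. i \<in> I \<Longrightarrow> tame (f i)) \<Longrightarrow> tame (\<lambda>x. \<Sum>i\<in>I. f i x)"
  by (induction I rule: infinite_finite_induct) (auto intro: tame_const tame_add)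

lemma tame_int: "tame \<phi> \<Longrightarrow> integrable \<mu> \<phi>"
  using tame_bnd bnd_int_\<mu> by blast

lemma tame_exp: "tame (\<lambda>x. exp (t * of_real (g x)))"
proof (rule tameI)
  show "norm (exp (t * of_real (g x))) \<le> exp (norm t * H)" for x
  proof -
    have "norm (exp (t * of_real (g x))) \<le> exp (norm (t * of_real (g x)))" by (rule norm_exp)
    also have "\<dots> \<le> exp (norm t * H)" using g_le by (simp add: norm_mult mult_left_mono)
    finally show ?thesis .
  qed
qed measurable

lemmas tame_intros = tame_const tame_g tame_add tame_diff tame_mult tame_cmult tame_divide tame_T tame_Tpow tame_exp

lemma T_add_tame: "tame \<phi> \<Longrightarrow> tame \<psi> \<Longrightarrow> T (\<lambda>x. \<phi> x + \<psi> x) = (\<lambda>x. T \<phi> x + T \<psi> x)"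
  using tame_bnd T_add by metis

lemma T_diff_tame: "tame \<phi> \<Longrightarrow> tame \<psi> \<Longrightarrow> T (\<lambda>x. \<phi> x - \<psi> x) = (\<lambda>x. T \<phi> x - T \<psi> x)"
  using tame_bnd T_diff by metis

lemma mean_T_tame: "tame \<phi> \<Longrightarrow> (\<integral>x. T \<phi> x \<partial>\<mu>) = (\<integral>x. \<phi> x \<partial>\<mu>)"
  unfolding tame_def using mean_T by blast

text \<open>Unrolled, \<open>w n\<close> is a sum of powers of \<open>T\<close> applied to the
  \<open>r k\<close>. Each \<open>r k\<close> is centred and decays geometrically from the step at
  which it enters, so the sum stays bounded uniformly in \<open>n\<close>.\<close>

lemma recursion_bound:
  fixes w r :: "nat \<Rightarrow> 'a \<Rightarrow> complex"
  assumes w0: "w 0 = (\<lambda>_. 0)" and rstep: "\<And>k. k < n \<Longrightarrow> w (Suc k) = (\<lambda>x. T (w k) x + r k x)"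
    and tame: "\<And>k. k < n \<Longrightarrow> tame (w k)" "\<And>k. k < n \<Longrightarrow> tame (r k)"
    and mean: "\<And>k. k < n \<Longrightarrow> (\<integral>x. r k x \<partial>\<mu>) = 0" and c: "\<And>k. k < n \<Longrightarrow> bnd c (r k)" "0 \<le> c"
  shows "norm (w n x) \<le> D' * c / (1 - \<rho>) * V x"
proof -
  \<comment> \<open>Stated for all powers \<open>j\<close> because the inductive step turns
    \<open>(T ^^ j) (w (Suc k))\<close> into \<open>(T ^^ Suc j) (w k)\<close>.\<close>
  have "norm ((T ^^ j) (w k) x) \<le> D' * c * (\<Sum>i<k. \<rho> ^ (j + i)) * V x" if "k \<le> n" for j k
    using that
  proof (induction k arbitrary: j)
    case (Suc k)
    then have k: "k < n" by simp
    obtain b1 b2 where b: "bnd b1 (T (w k))" "bnd b2 (r k)" using tame[OF k] tame_bnd tame_T by metis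
    obtain b3 where b3: "\<And>x. norm (r k x) \<le> b3" using tame(2)[OF k] by (auto simp: tame_def)
    have "(T ^^ j) (w (Suc k)) x = (T ^^ Suc j) (w k) x + (T ^^ j) (r k) x"
      unfolding rstep[OF k] Tpow_add[OF b] by (simp add: funpow_swap1)
    also have "norm \<dots> \<le> D' * c * (\<Sum>i<k. \<rho> ^ (Suc j + i)) * V x + D' * c * \<rho> ^ j * V x"
    proof (intro order_trans[OF norm_triangle_ineq] add_mono)
      show "norm ((T ^^ Suc j) (w k) x) \<le> D' * c * (\<Sum>i<k. \<rho> ^ (Suc j + i)) * V x"
        by (rule Suc.IH) (use k in simp)
      show "norm ((T ^^ j) (r k) x) \<le> D' * c * \<rho> ^ j * V x"
        using ergodic[OF c(1)[OF k] b3, of j x] mean[OF k] by simp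
    qed
    also have "\<dots> = D' * c * (\<Sum>i<Suc k. \<rho> ^ (j + i)) * V x"
      unfolding sum.lessThan_Suc_shift by (simp add: algebra_simps)
    finally show ?case .
  qed (simp add: w0)
  from this[of n 0] have "norm (w n x) \<le> D' * c * (\<Sum>i<n. \<rho> ^ i) * V x" by simp
  also have "\<dots> \<le> D' * c * (1 / (1 - \<rho>)) * V x"
    using \<rho>01 D'_pos c V_ge1[of x]
    by (intro mult_left_mono mult_right_mono) (auto simp: sum_gp_strict divide_right_mono)
  finally show ?thesis by simp
qed

text \<open>\<open>Cr\<close> and \<open>C3\<close> bound the driving terms of the profile recursion
  at first and second order, with a factor 2 from dividing by a growth factor of modulus at least
  1/2. \<open>C2\<close> and \<open>C4\<close> bound the resulting profiles, \<open>C5\<close> the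
  third order remainder of the growth, \<open>C6\<close> the covariances. With \<tau> for
  \<open>norm t\<close>, \<open>t0\<close> ensures \<open>H * \<tau> \<le> 1\<close>,
  \<open>6 * H * \<tau> * mV \<le> 1 / 2\<close> and \<open>C2 * \<tau> \<le> 1\<close>; there is no
  circularity, as \<open>C2\<close> does not depend on \<open>t0\<close>.\<close>

definition K1 where "K1 = \<kappa> + L"
definition Cr where "Cr = 12 * H * (K1 + mV * (1 + K1))"
definition C2 where "C2 = D' * Cr / (1 - \<rho>)"
definition Q where "Q = 3 * H\<^sup>2 + 3 * H * C2"
definition C3 where "C3 = 2 * (K1 * Q + Q * mV * (2 + K1))"
definition C4 where "C4 = D' * C3 / (1 - \<rho>)"
definition C5 where "C5 = 3 * H ^ 3 * mV + H * C4 * mV + 3 * H\<^sup>2 * C2 * mV"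
definition C6 where "C6 = 2 * D * mV * H\<^sup>2 * mV"
definition t0 where "t0 = 1 / (12 * H * mV + C2 + 1)"

lemma coeffs_nonneg: "0 \<le> K1" "0 \<le> Cr" "0 \<le> C2" "0 \<le> Q" "0 \<le> C3" "0 \<le> C4" "0 \<le> C5" "0 \<le> C6" "0 < t0"
proof -
  have H: "0 \<le> H" "0 \<le> mV" using H_ge1 mV_ge1 by auto
  show K1: "0 \<le> K1" using \<kappa>01 L_pos by (simp add: K1_def)
  show Cr: "0 \<le> Cr" using K1 H by (simp add: Cr_def)
  show C2: "0 \<le> C2" using Cr D'_pos \<rho>01 by (simp add: C2_def)
  show Q: "0 \<le> Q" using C2 H by (simp add: Q_def)
  show C3: "0 \<le> C3" using Q K1 H by (simp add: C3_def)
  show C4: "0 \<le> C4" using C3 D'_pos \<rho>01 by (simp add: C4_def)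
  show "0 \<le> C5" using C2 C4 H by (simp add: C5_def)
  show "0 \<le> C6" using D_pos H by (simp add: C6_def)
  show "0 < t0" using C2 H by (simp add: t0_def add_nonneg_pos)
qed

lemma K1_bnd: "bnd c \<phi> \<Longrightarrow> norm (T \<phi> x) \<le> K1 * c * V x"
  using bndD[OF bnd_T] by (simp add: K1_def)

section \<open>Decay of covariances\<close>

lemma cov_le: "\<bar>cov k\<bar> \<le> C6 * \<rho> ^ k"
proof -
  have b: "bnd H g" using g_le H_ge1 by (intro bnd_bounded) auto
  have "\<bar>(T ^^ k) g x\<bar> \<le> 2 * D * mV * H * \<rho> ^ k * V x" for x
    using ergodic_real[OF b g_le, of k x] by (simp add: g_mean)
  then have "bnd (2 * D * mV * H * \<rho> ^ k) ((T ^^ k) g)" by (intro bndI) (auto intro!: Tpow_meas)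
  then have "bnd (H * (2 * D * mV * H * \<rho> ^ k)) (\<lambda>x. g x * (T ^^ k) g x)"
    using g_le by (intro bnd_mult) auto
  from norm_mean_le[OF this] show ?thesis
    by (simp add: cov_def C6_def power2_eq_square mult_ac)
qed

lemma cov_summable: "summable cov"
  by (rule summable_comparison_test'[of "\<lambda>k. C6 * \<rho> ^ k" 0])
    (use cov_le \<rho>01 in \<open>auto intro!: summable_mult summable_geometric\<close>)

text \<open>Starting from the constant 1, the \<open>n\<close>-th growth factor sees covariances
  only up to lag \<open>n\<close>, so it expands with this truncated variance.\<close>

definition Vn where "Vn n = cov 0 + 2 * (\<Sum>k<n. cov (Suc k))"

lemma Vn_asymp_var: "\<bar>Vn n - asymp_var\<bar> \<le> 2 * C6 / (1 - \<rho>) * \<rho> ^ n"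
proof -
  have s: "summable (\<lambda>k. cov (Suc k))" using cov_summable summable_Suc_iff by blast
  have sg: "summable (\<lambda>k. C6 * \<rho> ^ (k + Suc n))"
    using \<rho>01 by (auto simp: power_add intro!: summable_mult summable_mult2 summable_geometric)
  have "asymp_var - Vn n = 2 * (\<Sum>k. cov (Suc (k + n)))"
    unfolding asymp_var_def Vn_def suminf_split_initial_segment[OF s, of n] by (simp add: algebra_simps)
  also have "\<bar>\<dots>\<bar> \<le> 2 * (\<Sum>k. C6 * \<rho> ^ (k + Suc n))"
  proof -
    have le: "norm (cov (Suc (k + n))) \<le> C6 * \<rho> ^ (k + Suc n)" for k
      using cov_le[of "Suc (k + n)"] by simp
    have sn: "summable (\<lambda>k. norm (cov (Suc (k + n))))"
      by (rule summable_comparison_test'[OF sg]) (use le in auto)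
    have "norm (\<Sum>k. cov (Suc (k + n))) \<le> (\<Sum>k. C6 * \<rho> ^ (k + Suc n))"
      by (rule order_trans[OF summable_norm[OF sn] suminf_le[OF le sn sg]])
    then show ?thesis by simp
  qed
  also have "(\<Sum>k. C6 * \<rho> ^ (k + Suc n)) = C6 * \<rho> ^ Suc n * (1 / (1 - \<rho>))"
  proof -
    have "(\<lambda>k. C6 * \<rho> ^ (k + Suc n)) = (\<lambda>k. (C6 * \<rho> ^ Suc n) * \<rho> ^ k)" by (simp add: power_add mult_ac)
    moreover have "summable (\<lambda>k. \<rho> ^ k)" using \<rho>01 by (simp add: summable_geometric)
    ultimately show ?thesis using \<rho>01 by (simp only: suminf_mult) (simp add: suminf_geometric)
  qed
  also have "2 * \<dots> \<le> 2 * C6 / (1 - \<rho>) * \<rho> ^ n"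
    using \<rho>01 coeffs_nonneg by (simp add: divide_right_mono mult_left_mono mult_left_le_one_le mult_ac mult_left_le)
  finally show ?thesis by (simp add: abs_minus_commute)
qed

end

section \<open>Second order expansion of the growth factors\<close>

context centred_observable begin

context
  fixes t :: complex
  assumes t: "norm t \<le> t0"
begin

abbreviation (input) "\<tau> \<equiv> norm t"

lemma t_bounds: "0 \<le> \<tau>" "H * \<tau> \<le> 1" "6 * H * \<tau> * mV \<le> 1 / 2" "C2 * \<tau> \<le> 1" "\<tau> \<le> 1"
proof -
  define N where "N = 12 * H * mV + C2 + 1"
  have HmV: "1 \<le> H * mV" using mult_mono[OF H_ge1 mV_ge1] H_ge1 by simp
  have HH: "H \<le> H * mV" using mult_left_mono[OF mV_ge1, of H] H_ge1 by simp
  have Hp: "0 \<le> H * mV" using HmV by simp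
  have N: "0 < N" "H \<le> N" "12 * H * mV \<le> N" "C2 \<le> N" "1 \<le> N"
    using HmV HH coeffs_nonneg by (auto simp: N_def)
  have tN: "\<tau> * N \<le> 1" using t N(1) by (simp add: t0_def N_def[symmetric] pos_le_divide_eq)
  have b: "a * \<tau> \<le> 1" if "a \<le> N" for a
  proof -
    have "a * \<tau> \<le> N * \<tau>" using that by (intro mult_right_mono) auto
    then show ?thesis using tN by (simp add: mult.commute)
  qed
  show "0 \<le> \<tau>" by simp
  show "H * \<tau> \<le> 1" "C2 * \<tau> \<le> 1" "\<tau> \<le> 1" using b[OF N(2)] b[OF N(4)] b[OF N(5)] by auto
  show "6 * H * \<tau> * mV \<le> 1 / 2" using b[OF N(3)] by (simp add: mult_ac)
qed

definition e where "e x = exp (t * of_real (g x))"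

lemma tame_e: "tame e" unfolding e_def by (rule tame_exp)

lemma e_rem: "norm (e x - 1) \<le> 3 * H * \<tau>" "norm (e x - 1 - t * of_real (g x)) \<le> 3 * H\<^sup>2 * \<tau>\<^sup>2"
  "norm (e x - 1 - t * of_real (g x) - (t * of_real (g x))\<^sup>2 / 2) \<le> 3 * H ^ 3 * \<tau> ^ 3"
proof -
  define z where "z = t * of_real (g x)"
  have z: "norm z \<le> H * \<tau>" using mult_right_mono[OF g_le[of x], of \<tau>] by (simp add: z_def norm_mult mult.commute)
  have z1: "norm z \<le> 1" using z t_bounds by linarith
  have p: "norm z ^ k \<le> (H * \<tau>) ^ k" for k using z by (intro power_mono) auto
  show "norm (e x - 1) \<le> 3 * H * \<tau>" using exp_remainders(1)[OF z1] z by (simp add: e_def z_def)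
  show "norm (e x - 1 - t * of_real (g x)) \<le> 3 * H\<^sup>2 * \<tau>\<^sup>2"
    using exp_remainders(2)[OF z1] p[of 2] unfolding e_def z_def[symmetric] by (simp add: power_mult_distrib)
  show "norm (e x - 1 - t * of_real (g x) - (t * of_real (g x))\<^sup>2 / 2) \<le> 3 * H ^ 3 * \<tau> ^ 3"
    using exp_remainders(3)[OF z1] p[of 3] unfolding e_def z_def[symmetric] by (simp add: power_mult_distrib)
qed

text \<open>Taking the function as an argument allows \<open>profile\<close> to divide by its own
  growth within the recursion.\<close>

definition growth_of :: "('a \<Rightarrow> complex) \<Rightarrow> complex" where "growth_of w = (\<integral>x. e x * (1 + w x) \<partial>\<mu>)"

text \<open>The iterates of the tilted kernel applied to \<open>1\<close> are normalized to \<open>\<mu>\<close>-mean one at each step: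
  they equal \<open>(\<Prod>k<n. growth k) * (1 + profile n)\<close> with \<open>profile n\<close> of mean zero and size \<open>O(t) V\<close>, so that
  \<open>growth k\<close> can be expanded to second order in \<open>t\<close>. No spectral theory is needed.\<close>

primrec profile :: "nat \<Rightarrow> 'a \<Rightarrow> complex" where
  "profile 0 = (\<lambda>_. 0)"
| "profile (Suc n) = (\<lambda>x. T (\<lambda>y. e y * (1 + profile n y)) x / growth_of (profile n) - 1)"

definition growth where "growth n = growth_of (profile n)"

lemma tame_profile: "tame (profile n)"
  by (induction n) (auto intro!: tame_intros tame_e)

lemma bnd_1: "bnd 1 (\<lambda>_. 1 :: complex)" using bnd_const[of "1::complex"] by simp

lemma bnd_e1:
  assumes "bnd c w" shows "bnd (3 * H * \<tau> * c) (\<lambda>x. (e x - 1) * w x)"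
proof (rule bnd_mult[OF _ _ assms])
  show "(\<lambda>x. e x - 1) \<in> borel_measurable borel" by (intro tame_meas tame_diff tame_e tame_const)
qed (rule e_rem)

text \<open>A profile of weighted norm at most 1 keeps the growth factor within 1/2 of 1, so
  normalizing is harmless. By invariance the mean of
  \<open>T (\<lambda>y. e y * (1 + profile n y))\<close> is the growth factor itself, hence the next
  profile is centred again. In the driving term every summand contains \<open>e y - 1\<close> or
  \<open>1 - growth n\<close>, which makes it first order.\<close>

lemma one_step:
  assumes mean: "(\<integral>x. profile n x \<partial>\<mu>) = 0" and b: "bnd 1 (profile n)"
  shows "growth n = 1 + (\<integral>x. (e x - 1) * (1 + profile n x) \<partial>\<mu>)"
    and "norm (growth n - 1) \<le> 6 * H * \<tau> * mV" and "1 / 2 \<le> norm (growth n)"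
    and "(\<integral>x. profile (Suc n) x \<partial>\<mu>) = 0"
    and "growth n * (profile (Suc n) x - T (profile n) x) = T (\<lambda>y. (e y - 1) * (1 + profile n y)) x + (1 - growth n) * (1 + T (profile n) x)"
    and "bnd (Cr * \<tau>) (\<lambda>x. profile (Suc n) x - T (profile n) x)"
proof -
  let ?w = "profile n" and ?E = "\<lambda>x. (e x - 1) * (1 + profile n x)"
  have te: "tame (\<lambda>x. e x * (1 + profile n x))" "tame ?E" "tame (\<lambda>x. 1 + profile n x)"
    by (auto intro!: tame_intros tame_e tame_profile)
  have bE: "bnd (6 * H * \<tau>) ?E"
    using bnd_e1[OF bnd_add[OF bnd_1 b]] by (simp add: mult_ac)
  have "growth n = (\<integral>x. (1 + profile n x) + ?E x \<partial>\<mu>)"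
    unfolding growth_def growth_of_def by (intro Bochner_Integration.integral_cong) (auto simp: algebra_simps)
  also have "\<dots> = 1 + (\<integral>x. ?E x \<partial>\<mu>)"
    using tame_int[OF te(2)] tame_int[OF te(3)] tame_int[OF tame_profile[of n]] mean by simp
  finally show q: "growth n = 1 + (\<integral>x. ?E x \<partial>\<mu>)" .
  show qb: "norm (growth n - 1) \<le> 6 * H * \<tau> * mV" using norm_mean_le[OF bE] by (simp add: q)
  have "norm (1::complex) \<le> norm (growth n) + norm (1 - growth n)" by (metis add_diff_cancel_left' diff_add_cancel norm_triangle_ineq add.commute)
  then show q2: "1 / 2 \<le> norm (growth n)" using qb t_bounds(3) by (simp add: norm_minus_commute)
  then have q0: "growth n \<noteq> 0" by auto
  have "(\<integral>x. T (\<lambda>y. e y * (1 + profile n y)) x \<partial>\<mu>) = growth n"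
    by (simp add: mean_T_tame[OF te(1)] growth_def growth_of_def)
  then show "(\<integral>x. profile (Suc n) x \<partial>\<mu>) = 0"
    using q0 tame_int[OF tame_T[OF te(1)]] by (simp add: growth_def[symmetric])
  have Te: "T (\<lambda>y. e y * (1 + profile n y)) = (\<lambda>x. 1 + T (profile n) x + T ?E x)"
  proof -
    have "T (\<lambda>y. e y * (1 + profile n y)) = T (\<lambda>y. (1 + profile n y) + ?E y)" by (simp add: algebra_simps)
    also have "\<dots> = (\<lambda>x. T (\<lambda>y. 1 + profile n y) x + T ?E x)" by (rule T_add_tame[OF te(3,2)])
    also have "T (\<lambda>y. 1 + profile n y) = (\<lambda>x. 1 + T (profile n) x)" by (simp add: T_add_tame[OF tame_const tame_profile])
    finally show ?thesis .
  qed
  \<comment> \<open>Multiplying by \<open>growth n\<close> removes the quotient in the definition of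
    \<open>profile\<close>.\<close>
  show eq: "growth n * (profile (Suc n) x - T (profile n) x) = T ?E x + (1 - growth n) * (1 + T (profile n) x)" for x
  proof -
    have alg: "b * ((1 + a + c) / b - 1 - a) = c + (1 - b) * (1 + a)" if "b \<noteq> 0" for a b c :: complex
      using that by (simp add: field_simps)
    show ?thesis unfolding profile.simps Te growth_def[symmetric] by (rule alg[OF q0])
  qed
  show "bnd (Cr * \<tau>) (\<lambda>x. profile (Suc n) x - T (profile n) x)"
  proof (rule tame_bnd')
    show "tame (\<lambda>x. profile (Suc n) x - T (profile n) x)" by (intro tame_intros tame_profile)
    fix x
    let ?r = "profile (Suc n) x - T (profile n) x"
    have V1: "1 \<le> V x" by (rule V_ge1)
    have "norm (1 + T (profile n) x) \<le> 1 * V x + K1 * 1 * V x"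
      using K1_bnd[OF b, of x] V1 by (intro order_trans[OF norm_triangle_ineq] add_mono) auto
    then have b1: "norm (1 + T (profile n) x) \<le> (1 + K1) * V x" by (simp add: distrib_right)
    have "1 / 2 * norm ?r \<le> norm (growth n) * norm ?r" using q2 by (intro mult_right_mono) auto
    also have "\<dots> = norm (T ?E x + (1 - growth n) * (1 + T (profile n) x))" unfolding norm_mult[symmetric] eq ..
    also have "\<dots> \<le> norm (T ?E x) + norm (1 - growth n) * norm (1 + T (profile n) x)"
      unfolding norm_mult[symmetric] by (rule norm_triangle_ineq)
    also have "\<dots> \<le> K1 * (6 * H * \<tau>) * V x + (6 * H * \<tau> * mV) * ((1 + K1) * V x)"
      using qb b1 K1_bnd[OF bE, of x] H_ge1 mV_ge1
      by (intro add_mono mult_mono) (auto simp: norm_minus_commute intro!: mult_nonneg_nonneg)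
    finally show "norm ?r \<le> Cr * \<tau> * V x" by (simp add: Cr_def algebra_simps)
  qed
qed

text \<open>A bootstrap: \<open>one_step\<close> needs the bound 1, \<open>recursion_bound\<close>
  returns \<open>C2 * \<tau>\<close>, and the choice of \<open>t0\<close> keeps this below 1. The
  driving terms of all earlier steps enter, hence the induction over initial segments.\<close>

lemma profile_all: "(\<forall>k\<le>n. (\<integral>x. profile k x \<partial>\<mu>) = 0 \<and> bnd (C2 * \<tau>) (profile k))"
proof (induction n)
  case 0
  then show ?case using bnd_const[of "0::complex"] coeffs_nonneg by (auto intro: bnd_mono)
next
  case (Suc n)
  have b1: "(\<integral>x. profile k x \<partial>\<mu>) = 0" "bnd 1 (profile k)" if "k \<le> n" for k
    using Suc that t_bounds(4) by (auto intro: bnd_mono)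
  have m: "(\<integral>x. profile (Suc n) x \<partial>\<mu>) = 0" by (rule one_step(4)[OF b1]) auto
  have "norm (profile (Suc n) x) \<le> D' * (Cr * \<tau>) / (1 - \<rho>) * V x" for x
  proof (rule recursion_bound[where r="\<lambda>k x. profile (Suc k) x - T (profile k) x"])
    fix k assume k: "k < Suc n"
    show "(\<integral>x. profile (Suc k) x - T (profile k) x \<partial>\<mu>) = 0"
      using one_step(4)[OF b1, of k] b1[of k] k tame_int[OF tame_profile[of "Suc k"]] tame_int[OF tame_T[OF tame_profile[of k]]]
      by (simp add: mean_T_tame[OF tame_profile] del: profile.simps)
    show "bnd (Cr * \<tau>) (\<lambda>x. profile (Suc k) x - T (profile k) x)" using one_step(6)[OF b1, of k] k by simp
  qed (use coeffs_nonneg in \<open>auto intro!: tame_intros tame_profile tame_e simp del: profile.simps(2)\<close>)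
  then have "bnd (C2 * \<tau>) (profile (Suc n))" by (intro tame_bnd' tame_profile) (simp add: C2_def mult.assoc del: profile.simps)
  then show ?case using Suc m by (auto simp: le_Suc_eq)
qed

lemma profile_mean: "(\<integral>x. profile n x \<partial>\<mu>) = 0" and profile_bnd: "bnd (C2 * \<tau>) (profile n)" and profile_bnd1: "bnd 1 (profile n)"
  using profile_all[of n] t_bounds(4) by (auto intro: bnd_mono)

lemmas one_step' = one_step[OF profile_mean profile_bnd1]

lemma tilted_prod: "tilted t n x = (\<Prod>k<n. growth k) * (1 + profile n x)"
proof -
  have "tilted t n = (\<lambda>x. (\<Prod>k<n. growth k) * (1 + profile n x))"
  proof (induction n)
    case 0
    then show ?case by (simp add: tilted_def)
  next
    case (Suc n)
    have q0: "growth n \<noteq> 0" using one_step'(3)[of n] by auto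
    have "tilted t (Suc n) = T (\<lambda>y. e y * tilted t n y)" by (simp add: tilted_def e_def)
    also have "\<dots> = (\<lambda>x. (\<Prod>k<n. growth k) * T (\<lambda>y. e y * (1 + profile n y)) x)"
      by (simp add: Suc T_cmult[symmetric] mult_ac)
    also have "\<dots> = (\<lambda>x. (\<Prod>k<Suc n. growth k) * (1 + profile (Suc n) x))"
      using q0 by (simp add: growth_def[symmetric])
    finally show ?case .
  qed
  then show ?thesis by simp
qed

text \<open>The first order coefficient of \<open>profile n\<close> in \<open>t\<close>: a truncated
  Poisson series without its zeroth term.\<close>

definition poisson_sum :: "nat \<Rightarrow> 'a \<Rightarrow> complex" where
  "poisson_sum n x = (\<Sum>k<n. (T ^^ Suc k) (\<lambda>x. of_real (g x)) x)"

lemma tame_poisson_sum: "tame (poisson_sum n)" unfolding poisson_sum_def by (intro tame_sum tame_intros)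

lemma poisson_sum_Suc: "poisson_sum (Suc n) = (\<lambda>x. T (poisson_sum n) x + T (\<lambda>x. of_real (g x)) x)"
proof -
  have "T (poisson_sum n) = (\<lambda>x. \<Sum>k<n. (T ^^ Suc (Suc k)) (\<lambda>x. of_real (g x)) x)" for n
  proof (induction n)
    case 0
    then show ?case by (simp add: poisson_sum_def[abs_def])
  next
    case (Suc n)
    have "poisson_sum (Suc n) = (\<lambda>x. poisson_sum n x + (T ^^ Suc n) (\<lambda>x. of_real (g x)) x)" by (simp add: poisson_sum_def fun_eq_iff)
    then have "T (poisson_sum (Suc n)) = T (\<lambda>x. poisson_sum n x + (T ^^ Suc n) (\<lambda>x. of_real (g x)) x)" by (simp only:)
    also have "\<dots> = (\<lambda>x. T (poisson_sum n) x + T ((T ^^ Suc n) (\<lambda>x. of_real (g x))) x)"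
      by (intro T_add_tame tame_poisson_sum tame_intros)
    finally show ?case using Suc by simp
  qed
  then show ?thesis unfolding poisson_sum_def[of "Suc n", abs_def] sum.lessThan_Suc_shift by (simp add: fun_eq_iff add.commute)
qed

lemma bnd_E2: "bnd (Q * \<tau>\<^sup>2) (\<lambda>x. (e x - 1 - t * of_real (g x)) + (e x - 1) * profile n x)"
proof -
  have "bnd (3 * H\<^sup>2 * \<tau>\<^sup>2) (\<lambda>x. e x - 1 - t * of_real (g x))"
    using e_rem(2) by (intro bnd_bounded tame_meas tame_intros tame_e) auto
  from bnd_add[OF this bnd_e1[OF profile_bnd[of n]]]
  show ?thesis by (rule bnd_mono) (simp add: Q_def power2_eq_square algebra_simps)
qed

lemma tame_E2: "tame (\<lambda>x. (e x - 1 - t * of_real (g x)) + (e x - 1) * profile n x)"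
  by (intro tame_intros tame_e tame_profile)

lemma g_mean_c: "(\<integral>x. complex_of_real (g x) \<partial>\<mu>) = 0"
  by (simp add: g_mean)

text \<open>Because \<open>g\<close> is centred, the first order term \<open>t * g\<close>
  integrates to 0, which makes \<open>growth n - 1\<close> second order.\<close>

lemma growth_E2: "growth n = 1 + (\<integral>x. (e x - 1 - t * of_real (g x)) + (e x - 1) * profile n x \<partial>\<mu>)"
proof -
  have "(\<integral>x. (e x - 1) * (1 + profile n x) \<partial>\<mu>) =
      (\<integral>x. ((e x - 1 - t * of_real (g x)) + (e x - 1) * profile n x) + t * of_real (g x) \<partial>\<mu>)"
    by (intro Bochner_Integration.integral_cong) (auto simp: algebra_simps)
  also have "\<dots> = (\<integral>x. (e x - 1 - t * of_real (g x)) + (e x - 1) * profile n x \<partial>\<mu>) + (\<integral>x. t * of_real (g x) \<partial>\<mu>)"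
    by (intro Bochner_Integration.integral_add tame_int tame_E2 tame_intros)
  finally show ?thesis using g_mean_c by (simp add: one_step'(1))
qed

lemma growth_1_le: "norm (growth n - 1) \<le> Q * mV * \<tau>\<^sup>2"
  using norm_mean_le[OF bnd_E2[of n]] by (simp add: growth_E2 mult_ac)

text \<open>\<open>t * poisson_sum n\<close> obeys the same recursion with driving term
  \<open>t * T g\<close>. Subtracting it removes the first order part of the driving term of the
  profile; what is left is centred and second order, so \<open>recursion_bound\<close> applies once
  more.\<close>

lemma second_order: "bnd (C4 * \<tau>\<^sup>2) (\<lambda>x. profile n x - t * poisson_sum n x)"
proof -
  let ?g = "\<lambda>x. complex_of_real (g x)"
  define r where "r k x = (profile (Suc k) x - T (profile k) x) - t * T ?g x" for k x
  have tame_r: "tame (r k)" for k unfolding r_def by (intro tame_intros tame_profile)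
  have tmul: "T (\<lambda>x. t * poisson_sum k x) = (\<lambda>x. t * T (poisson_sum k) x)" for k by (rule T_cmult)
  have rbnd: "bnd (C3 * \<tau>\<^sup>2) (r k)" for k
  proof (rule tame_bnd'[OF tame_r])
    fix x
    let ?E = "\<lambda>x. (e x - 1 - t * of_real (g x)) + (e x - 1) * profile k x"
    have V1: "1 \<le> V x" by (rule V_ge1)
    have "T (\<lambda>y. (e y - 1) * (1 + profile k y)) = T (\<lambda>y. ?E y + t * ?g y)" by (simp add: algebra_simps)
    also have "\<dots> = (\<lambda>x. T ?E x + T (\<lambda>y. t * ?g y) x)" by (intro T_add_tame tame_E2 tame_intros)
    also have "\<dots> = (\<lambda>x. T ?E x + t * T ?g x)" by (simp only: T_cmult)
    finally have TE: "T (\<lambda>y. (e y - 1) * (1 + profile k y)) x = T ?E x + t * T ?g x" by (rule fun_cong)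
    have eq: "growth k * r k x = T ?E x + (1 - growth k) * (1 + T (profile k) x + t * T ?g x)"
    proof -
      have "growth k * r k x = growth k * (profile (Suc k) x - T (profile k) x) - growth k * (t * T ?g x)" by (simp add: r_def right_diff_distrib)
      then show ?thesis unfolding one_step'(5) TE by (simp add: algebra_simps)
    qed
    have tg: "norm (t * T ?g x) \<le> 1"
    proof -
      have "norm (T ?g x) \<le> H" using g_le by (intro T_bounded) auto
      then have "norm (t * T ?g x) \<le> \<tau> * H" unfolding norm_mult by (intro mult_left_mono) auto
      then show ?thesis using t_bounds(2) by (simp add: mult.commute)
    qed
    have "norm (1 + T (profile k) x + t * T ?g x) \<le> norm (1 + T (profile k) x) + norm (t * T ?g x)" by (rule norm_triangle_ineq)
    also have "\<dots> \<le> (1 + norm (T (profile k) x)) + 1" using tg norm_triangle_ineq[of 1 "T (profile k) x"] by simp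
    also have "\<dots> \<le> (2 + K1) * V x" using K1_bnd[OF profile_bnd1, of k x] V1 by (simp add: algebra_simps)
    finally have b1: "norm (1 + T (profile k) x + t * T ?g x) \<le> (2 + K1) * V x" .
    have "1 / 2 * norm (r k x) \<le> norm (growth k) * norm (r k x)" using one_step'(3)[of k] by (intro mult_right_mono) auto
    also have "\<dots> = norm (T ?E x + (1 - growth k) * (1 + T (profile k) x + t * T ?g x))" unfolding norm_mult[symmetric] eq ..
    also have "\<dots> \<le> norm (T ?E x) + norm (1 - growth k) * norm (1 + T (profile k) x + t * T ?g x)"
      unfolding norm_mult[symmetric] by (rule norm_triangle_ineq)
    also have "\<dots> \<le> K1 * (Q * \<tau>\<^sup>2) * V x + (Q * mV * \<tau>\<^sup>2) * ((2 + K1) * V x)"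
    proof (intro add_mono mult_mono)
      show "norm (1 - growth k) \<le> Q * mV * \<tau>\<^sup>2" using growth_1_le[of k] by (simp add: norm_minus_commute)
      show "0 \<le> Q * mV * \<tau>\<^sup>2" using coeffs_nonneg(4) mV_ge1 by simp
    qed (use b1 K1_bnd[OF bnd_E2, of k x] in auto)
    finally show "norm (r k x) \<le> C3 * \<tau>\<^sup>2 * V x" by (simp add: C3_def algebra_simps)
  qed
  have "norm (profile n x - t * poisson_sum n x) \<le> D' * (C3 * \<tau>\<^sup>2) / (1 - \<rho>) * V x" for x
  proof (rule recursion_bound[where w="\<lambda>k x. profile k x - t * poisson_sum k x" and r=r])
    show "(\<lambda>x. profile 0 x - t * poisson_sum 0 x) = (\<lambda>_. 0)" by (simp add: poisson_sum_def)
    fix k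
    have "T (\<lambda>x. profile k x - t * poisson_sum k x) = (\<lambda>x. T (profile k) x - t * T (poisson_sum k) x)"
    proof -
      have "T (\<lambda>x. profile k x - t * poisson_sum k x) = (\<lambda>x. T (profile k) x - T (\<lambda>x. t * poisson_sum k x) x)"
        by (intro T_diff_tame tame_cmult tame_profile tame_poisson_sum)
      then show ?thesis by (simp only: tmul)
    qed
    then show "(\<lambda>x. profile (Suc k) x - t * poisson_sum (Suc k) x) = (\<lambda>x. T (\<lambda>x. profile k x - t * poisson_sum k x) x + r k x)"
      by (simp add: r_def poisson_sum_Suc algebra_simps del: profile.simps)
    show "tame (\<lambda>x. profile k x - t * poisson_sum k x)" by (intro tame_intros tame_profile tame_poisson_sum)
    show "tame (r k)" by (rule tame_r)
    have "integrable \<mu> (profile (Suc k))" "integrable \<mu> (T (profile k))" "integrable \<mu> (T ?g)"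
      by (intro tame_int tame_intros tame_profile)+
    then show "(\<integral>x. r k x \<partial>\<mu>) = 0" unfolding r_def
      by (simp add: profile_mean mean_T_tame[OF tame_profile] mean_T_tame[OF tame_g] g_mean_c del: profile.simps of_real_eq_0_iff integral_complex_of_real)
    show "bnd (C3 * \<tau>\<^sup>2) (r k)" by (rule rbnd)
  qed (use coeffs_nonneg in auto)
  then show ?thesis by (intro tame_bnd' tame_intros tame_profile tame_poisson_sum) (simp add: C4_def mult.assoc)
qed

text \<open>\<open>?A\<close>, \<open>t * ?B\<close> and \<open>?C\<close> collect what is third
  order: the Taylor remainder of the weight, the deviation of the profile from its first order
  coefficient, and the second order remainder times the profile. The rest,
  \<open>t\<^sup>2 / 2 * g\<^sup>2 + t\<^sup>2 * g * poisson_sum n\<close>, has mean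
  \<open>t\<^sup>2 * Vn n / 2\<close>.\<close>

lemma growth_expansion: "norm (growth n - 1 - t\<^sup>2 * of_real (Vn n) / 2) \<le> C5 * \<tau> ^ 3"
proof -
  let ?g = "\<lambda>x. complex_of_real (g x)"
  let ?A = "\<lambda>x. e x - 1 - t * ?g x - (t * ?g x)\<^sup>2 / 2"
  let ?B = "\<lambda>x. ?g x * (profile n x - t * poisson_sum n x)"
  let ?C = "\<lambda>x. (e x - 1 - t * ?g x) * profile n x"
  have bA: "bnd (3 * H ^ 3 * \<tau> ^ 3) ?A"
    using e_rem(3) H_ge1 by (intro bnd_bounded) (auto simp: power2_eq_square intro!: tame_meas tame_intros tame_e)
  have bB: "bnd (H * (C4 * \<tau>\<^sup>2)) ?B" using g_le by (intro bnd_mult second_order) auto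
  have bC: "bnd (3 * H\<^sup>2 * \<tau>\<^sup>2 * (C2 * \<tau>)) ?C"
    using e_rem(2) by (intro bnd_mult profile_bnd tame_meas tame_intros tame_e) auto
  have tA: "tame ?A" unfolding power2_eq_square by (intro tame_intros tame_e)
  have tB: "tame ?B" by (intro tame_intros tame_profile tame_poisson_sum)
  have tC: "tame ?C" by (intro tame_intros tame_profile tame_e)
  have gg: "tame (\<lambda>x. ?g x * ?g x)" "tame (\<lambda>x. ?g x * poisson_sum n x)" by (intro tame_intros tame_poisson_sum)+
  have cov0: "(\<integral>x. ?g x * ?g x \<partial>\<mu>) = of_real (cov 0)"
    unfolding cov_def of_real_mult[symmetric] integral_complex_of_real by simp
  have covS: "(\<integral>x. ?g x * poisson_sum n x \<partial>\<mu>) = of_real (\<Sum>k<n. cov (Suc k))"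
  proof -
    have "(\<integral>x. ?g x * poisson_sum n x \<partial>\<mu>) = (\<integral>x. (\<Sum>k<n. of_real (g x * (T ^^ Suc k) g x)) \<partial>\<mu>)"
      unfolding poisson_sum_def sum_distrib_left Tpow_of_real of_real_mult ..
    also have "\<dots> = (\<Sum>k<n. \<integral>x. of_real (g x * (T ^^ Suc k) g x) \<partial>\<mu>)"
    proof (rule Bochner_Integration.integral_sum)
      fix k
      have "tame (\<lambda>x. ?g x * (T ^^ Suc k) ?g x)" by (intro tame_intros)
      then show "integrable \<mu> (\<lambda>x. complex_of_real (g x * (T ^^ Suc k) g x))"
        unfolding Tpow_of_real of_real_mult[symmetric] by (rule tame_int)
    qed
    also have "\<dots> = of_real (\<Sum>k<n. cov (Suc k))" unfolding integral_complex_of_real cov_def of_real_sum ..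
    finally show ?thesis .
  qed
  have "(\<lambda>x. (e x - 1 - t * ?g x) + (e x - 1) * profile n x) =
     (\<lambda>x. (?A x + t * ?B x + ?C x) + ((t\<^sup>2 / 2) * (?g x * ?g x) + t\<^sup>2 * (?g x * poisson_sum n x)))"
    by (simp add: fun_eq_iff field_simps power2_eq_square)
  then have "growth n - 1 = (\<integral>x. (?A x + t * ?B x + ?C x) + ((t\<^sup>2 / 2) * (?g x * ?g x) + t\<^sup>2 * (?g x * poisson_sum n x)) \<partial>\<mu>)"
    unfolding growth_E2 by simp
  also have "\<dots> = (\<integral>x. ?A x + t * ?B x + ?C x \<partial>\<mu>) + (\<integral>x. (t\<^sup>2 / 2) * (?g x * ?g x) + t\<^sup>2 * (?g x * poisson_sum n x) \<partial>\<mu>)"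
    by (intro Bochner_Integration.integral_add tame_int tame_add tame_cmult tA tB tC gg)
  also have "(\<integral>x. (t\<^sup>2 / 2) * (?g x * ?g x) + t\<^sup>2 * (?g x * poisson_sum n x) \<partial>\<mu>) =
      (\<integral>x. (t\<^sup>2 / 2) * (?g x * ?g x) \<partial>\<mu>) + (\<integral>x. t\<^sup>2 * (?g x * poisson_sum n x) \<partial>\<mu>)"
    by (intro Bochner_Integration.integral_add tame_int tame_cmult gg)
  also have "\<dots> = t\<^sup>2 * of_real (Vn n) / 2"
    by (simp only: integral_mult_right_zero cov0 covS) (simp add: Vn_def algebra_simps)
  also have "(\<integral>x. ?A x + t * ?B x + ?C x \<partial>\<mu>) = (\<integral>x. ?A x \<partial>\<mu>) + t * (\<integral>x. ?B x \<partial>\<mu>) + (\<integral>x. ?C x \<partial>\<mu>)"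
    using tame_int[OF tA] tame_int[OF tB] tame_int[OF tC] by simp
  finally have eq: "growth n - 1 - t\<^sup>2 * of_real (Vn n) / 2 = (\<integral>x. ?A x \<partial>\<mu>) + t * (\<integral>x. ?B x \<partial>\<mu>) + (\<integral>x. ?C x \<partial>\<mu>)" by simp
  have tri: "norm (a + t * b + c) \<le> \<tau> * q + r + s" if "norm a \<le> r" "norm b \<le> q" "norm c \<le> s" for a b c :: complex and q r s
  proof -
    have "norm (a + t * b + c) \<le> norm a + norm (t * b) + norm c"
      using norm_triangle_ineq[of "a + t * b" c] norm_triangle_ineq[of a "t * b"] by linarith
    moreover have "norm (t * b) \<le> \<tau> * q" using that by (simp add: norm_mult mult_left_mono)
    ultimately show ?thesis using that by linarith
  qed
  have "norm (growth n - 1 - t\<^sup>2 * of_real (Vn n) / 2) \<le> \<tau> * (H * (C4 * \<tau>\<^sup>2) * mV) + 3 * H ^ 3 * \<tau> ^ 3 * mV + 3 * H\<^sup>2 * \<tau>\<^sup>2 * (C2 * \<tau>) * mV"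
    unfolding eq by (rule tri[OF norm_mean_le[OF bA] norm_mean_le[OF bB] norm_mean_le[OF bC]])
  also have "\<dots> = (3 * H ^ 3 * mV + H * C4 * mV + 3 * H\<^sup>2 * C2 * mV) * \<tau> ^ 3"
    by (simp add: power2_eq_square power3_eq_cube algebra_simps)
  finally show ?thesis by (simp add: C5_def)
qed

definition C7 where "C7 = C5 + 2 * (Q * mV)\<^sup>2"
definition C8 where "C8 = C6 / (1 - \<rho>)"

text \<open>The growth factor lies within 1/2 of 1, so the principal logarithm is safe, and
  linearizing it costs a multiple of \<open>\<tau> ^ 4\<close>. Replacing \<open>Vn n\<close> by its
  limit costs only second order in \<tau>, but with a factor \<open>\<rho> ^ n\<close> that is
  summable over the steps.\<close>

lemma Ln_growth: "norm (Ln (growth n) - t\<^sup>2 * of_real asymp_var / 2) \<le> C7 * \<tau> ^ 3 + C8 * \<rho> ^ n * \<tau>\<^sup>2" "exp (Ln (growth n)) = growth n"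
proof -
  define u where "u = growth n - 1"
  have u2: "norm u \<le> 1 / 2" using one_step'(2)[of n] t_bounds(3) by (simp add: u_def)
  have uQ: "norm u \<le> Q * mV * \<tau>\<^sup>2" using growth_1_le[of n] by (simp add: u_def)
  have "norm (Ln (1 + u) - u) \<le> (norm u)\<^sup>2 / (1 - norm u)" using u2 by (intro Ln_approx_linear) simp
  also have "\<dots> \<le> (norm u)\<^sup>2 / (1 / 2)" using u2 by (intro divide_left_mono) auto
  also have "\<dots> \<le> 2 * (Q * mV * \<tau>\<^sup>2)\<^sup>2" using power_mono[OF uQ, of 2] by simp
  also have "\<dots> = 2 * (Q * mV)\<^sup>2 * (\<tau> ^ 3 * \<tau>)" by (simp add: power2_eq_square power3_eq_cube mult_ac)
  also have "\<dots> \<le> 2 * (Q * mV)\<^sup>2 * (\<tau> ^ 3 * 1)" using t_bounds by (intro mult_left_mono) auto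
  finally have 1: "norm (Ln (growth n) - (growth n - 1)) \<le> 2 * (Q * mV)\<^sup>2 * \<tau> ^ 3" by (simp add: u_def)
  have 2: "norm (t\<^sup>2 * of_real (Vn n) / 2 - t\<^sup>2 * of_real asymp_var / 2) \<le> C8 * \<rho> ^ n * \<tau>\<^sup>2"
  proof -
    have "t\<^sup>2 * of_real (Vn n) / 2 - t\<^sup>2 * of_real asymp_var / 2 = t\<^sup>2 / 2 * of_real (Vn n - asymp_var)"
      by (simp add: algebra_simps diff_divide_distrib)
    also have "norm \<dots> = \<tau>\<^sup>2 / 2 * \<bar>Vn n - asymp_var\<bar>" by (simp only: norm_mult norm_divide norm_power norm_of_real) simp
    also have "\<dots> \<le> \<tau>\<^sup>2 / 2 * (2 * C6 / (1 - \<rho>) * \<rho> ^ n)" by (intro mult_left_mono Vn_asymp_var) auto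
    finally show ?thesis by (simp add: C8_def mult_ac)
  qed
  have "Ln (growth n) - t\<^sup>2 * of_real asymp_var / 2 = (Ln (growth n) - (growth n - 1)) + (growth n - 1 - t\<^sup>2 * of_real (Vn n) / 2)
      + (t\<^sup>2 * of_real (Vn n) / 2 - t\<^sup>2 * of_real asymp_var / 2)" by simp
  also have "norm \<dots> \<le> 2 * (Q * mV)\<^sup>2 * \<tau> ^ 3 + C5 * \<tau> ^ 3 + C8 * \<rho> ^ n * \<tau>\<^sup>2"
    by (intro order_trans[OF norm_triangle_ineq] add_mono 1 2 growth_expansion)
  also have "\<dots> = C7 * \<tau> ^ 3 + C8 * \<rho> ^ n * \<tau>\<^sup>2" by (simp add: C7_def algebra_simps)
  finally show "norm (Ln (growth n) - t\<^sup>2 * of_real asymp_var / 2) \<le> C7 * \<tau> ^ 3 + C8 * \<rho> ^ n * \<tau>\<^sup>2" .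
  have "growth n \<noteq> 0" using one_step'(3)[of n] by auto
  then show "exp (Ln (growth n)) = growth n" by simp
qed

text \<open>Adding logarithms, the third order errors grow like \<open>n * \<tau> ^ 3\<close>,
  whereas the geometric ones sum to a multiple of \<open>\<tau>\<^sup>2\<close> independent of
  \<open>n\<close>.\<close>

lemma tilted_exp:
  "\<exists>E u. tilted t n x = exp (of_nat n * t\<^sup>2 * of_real asymp_var / 2 + E) * (1 + u) \<and>
     norm E \<le> C7 * real n * \<tau> ^ 3 + C8 / (1 - \<rho>) * \<tau>\<^sup>2 \<and> norm u \<le> C2 * \<tau> * V x"
proof (intro exI conjI)
  define E where "E = (\<Sum>k<n. Ln (growth k) - t\<^sup>2 * of_real asymp_var / 2)"
  have "(\<Prod>k<n. growth k) = exp (\<Sum>k<n. Ln (growth k))" by (simp add: exp_sum Ln_growth(2))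
  also have "(\<Sum>k<n. Ln (growth k)) = of_nat n * t\<^sup>2 * of_real asymp_var / 2 + E" by (simp add: E_def sum_subtractf)
  finally show "tilted t n x = exp (of_nat n * t\<^sup>2 * of_real asymp_var / 2 + E) * (1 + profile n x)" by (simp add: tilted_prod)
  have "norm E \<le> (\<Sum>k<n. C7 * \<tau> ^ 3 + C8 * \<rho> ^ k * \<tau>\<^sup>2)"
    unfolding E_def by (intro sum_norm_le Ln_growth(1))
  also have "\<dots> = C7 * real n * \<tau> ^ 3 + C8 * \<tau>\<^sup>2 * (\<Sum>k<n. \<rho> ^ k)"
    by (simp add: sum.distrib sum_distrib_left mult_ac)
  also have "\<dots> \<le> C7 * real n * \<tau> ^ 3 + C8 * \<tau>\<^sup>2 * (1 / (1 - \<rho>))"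
    using \<rho>01 coeffs_nonneg
    by (intro add_left_mono mult_left_mono) (auto simp: sum_gp_strict divide_right_mono C8_def)
  finally show "norm E \<le> C7 * real n * \<tau> ^ 3 + C8 / (1 - \<rho>) * \<tau>\<^sup>2" by simp
  show "norm (profile n x) \<le> C2 * \<tau> * V x" using bndD[OF profile_bnd] .
qed

end

end

section \<open>Poisson equation and asymptotic variance\<close>

context harris_chain begin

lemma invariant_bind:
  assumes "invariant \<mu>" shows "\<mu> \<bind> K = \<mu>"
proof (rule measure_eqI)
  have sets_\<mu>[measurable_cong]: "sets \<mu> = sets borel" using assms by (simp add: invariant_def)
  have space_\<mu>: "space \<mu> = UNIV" using sets_eq_imp_space_eq[OF sets_\<mu>] by simp
  have K': "K \<in> \<mu> \<rightarrow>\<^sub>M subprob_algebra borel" by measurable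
  show s: "sets (\<mu> \<bind> K) = sets \<mu>" using sets_bind[OF sets_K, of \<mu>] by (simp add: space_\<mu> sets_\<mu>)
  fix A assume "A \<in> sets (\<mu> \<bind> K)"
  then show "emeasure (\<mu> \<bind> K) A = emeasure \<mu> A"
    using assms s by (subst emeasure_bind[OF _ K']) (auto simp: invariant_def space_\<mu>)
qed

end

context stationary_chain begin

text \<open>Functions with a \<open>V\<close>-bound may be unbounded, so \<open>mean_T\<close> does
  not apply to their squares. Invariance is used through the nonnegative integral of
  \<open>(f x)\<^sup>2\<close>, which is finite because
  \<open>(f x)\<^sup>2 \<le> c\<^sup>2 * W x\<close>; the comparison itself is Jensen's
  inequality.\<close>

lemma mean_T_sq_le:
  fixes f :: "'a \<Rightarrow> real"
  assumes f: "bnd c f"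
  shows "(\<integral>x. (T f x)\<^sup>2 \<partial>\<mu>) \<le> (\<integral>x. (f x)\<^sup>2 \<partial>\<mu>)"
    and "integrable \<mu> (\<lambda>x. (f x)\<^sup>2)"
proof -
  have [measurable]: "f \<in> borel_measurable borel" by (rule bnd_meas[OF f])
  have le: "(f x)\<^sup>2 \<le> c\<^sup>2 * W x" for x
    using power_mono[OF bndD[OF f, of x], of 2] by (simp add: power_mult_distrib V_sq)
  have iK: "integrable (K x) (\<lambda>y. (f y)\<^sup>2)" for x
  proof (rule Bochner_Integration.integrable_bound)
    show "integrable (K x) (\<lambda>y. c\<^sup>2 * W y)" using W_int by simp
    show "AE y in K x. norm ((f y)\<^sup>2) \<le> norm (c\<^sup>2 * W y)" using le by (intro AE_I2) (auto intro: order_trans[OF _ abs_ge_self])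
  qed simp
  show i\<mu>: "integrable \<mu> (\<lambda>y. (f y)\<^sup>2)"
  proof (rule Bochner_Integration.integrable_bound)
    show "integrable \<mu> (\<lambda>y. c\<^sup>2 * W y)" using W_int_\<mu> by simp
    show "AE y in \<mu>. norm ((f y)\<^sup>2) \<le> norm (c\<^sup>2 * W y)" using le by (intro AE_I2) (auto intro: order_trans[OF _ abs_ge_self])
  qed simp
  have jensen: "(T f x)\<^sup>2 \<le> T (\<lambda>y. (f y)\<^sup>2) x" for x
  proof -
    interpret Kx: prob_space "K x" by (rule K_prob)
    show ?thesis
      using Kx.variance_positive[of f] Kx.variance_eq[OF bnd_int[OF f] iK] by (simp add: T_def)
  qed
  have [measurable]: "T f \<in> borel_measurable borel" "T (\<lambda>y. (f y)\<^sup>2) \<in> borel_measurable borel" by (rule T_meas, measurable)+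
  have K': "K \<in> \<mu> \<rightarrow>\<^sub>M subprob_algebra borel" by measurable
  have nn: "(\<integral>\<^sup>+x. ennreal (T (\<lambda>y. (f y)\<^sup>2) x) \<partial>\<mu>) = ennreal (\<integral>x. (f x)\<^sup>2 \<partial>\<mu>)"
  proof -
    have "ennreal (T (\<lambda>y. (f y)\<^sup>2) x) = (\<integral>\<^sup>+y. ennreal ((f y)\<^sup>2) \<partial>K x)" for x
      unfolding T_def by (rule nn_integral_eq_integral[symmetric]) (auto intro: iK)
    then have "(\<integral>\<^sup>+x. ennreal (T (\<lambda>y. (f y)\<^sup>2) x) \<partial>\<mu>) = (\<integral>\<^sup>+x. (\<integral>\<^sup>+y. ennreal ((f y)\<^sup>2) \<partial>K x) \<partial>\<mu>)" by simp
    also have "\<dots> = (\<integral>\<^sup>+y. ennreal ((f y)\<^sup>2) \<partial>(\<mu> \<bind> K))"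
      by (rule nn_integral_bind[symmetric, OF _ K']) measurable
    also have "\<dots> = ennreal (\<integral>x. (f x)\<^sup>2 \<partial>\<mu>)"
      unfolding invariant_bind[OF inv] by (rule nn_integral_eq_integral[OF i\<mu>]) simp
    finally show ?thesis .
  qed
  have nnT: "0 \<le> T (\<lambda>y. (f y)\<^sup>2) x" for x using jensen[of x] zero_le_power2 order_trans by blast
  have iT: "integrable \<mu> (T (\<lambda>y. (f y)\<^sup>2))"
    using nn nnT by (intro integrableI_nonneg) auto
  have iTf: "integrable \<mu> (\<lambda>x. (T f x)\<^sup>2)"
  proof (rule Bochner_Integration.integrable_bound[OF iT])
    show "AE x in \<mu>. norm ((T f x)\<^sup>2) \<le> norm (T (\<lambda>y. (f y)\<^sup>2) x)"
      using jensen by (intro AE_I2) (auto intro: order_trans[OF _ abs_ge_self])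
  qed simp
  have "(\<integral>x. (T f x)\<^sup>2 \<partial>\<mu>) \<le> (\<integral>x. T (\<lambda>y. (f y)\<^sup>2) x \<partial>\<mu>)"
    by (rule integral_mono[OF iTf iT jensen])
  also have "ennreal \<dots> = (\<integral>\<^sup>+x. ennreal (T (\<lambda>y. (f y)\<^sup>2) x) \<partial>\<mu>)"
    by (rule nn_integral_eq_integral[symmetric, OF iT]) (simp add: nnT)
  then have "(\<integral>x. T (\<lambda>y. (f y)\<^sup>2) x \<partial>\<mu>) = (\<integral>x. (f x)\<^sup>2 \<partial>\<mu>)"
    unfolding nn using nnT by (simp add: integral_nonneg_AE)
  finally show "(\<integral>x. (T f x)\<^sup>2 \<partial>\<mu>) \<le> (\<integral>x. (f x)\<^sup>2 \<partial>\<mu>)" .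
qed

end

section \<open>Solution of the Poisson equation and its variance\<close>

context centred_observable begin

definition Cg where "Cg = 2 * D * mV * H"

lemma Tpow_g_bnd: "bnd (Cg * \<rho> ^ k) ((T ^^ k) g)"
proof (rule bndI)
  have b: "bnd H g" using g_le H_ge1 by (intro bnd_bounded) auto
  show "norm ((T ^^ k) g x) \<le> Cg * \<rho> ^ k * V x" for x
    using ergodic_real[OF b g_le, of k x] by (simp add: g_mean Cg_def)
qed measurable

lemma Cg_summable: "summable (\<lambda>k. Cg * \<rho> ^ k * a)"
  using \<rho>01 by (intro summable_mult summable_mult2 summable_geometric) simp

lemma Tpow_g_summable: "summable (\<lambda>k. (T ^^ k) g y)"
  by (rule summable_comparison_test'[OF Cg_summable[of "V y"]]) (rule bndD[OF Tpow_g_bnd])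

definition poisson :: "'a \<Rightarrow> real" where "poisson y = - (\<Sum>k. (T ^^ k) g y)"

lemma poisson_bnd: "bnd (Cg / (1 - \<rho>)) poisson"
proof (rule bndI)
  show "poisson \<in> borel_measurable borel"
    unfolding poisson_def by measurable
  fix y
  have sn: "summable (\<lambda>k. norm ((T ^^ k) g y))"
    by (rule summable_comparison_test'[OF Cg_summable[of "V y"]]) (use bndD[OF Tpow_g_bnd] in auto)
  have "norm (poisson y) \<le> (\<Sum>k. Cg * \<rho> ^ k * V y)"
    unfolding poisson_def norm_minus_cancel
    by (rule order_trans[OF summable_norm[OF sn] suminf_le[OF bndD[OF Tpow_g_bnd] sn Cg_summable]])
  also have "(\<lambda>k. Cg * \<rho> ^ k * V y) = (\<lambda>k. (Cg * V y) * \<rho> ^ k)" by (simp add: mult_ac)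
  also have "suminf \<dots> = (Cg * V y) * (1 / (1 - \<rho>))"
    using \<rho>01 by (subst suminf_mult) (auto simp: suminf_geometric intro: summable_geometric)
  finally show "norm (poisson y) \<le> Cg / (1 - \<rho>) * V y" by simp
qed

text \<open>The geometric bound dominates the series, so \<open>T\<close> acts termwise and merely
  shifts it; the zeroth term is what remains.\<close>

lemma poisson_equation: "T poisson y - poisson y = g y"
proof -
  have "T (\<lambda>y. \<Sum>k. (T ^^ k) g y) y = (\<Sum>k. \<integral>z. (T ^^ k) g z \<partial>K y)"
    unfolding T_def[of "\<lambda>y. \<Sum>k. (T ^^ k) g y"]
  proof (rule integral_suminf)
    show "integrable (K y) ((T ^^ k) g)" for k by (rule bnd_int[OF Tpow_g_bnd])
    show "AE z in K y. summable (\<lambda>k. norm ((T ^^ k) g z))"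
      by (intro AE_I2 summable_comparison_test'[OF Cg_summable]) (use bndD[OF Tpow_g_bnd] in auto)
    show "summable (\<lambda>k. \<integral>z. norm ((T ^^ k) g z) \<partial>K y)"
    proof (rule summable_comparison_test'[OF Cg_summable[of "T V y"]])
      fix k
      have "norm (\<integral>z. norm ((T ^^ k) g z) \<partial>K y) = (\<integral>z. norm ((T ^^ k) g z) \<partial>K y)" by simp
      also have "\<dots> \<le> (\<integral>z. Cg * \<rho> ^ k * V z \<partial>K y)"
        using bndD[OF Tpow_g_bnd[of k]] by (intro integral_mono integrable_norm bnd_int[OF Tpow_g_bnd] integrable_mult_right V_int)
      finally show "norm (\<integral>z. norm ((T ^^ k) g z) \<partial>K y) \<le> Cg * \<rho> ^ k * T V y" by (simp add: T_def)
    qed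
  qed
  also have "\<dots> = (\<Sum>k. (T ^^ Suc k) g y)" by (simp add: T_def[of "(T ^^ _) g"])
  also have "\<dots> = (\<Sum>k. (T ^^ k) g y) - g y"
    using suminf_split_head[OF Tpow_g_summable, of y] by simp
  finally have *: "T (\<lambda>y. \<Sum>k. (T ^^ k) g y) y = (\<Sum>k. (T ^^ k) g y) - g y" .
  have "T poisson y = - T (\<lambda>y. \<Sum>k. (T ^^ k) g y) y" unfolding T_def poisson_def by simp
  then show ?thesis using * by (simp add: poisson_def)
qed

text \<open>Write \<open>f\<close> for the solution. Since \<open>T f = f + g\<close>, the
  difference of squares is \<open>- 2 * f * g - g\<^sup>2\<close>, and termwise integration of
  \<open>f * g\<close> gives minus the sum of all covariances.\<close>

lemma poisson_variance: "(\<integral>y. (poisson y)\<^sup>2 \<partial>\<mu>) - (\<integral>y. (T poisson y)\<^sup>2 \<partial>\<mu>) = asymp_var"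
proof -
  have [measurable]: "poisson \<in> borel_measurable borel" by (rule bnd_meas[OF poisson_bnd])
  have i1: "integrable \<mu> (\<lambda>y. (poisson y)\<^sup>2)" by (rule mean_T_sq_le(2)[OF poisson_bnd])
  have i2: "integrable \<mu> (\<lambda>y. g y * poisson y)"
    by (rule bnd_int_\<mu>[OF bnd_mult[OF g_meas _ poisson_bnd, of H]]) (use g_le in simp)
  have i3: "integrable \<mu> (\<lambda>y. g y * g y)"
    by (rule bnd_int_\<mu>[OF bnd_mult[OF g_meas _ bnd_bounded[OF g_meas, of H], of H]]) (use g_le H_ge1 in auto)
  have sq: "(T poisson y)\<^sup>2 = (poisson y)\<^sup>2 + 2 * (g y * poisson y) + g y * g y" for y
  proof -
    have "T poisson y = poisson y + g y" using poisson_equation[of y] by simp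
    then show ?thesis by (simp add: power2_eq_square algebra_simps)
  qed
  have mix: "(\<integral>y. g y * poisson y \<partial>\<mu>) = - (\<Sum>k. cov k)"
  proof -
    have "(\<integral>y. g y * poisson y \<partial>\<mu>) = - (\<integral>y. (\<Sum>k. g y * (T ^^ k) g y) \<partial>\<mu>)"
      unfolding poisson_def by (simp add: suminf_mult[OF Tpow_g_summable])
    also have "(\<integral>y. (\<Sum>k. g y * (T ^^ k) g y) \<partial>\<mu>) = (\<Sum>k. \<integral>y. g y * (T ^^ k) g y \<partial>\<mu>)"
    proof (rule integral_suminf)
      have b: "bnd (H * (Cg * \<rho> ^ k)) (\<lambda>y. g y * (T ^^ k) g y)" for k
        using g_le by (intro bnd_mult Tpow_g_bnd) auto
      show "integrable \<mu> (\<lambda>y. g y * (T ^^ k) g y)" for k by (rule bnd_int_\<mu>[OF b])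
      show "AE y in \<mu>. summable (\<lambda>k. norm (g y * (T ^^ k) g y))"
      proof (intro AE_I2 summable_comparison_test'[OF Cg_summable])
        fix y k show "norm (norm (g y * (T ^^ k) g y)) \<le> Cg * \<rho> ^ k * (H * V y)"
          using bndD[OF b[of k], of y] by (simp add: mult_ac)
      qed
      show "summable (\<lambda>k. \<integral>y. norm (g y * (T ^^ k) g y) \<partial>\<mu>)"
      proof (rule summable_comparison_test'[OF Cg_summable[of "H * mV"]])
        fix k
        have "norm (\<integral>z. norm (g z * (T ^^ k) g z) \<partial>\<mu>) = (\<integral>z. norm (g z * (T ^^ k) g z) \<partial>\<mu>)" by simp
        also have "\<dots> \<le> (\<integral>z. (H * (Cg * \<rho> ^ k)) * V z \<partial>\<mu>)"
          using bndD[OF b[of k]] by (intro integral_mono integrable_norm bnd_int_\<mu>[OF b] integrable_mult_right V_int_\<mu>)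
        also have "\<dots> = Cg * \<rho> ^ k * (H * mV)" by (simp add: mV_def)
        finally show "norm (\<integral>z. norm (g z * (T ^^ k) g z) \<partial>\<mu>) \<le> Cg * \<rho> ^ k * (H * mV)" .
      qed
    qed
    finally show ?thesis by (simp add: cov_def)
  qed
  have "(\<integral>y. (T poisson y)\<^sup>2 \<partial>\<mu>) = (\<integral>y. (poisson y)\<^sup>2 \<partial>\<mu>) + 2 * (\<integral>y. g y * poisson y \<partial>\<mu>) + (\<integral>y. g y * g y \<partial>\<mu>)"
    unfolding sq using i1 i2 i3 by simp
  moreover have "(\<integral>y. g y * g y \<partial>\<mu>) = cov 0" by (simp add: cov_def)
  moreover have "(\<Sum>k. cov k) = cov 0 + (\<Sum>k. cov (Suc k))" using suminf_split_head[OF cov_summable] by simp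
  ultimately show ?thesis by (simp add: mix asymp_var_def)
qed

text \<open>The sign is not visible in the covariance series; it comes from the Poisson form by
  Jensen's inequality.\<close>

lemma asymp_var_nonneg: "0 \<le> asymp_var"
  using mean_T_sq_le(1)[OF poisson_bnd] by (simp flip: poisson_variance)

lemma cov_sums: "(\<lambda>k. cov (Suc k)) sums ((asymp_var - cov 0) / 2)"
proof -
  have "summable (\<lambda>k. cov (Suc k))" using cov_summable summable_Suc_iff by blast
  then show ?thesis using summable_sums by (simp add: asymp_var_def)
qed

end

section \<open>Limit theorems for additive functionals\<close>

lemma char_gauss_law:
  assumes "0 \<le> V" shows "real_distribution (gauss_law V)" "char (gauss_law V) u = exp (of_real (- (u\<^sup>2 * V / 2)))"
proof -
  show "real_distribution (gauss_law V)"
  proof (cases "V = 0")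
    case True
    have "prob_space (return lborel (0::real))" by (rule prob_space_return) simp
    then show ?thesis using True
      by (auto simp: gauss_law_def real_distribution_def real_distribution_axioms_def)
  next
    case False
    have "prob_space (density lborel (normal_density 0 (sqrt V)))"
      using assms False by (intro prob_space_normal_density) simp
    then show ?thesis using False
      by (auto simp: gauss_law_def real_distribution_def real_distribution_axioms_def)
  qed
  show "char (gauss_law V) u = exp (of_real (- (u\<^sup>2 * V / 2)))"
  proof (cases "V = 0")
    case True
    have "char (return lborel 0) u = iexp (u * 0)"
      unfolding char_def by (subst integral_return) auto
    then show ?thesis using True by (simp add: gauss_law_def)
  next
    case False
    then have V: "0 < sqrt V" using assms by simp
    interpret N: prob_space std_normal_distribution by (rule prob_space_normal_density) simp
    have "distributed std_normal_distribution lborel (\<lambda>x. x) std_normal_density"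
      by (auto simp: distributed_def distr_id2 normal_density_nonneg)
    from N.normal_density_affine[OF this _ , of "sqrt V" 0]
    have "distributed std_normal_distribution lborel (\<lambda>x. sqrt V * x) (normal_density 0 (sqrt V))"
      using V by simp
    then have "density lborel (normal_density 0 (sqrt V)) = distr std_normal_distribution lborel (\<lambda>x. sqrt V * x)"
      by (simp add: distributed_def)
    then have "char (gauss_law V) u = (CLINT x|distr std_normal_distribution lborel (\<lambda>x. sqrt V * x). iexp (u * x))"
      using False by (simp add: gauss_law_def char_def)
    also have "\<dots> = (CLINT x|std_normal_distribution. iexp (u * (sqrt V * x)))"
      by (subst integral_distr) auto
    also have "\<dots> = char std_normal_distribution (u * sqrt V)" by (simp add: char_def mult.assoc)
    also have "\<dots> = of_real (exp (- (u\<^sup>2 * V / 2)))"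
      using assms by (simp add: char_std_normal_distribution power_mult_distrib)
    also have "\<dots> = exp (of_real (- (u\<^sup>2 * V / 2)))" by (rule exp_of_real[symmetric])
    finally show ?thesis .
  qed
qed

text \<open>The limit theorems use only a deterministic bound on \<open>S n\<close> and its
  transform; an abstract probability space separates them from the construction of the
  paths.\<close>

locale partial_sums = centred_observable K W \<gamma> C \<mu> g H + Om: prob_space M
  for K :: "'a::topological_space \<Rightarrow> 'a measure" and W \<gamma> C \<mu> g H and M :: "'m measure" +
  fixes S :: "nat \<Rightarrow> 'm \<Rightarrow> real" and x :: 'a
  assumes S_meas[measurable]: "S n \<in> borel_measurable M"
    and S_le: "\<bar>S n \<omega>\<bar> \<le> real n * H"
    and S_mgf: "(\<integral>\<omega>. exp (t * of_real (S n \<omega>)) \<partial>M) = tilted t n x"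
begin

text \<open>The remainders of \<open>tilted_exp\<close> are selected along the sequence. They are
  controlled only where \<open>norm (t n) \<le> t0\<close>, hence eventually.\<close>

lemma tilted_exp_seq:
  assumes t: "t \<longlonglongrightarrow> (0::complex)"
  obtains E u where "eventually (\<lambda>n. tilted (t n) n x = exp (of_nat n * (t n)\<^sup>2 * of_real asymp_var / 2 + E n) * (1 + u n)) sequentially"
    "eventually (\<lambda>n. norm (E n) \<le> C7 * real n * norm (t n) ^ 3 + C8 / (1 - \<rho>) * (norm (t n))\<^sup>2) sequentially"
    "u \<longlonglongrightarrow> 0"
proof -
  have "\<forall>n. \<exists>E u. norm (t n) \<le> t0 \<longrightarrow> tilted (t n) n x = exp (of_nat n * (t n)\<^sup>2 * of_real asymp_var / 2 + E) * (1 + u) \<and>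
     norm E \<le> C7 * real n * norm (t n) ^ 3 + C8 / (1 - \<rho>) * (norm (t n))\<^sup>2 \<and> norm u \<le> C2 * norm (t n) * V x"
    using tilted_exp by blast
  then obtain E u where Eu: "\<And>n. norm (t n) \<le> t0 \<Longrightarrow> tilted (t n) n x = exp (of_nat n * (t n)\<^sup>2 * of_real asymp_var / 2 + E n) * (1 + u n) \<and>
     norm (E n) \<le> C7 * real n * norm (t n) ^ 3 + C8 / (1 - \<rho>) * (norm (t n))\<^sup>2 \<and> norm (u n) \<le> C2 * norm (t n) * V x"
    by metis
  have ev: "eventually (\<lambda>n. norm (t n) \<le> t0) sequentially"
    using order_tendstoD(2)[OF tendsto_norm_zero[OF t] coeffs_nonneg(9)] by eventually_elim simp
  show ?thesis
  proof
    show "eventually (\<lambda>n. tilted (t n) n x = exp (of_nat n * (t n)\<^sup>2 * of_real asymp_var / 2 + E n) * (1 + u n)) sequentially"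
      using ev by eventually_elim (use Eu in blast)
    show "eventually (\<lambda>n. norm (E n) \<le> C7 * real n * norm (t n) ^ 3 + C8 / (1 - \<rho>) * (norm (t n))\<^sup>2) sequentially"
      using ev by eventually_elim (use Eu in blast)
    have "(\<lambda>n. C2 * norm (t n) * V x) \<longlonglongrightarrow> C2 * 0 * V x"
      by (intro tendsto_intros tendsto_norm_zero t)
    then have lim: "(\<lambda>n. C2 * norm (t n) * V x) \<longlonglongrightarrow> 0" by simp
    show "u \<longlonglongrightarrow> 0"
      by (rule Lim_null_comparison[OF _ lim]) (use ev in eventually_elim, use Eu in blast)
  qed
qed

lemma clt: "weak_conv_m (\<lambda>n. distr M borel (\<lambda>\<omega>. S n \<omega> / sqrt (real n))) (gauss_law asymp_var)"
proof (rule levy_continuity)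
  show "real_distribution (distr M borel (\<lambda>\<omega>. S n \<omega> / sqrt (real n)))" for n
    by (rule Om.real_distribution_distr) measurable
  show "real_distribution (gauss_law asymp_var)" by (rule char_gauss_law(1)[OF asymp_var_nonneg])
  fix s :: real
  \<comment> \<open>This makes the transform the characteristic function at \<open>s\<close>, and
    \<open>n * norm (t n) ^ 3\<close> is of order \<open>1 / sqrt n\<close>. At \<open>n = 0\<close>
    division by zero gives 0, so the quadratic term is identified only for positive
    \<open>n\<close>.\<close>
  define t where "t n = \<i> * of_real (s / sqrt (real n))" for n
  have nt: "norm (t n) = \<bar>s\<bar> / sqrt (real n)" for n by (simp add: t_def norm_mult norm_divide)
  have nt0: "(\<lambda>n. \<bar>s\<bar> / sqrt (real n)) \<longlonglongrightarrow> 0" by real_asymp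
  then have t: "t \<longlonglongrightarrow> 0" using tendsto_norm_zero_iff[of t sequentially] by (simp add: nt)
  obtain E u where ev: "eventually (\<lambda>n. tilted (t n) n x = exp (of_nat n * (t n)\<^sup>2 * of_real asymp_var / 2 + E n) * (1 + u n)) sequentially"
    and E: "eventually (\<lambda>n. norm (E n) \<le> C7 * real n * norm (t n) ^ 3 + C8 / (1 - \<rho>) * (norm (t n))\<^sup>2) sequentially"
    and u: "u \<longlonglongrightarrow> 0"
    by (rule tilted_exp_seq[OF t])
  have "(\<lambda>n. C7 * real n * (\<bar>s\<bar> / sqrt (real n)) ^ 3 + C8 / (1 - \<rho>) * (\<bar>s\<bar> / sqrt (real n))\<^sup>2) \<longlonglongrightarrow> 0"
  proof -
    have "(\<lambda>n. real n * (1 / sqrt (real n)) ^ 3) \<longlonglongrightarrow> 0" by real_asymp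
    from tendsto_mult[OF tendsto_const[of "\<bar>s\<bar> ^ 3"] this]
    have "(\<lambda>n. real n * (\<bar>s\<bar> / sqrt (real n)) ^ 3) \<longlonglongrightarrow> 0" by (simp add: power_divide mult_ac)
    from tendsto_add[OF tendsto_mult[OF tendsto_const[of C7] this] tendsto_mult[OF tendsto_const[of "C8 / (1 - \<rho>)"] tendsto_power[OF nt0, of 2]]]
    show ?thesis by (simp add: mult.assoc)
  qed
  then have E0: "E \<longlonglongrightarrow> 0" using E by (intro Lim_null_comparison[of E]) (simp_all add: nt)
  have sq: "eventually (\<lambda>n. of_nat n * (t n)\<^sup>2 * of_real asymp_var / 2 = complex_of_real (- (s\<^sup>2 * asymp_var / 2))) sequentially"
    using eventually_gt_at_top[of 0]
  proof eventually_elim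
    case (elim n)
    have "(t n)\<^sup>2 = - of_real (s\<^sup>2 / real n)"
      using elim by (simp add: t_def power_mult_distrib power_divide flip: of_real_power)
    then have "of_nat n * (t n)\<^sup>2 * of_real asymp_var / 2 = - of_real (real n * (s\<^sup>2 / real n) * asymp_var / 2)" by simp
    then show ?case using elim by simp
  qed
  have "(\<lambda>n. exp (complex_of_real (- (s\<^sup>2 * asymp_var / 2)) + E n) * (1 + u n)) \<longlonglongrightarrow> exp (complex_of_real (- (s\<^sup>2 * asymp_var / 2)) + 0) * (1 + 0)"
    by (intro tendsto_intros E0 u)
  then have "(\<lambda>n. tilted (t n) n x) \<longlonglongrightarrow> char (gauss_law asymp_var) s"
    unfolding char_gauss_law(2)[OF asymp_var_nonneg] add_0_right mult_1_right
  proof (rule Lim_transform_eventually)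
    show "eventually (\<lambda>n. exp (complex_of_real (- (s\<^sup>2 * asymp_var / 2)) + E n) * (1 + u n) = tilted (t n) n x) sequentially"
      using ev sq by eventually_elim simp
  qed
  moreover have "char (distr M borel (\<lambda>\<omega>. S n \<omega> / sqrt (real n))) s = tilted (t n) n x" for n
  proof -
    have "char (distr M borel (\<lambda>\<omega>. S n \<omega> / sqrt (real n))) s = (CLINT \<omega>|M. iexp (s * (S n \<omega> / sqrt (real n))))"
      unfolding char_def by (subst integral_distr) auto
    also have "\<dots> = (\<integral>\<omega>. exp (t n * of_real (S n \<omega>)) \<partial>M)"
      by (simp add: t_def mult_ac)
    finally show ?thesis by (simp add: S_mgf)
  qed
  ultimately show "(\<lambda>n. char (distr M borel (\<lambda>\<omega>. S n \<omega> / sqrt (real n))) s) \<longlonglongrightarrow> char (gauss_law asymp_var) s" by simp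
qed

text \<open>Tilting by \<open>l\<close> at speed \<open>(a n)\<^sup>2\<close> means
  \<open>t n = l * a n / sqrt n\<close>, so \<open>n * (t n)\<^sup>2\<close> is
  \<open>l\<^sup>2 * (a n)\<^sup>2\<close>. Divided by the speed, the third order error is of order
  \<open>a n / sqrt n\<close>, and the remaining ones vanish as well.\<close>

lemma moderate_mgf:
  assumes a: "filterlim a at_top sequentially" "(\<lambda>n. a n / sqrt (real n)) \<longlonglongrightarrow> 0"
  shows "quadratic_mgf M (\<lambda>n \<omega>. S n \<omega> / (sqrt (real n) * a n)) (\<lambda>n. (a n)\<^sup>2) asymp_var"
proof (rule quadratic_mgf.intro)
  show "prob_space M" by (rule Om.prob_space_axioms)
  show "quadratic_mgf_axioms M (\<lambda>n \<omega>. S n \<omega> / (sqrt (real n) * a n)) (\<lambda>n. (a n)\<^sup>2) asymp_var"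
  proof (rule quadratic_mgf_axioms.intro)
    show "(\<lambda>\<omega>. S n \<omega> / (sqrt (real n) * a n)) \<in> borel_measurable M" for n by measurable
    show "filterlim (\<lambda>n. (a n)\<^sup>2) at_top sequentially"
      using filterlim_pow_at_top[OF _ a(1), of 2] by simp
    show "0 \<le> asymp_var" by (rule asymp_var_nonneg)
    show "integrable M (\<lambda>\<omega>. exp (l * (a n)\<^sup>2 * (S n \<omega> / (sqrt (real n) * a n))))" for l n
    proof (rule Om.integrable_const_bound[of _ "exp (\<bar>l * (a n)\<^sup>2 / (sqrt (real n) * a n)\<bar> * (real n * H))"])
      show "AE \<omega> in M. norm (exp (l * (a n)\<^sup>2 * (S n \<omega> / (sqrt (real n) * a n)))) \<le> exp (\<bar>l * (a n)\<^sup>2 / (sqrt (real n) * a n)\<bar> * (real n * H))"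
      proof (rule AE_I2)
        fix \<omega>
        have "l * (a n)\<^sup>2 * (S n \<omega> / (sqrt (real n) * a n)) = l * (a n)\<^sup>2 / (sqrt (real n) * a n) * S n \<omega>" by simp
        also have "\<dots> \<le> \<bar>l * (a n)\<^sup>2 / (sqrt (real n) * a n)\<bar> * \<bar>S n \<omega>\<bar>" unfolding abs_mult[symmetric] by (rule abs_ge_self)
        also have "\<dots> \<le> \<bar>l * (a n)\<^sup>2 / (sqrt (real n) * a n)\<bar> * (real n * H)" by (intro mult_left_mono S_le) simp
        finally show "norm (exp (l * (a n)\<^sup>2 * (S n \<omega> / (sqrt (real n) * a n)))) \<le> exp (\<bar>l * (a n)\<^sup>2 / (sqrt (real n) * a n)\<bar> * (real n * H))" by simp
      qed
    qed measurable
    fix l :: real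
    define t where "t n = complex_of_real (l * (a n / sqrt (real n)))" for n
    have nt: "norm (t n) = \<bar>l\<bar> * \<bar>a n / sqrt (real n)\<bar>" for n by (simp only: t_def norm_of_real abs_mult)
    have rt: "(\<lambda>n. l * (a n / sqrt (real n))) \<longlonglongrightarrow> l * 0" by (intro tendsto_intros a(2))
    then have t: "t \<longlonglongrightarrow> 0" using tendsto_of_real[OF rt, where 'a=complex] unfolding t_def by (simp only: mult_zero_right of_real_0)
    obtain E u where ev: "eventually (\<lambda>n. tilted (t n) n x = exp (of_nat n * (t n)\<^sup>2 * of_real asymp_var / 2 + E n) * (1 + u n)) sequentially"
      and E: "eventually (\<lambda>n. norm (E n) \<le> C7 * real n * norm (t n) ^ 3 + C8 / (1 - \<rho>) * (norm (t n))\<^sup>2) sequentially"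
      and u: "u \<longlonglongrightarrow> 0"
      by (rule tilted_exp_seq[OF t])
    have apos: "eventually (\<lambda>n. 1 \<le> a n) sequentially" using a(1) by (simp add: filterlim_at_top)
    have a2inv: "(\<lambda>n. 1 / (a n)\<^sup>2) \<longlonglongrightarrow> 0"
      using tendsto_divide_0[OF tendsto_const filterlim_at_top_imp_at_infinity[OF filterlim_pow_at_top[OF _ a(1), of 2]]] by simp
    have Ebound: "(\<lambda>n. C7 * (\<bar>l\<bar> ^ 3 * \<bar>a n / sqrt (real n)\<bar>) + C8 / (1 - \<rho>) * (norm (t n))\<^sup>2 * (1 / (a n)\<^sup>2)) \<longlonglongrightarrow> 0"
    proof -
      have "(\<lambda>n. C7 * (\<bar>l\<bar> ^ 3 * \<bar>a n / sqrt (real n)\<bar>) + C8 / (1 - \<rho>) * (norm (t n))\<^sup>2 * (1 / (a n)\<^sup>2))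
         \<longlonglongrightarrow> C7 * (\<bar>l\<bar> ^ 3 * \<bar>0\<bar>) + C8 / (1 - \<rho>) * 0\<^sup>2 * 0"
        by (intro tendsto_intros a(2) tendsto_norm_zero t a2inv)
      then show ?thesis by simp
    qed
    have E0: "(\<lambda>n. Re (E n) / (a n)\<^sup>2) \<longlonglongrightarrow> 0"
    proof (rule Lim_null_comparison[OF _ Ebound])
      show "eventually (\<lambda>n. norm (Re (E n) / (a n)\<^sup>2) \<le> C7 * (\<bar>l\<bar> ^ 3 * \<bar>a n / sqrt (real n)\<bar>) + C8 / (1 - \<rho>) * (norm (t n))\<^sup>2 * (1 / (a n)\<^sup>2)) sequentially"
        using E apos eventually_gt_at_top[of 0]
      proof eventually_elim
        case (elim n)
        have "real n * norm (t n) ^ 3 / (a n)\<^sup>2 = \<bar>l\<bar> ^ 3 * (real n * (\<bar>a n\<bar> ^ 3 / (sqrt (real n)) ^ 3) / (a n)\<^sup>2)"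
          by (simp add: nt power_mult_distrib abs_divide power_divide)
        also have "real n * (\<bar>a n\<bar> ^ 3 / (sqrt (real n)) ^ 3) / (a n)\<^sup>2 = \<bar>a n / sqrt (real n)\<bar>"
        proof -
          have n: "real n = sqrt (real n) * sqrt (real n)" by simp
          have "(sqrt (real n) * sqrt (real n)) * (a n ^ 3 / (sqrt (real n)) ^ 3) / (a n)\<^sup>2 = a n / sqrt (real n)"
            using elim by (simp add: power2_eq_square power3_eq_cube del: real_sqrt_mult_self)
          then show ?thesis using elim by simp
        qed
        finally have eq: "real n * norm (t n) ^ 3 / (a n)\<^sup>2 = \<bar>l\<bar> ^ 3 * \<bar>a n / sqrt (real n)\<bar>" .
        have "norm (Re (E n) / (a n)\<^sup>2) \<le> norm (E n) / (a n)\<^sup>2"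
          using abs_Re_le_cmod[of "E n"] by (simp add: divide_right_mono)
        also have "\<dots> \<le> (C7 * real n * norm (t n) ^ 3 + C8 / (1 - \<rho>) * (norm (t n))\<^sup>2) / (a n)\<^sup>2"
          using elim by (intro divide_right_mono) auto
        also have "\<dots> = C7 * (real n * norm (t n) ^ 3 / (a n)\<^sup>2) + C8 / (1 - \<rho>) * (norm (t n))\<^sup>2 * (1 / (a n)\<^sup>2)"
          by (simp add: add_divide_distrib)
        finally show ?case unfolding eq .
      qed
    qed
    have u0: "(\<lambda>n. ln (norm (1 + u n)) * (1 / (a n)\<^sup>2)) \<longlonglongrightarrow> ln (norm (1 + 0 :: complex)) * 0"
      by (intro tendsto_intros u a2inv) simp
    have "(\<lambda>n. l\<^sup>2 * asymp_var / 2 + Re (E n) / (a n)\<^sup>2 + ln (norm (1 + u n)) * (1 / (a n)\<^sup>2)) \<longlonglongrightarrow> l\<^sup>2 * asymp_var / 2 + 0 + ln (norm (1 + 0 :: complex)) * 0"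
      by (intro tendsto_add tendsto_const E0 u0)
    then have lim: "(\<lambda>n. l\<^sup>2 * asymp_var / 2 + Re (E n) / (a n)\<^sup>2 + ln (norm (1 + u n)) * (1 / (a n)\<^sup>2)) \<longlonglongrightarrow> l\<^sup>2 * asymp_var / 2" by simp
    have unz: "eventually (\<lambda>n. norm (u n) < 1) sequentially"
      using order_tendstoD(2)[OF tendsto_norm_zero[OF u], of 1] by simp
    show "(\<lambda>n. ln (\<integral>\<omega>. exp (l * (a n)\<^sup>2 * (S n \<omega> / (sqrt (real n) * a n))) \<partial>M) / (a n)\<^sup>2) \<longlonglongrightarrow> l\<^sup>2 * asymp_var / 2"
    proof (rule Lim_transform_eventually[OF lim])
      show "eventually (\<lambda>n. l\<^sup>2 * asymp_var / 2 + Re (E n) / (a n)\<^sup>2 + ln (norm (1 + u n)) * (1 / (a n)\<^sup>2) =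
          ln (\<integral>\<omega>. exp (l * (a n)\<^sup>2 * (S n \<omega> / (sqrt (real n) * a n))) \<partial>M) / (a n)\<^sup>2) sequentially"
        using ev apos eventually_gt_at_top[of 0] unz
      proof eventually_elim
        case (elim n)
        have an: "a n \<noteq> 0" "0 < (a n)\<^sup>2" using elim by auto
        have exp_eq: "l * (a n)\<^sup>2 * (S n \<omega> / (sqrt (real n) * a n)) = l * (a n / sqrt (real n)) * S n \<omega>" for \<omega>
          using an by (simp add: power2_eq_square)
        define I where "I = (\<integral>\<omega>. exp (l * (a n)\<^sup>2 * (S n \<omega> / (sqrt (real n) * a n))) \<partial>M)"
        have "complex_of_real I = (\<integral>\<omega>. complex_of_real (exp (l * (a n / sqrt (real n)) * S n \<omega>)) \<partial>M)"
          unfolding I_def exp_eq by (rule integral_complex_of_real[symmetric])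
        also have "\<dots> = tilted (t n) n x"
          unfolding S_mgf[symmetric] by (simp only: t_def of_real_mult[symmetric] exp_of_real)
        finally have I: "complex_of_real I = tilted (t n) n x" .
        have I0: "0 \<le> I" unfolding I_def by (intro integral_nonneg_AE) simp
        have u1: "1 + u n \<noteq> 0"
        proof
          assume "1 + u n = 0"
          then have "u n = - 1" by (simp add: eq_neg_iff_add_eq_0 add.commute)
          then show False using elim(4) by simp
        qed
        \<comment> \<open>\<open>I\<close> is a nonnegative real, so passing to moduli avoids
          choosing a branch of the complex logarithm.\<close>
        have "I = norm (complex_of_real I)" using I0 by simp
        also have "\<dots> = exp (Re (of_nat n * (t n)\<^sup>2 * of_real asymp_var / 2 + E n)) * norm (1 + u n)"
          unfolding I elim(1) norm_mult norm_exp_eq_Re ..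
        finally have "ln I = Re (of_nat n * (t n)\<^sup>2 * of_real asymp_var / 2 + E n) + ln (norm (1 + u n))"
          using u1 by (simp add: ln_mult)
        also have "Re (of_nat n * (t n)\<^sup>2 * of_real asymp_var / 2 + E n) = l\<^sup>2 * asymp_var / 2 * (a n)\<^sup>2 + Re (E n)"
        proof -
          have "of_nat n * (t n)\<^sup>2 * of_real asymp_var / 2 = complex_of_real (real n * (l * (a n / sqrt (real n)))\<^sup>2 * asymp_var / 2)"
            by (simp add: t_def)
          also have "real n * (l * (a n / sqrt (real n)))\<^sup>2 * asymp_var / 2 = l\<^sup>2 * asymp_var / 2 * (a n)\<^sup>2"
            using elim by (simp add: power_mult_distrib power_divide)
          finally show ?thesis by (simp only: plus_complex.simps Re_complex_of_real)
        qed
        finally have "ln I / (a n)\<^sup>2 = l\<^sup>2 * asymp_var / 2 + Re (E n) / (a n)\<^sup>2 + ln (norm (1 + u n)) * (1 / (a n)\<^sup>2)"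
          using an by (simp add: add_divide_distrib)
        then show ?case by (simp add: I_def)
      qed
    qed
  qed
qed

end

section \<open>Stability of the noiseless recursion\<close>

lemma perturbed_contraction_tendsto_0:
  fixes s e :: "nat \<Rightarrow> real"
  assumes s: "\<And>k. 0 \<le> s k" "\<And>k. s (Suc k) \<le> a * s k + e k" and a: "0 \<le> a" "a < 1" and e: "e \<longlonglongrightarrow> 0"
  shows "s \<longlonglongrightarrow> 0"
proof (rule LIMSEQ_I)
  fix d :: real assume d: "0 < d"
  \<comment> \<open>With this forcing the map sending \<open>y\<close> to
    \<open>a * y + \<epsilon>\<close> has fixed point \<open>d / 2\<close>.\<close>
  define \<epsilon> where "\<epsilon> = d * (1 - a) / 2"
  have "\<epsilon> > 0" using d a by (simp add: \<epsilon>_def)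
  then obtain N where N: "\<And>n. n \<ge> N \<Longrightarrow> e n < \<epsilon>"
    using order_tendstoD(2)[OF e, of \<epsilon>] by (auto simp: eventually_sequentially)
  have b: "s (N + k) \<le> a ^ k * s N + d / 2" for k
  proof (induction k)
    case (Suc k)
    have "s (N + Suc k) \<le> a * s (N + k) + e (N + k)" using s(2)[of "N + k"] by simp
    also have "\<dots> \<le> a * (a ^ k * s N + d / 2) + \<epsilon>"
      using Suc a N[of "N + k"] by (intro add_mono mult_left_mono) auto
    also have "\<dots> = a ^ Suc k * s N + d / 2" by (simp add: \<epsilon>_def field_simps)
    finally show ?case .
  qed (use d in simp)
  have "(\<lambda>k. a ^ k * s N) \<longlonglongrightarrow> 0 * s N" using a by (intro tendsto_intros LIMSEQ_realpow_zero)
  then obtain M where M: "\<And>k. k \<ge> M \<Longrightarrow> a ^ k * s N < d / 2"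
    using order_tendstoD(2)[of "\<lambda>k. a ^ k * s N" 0 sequentially "d / 2"] d by (auto simp: eventually_sequentially)
  show "\<exists>no. \<forall>n\<ge>no. norm (s n - 0) < d"
  proof (intro exI[of _ "N + M"] allI impI)
    fix n assume "N + M \<le> n"
    then have n: "N + (n - N) = n" "M \<le> n - N" by auto
    have "s n < d" using b[of "n - N"] M[OF n(2)] unfolding n(1) by argo
    then show "norm (s n - 0) < d" using s(1)[of n] by simp
  qed
qed

lemma funpow_lipschitz:
  fixes F :: "'a::real_normed_vector \<Rightarrow> 'a"
  assumes "\<And>x y. norm (F x - F y) \<le> M * norm (x - y)" "0 \<le> M"
  shows "norm ((F ^^ k) x - (F ^^ k) y) \<le> M ^ k * norm (x - y)"
proof (induction k)
  case (Suc k)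
  have "norm ((F ^^ Suc k) x - (F ^^ Suc k) y) \<le> M * norm ((F ^^ k) x - (F ^^ k) y)"
    using assms(1) by simp
  also have "\<dots> \<le> M * (M ^ k * norm (x - y))" using Suc assms(2) by (intro mult_left_mono)
  finally show ?case by (simp add: mult.assoc)
qed simp

text \<open>By compactness of the sphere some iterate of a stable homogeneous map halves all norms; a weighted
  sum of norms along the orbit is then a one-step Lyapunov function.\<close>

lemma homogeneous_lyapunov:
  fixes F :: "'a::euclidean_space \<Rightarrow> 'a"
  assumes hom: "\<And>c x. 0 \<le> c \<Longrightarrow> F (c *\<^sub>R x) = c *\<^sub>R F x"
    and lip: "\<And>x y. norm (F x - F y) \<le> M * norm (x - y)" "0 \<le> M"
    and bdd: "\<And>k x. norm ((F ^^ k) x) \<le> B * norm x"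
    and conv: "\<And>x. (\<lambda>k. (F ^^ k) x) \<longlonglongrightarrow> 0"
  shows "\<exists>U r L. 0 \<le> r \<and> r < 1 \<and> 0 \<le> L \<and> (\<forall>x. norm x \<le> U x) \<and>
     (\<forall>x y. \<bar>U x - U y\<bar> \<le> L * norm (x - y)) \<and> (\<forall>x. U (F x) \<le> r * U x)"
proof -
  have homk: "(F ^^ k) (c *\<^sub>R x) = c *\<^sub>R (F ^^ k) x" if "0 \<le> c" for c k x
    using that by (induction k) (auto simp: hom)
  define B' where "B' = max 1 B"
  have B': "1 \<le> B'" "norm ((F ^^ k) x) \<le> B' * norm x" for k x
    using bdd[of k x] mult_right_mono[of B B' "norm x"] by (auto simp: B'_def)
  \<comment> \<open>Otherwise some unit vectors \<open>x m\<close> stay large at time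
    \<open>m\<close>. A limit point of them has an orbit already tiny at some time \<open>k\<close>;
    continuity of the \<open>k\<close>-th iterate passes this on to nearby \<open>x (r n)\<close>,
    and the uniform bound \<open>B'\<close> keeps them small up to time \<open>r n\<close>.\<close>
  have "\<exists>m. \<forall>x. norm x = 1 \<longrightarrow> norm ((F ^^ m) x) \<le> 1 / 2"
  proof (rule ccontr)
    assume "\<not> ?thesis"
    then obtain x where x: "\<And>m. norm (x m) = 1" "\<And>m. norm ((F ^^ m) (x m)) > 1 / 2"
      by (metis not_le)
    have "compact (sphere (0::'a) 1)" by simp
    moreover have "\<forall>m. x m \<in> sphere 0 1" using x by simp
    ultimately obtain l r where l: "strict_mono r" "(x \<circ> r) \<longlonglongrightarrow> l"
      unfolding compact_def by metis
    have "eventually (\<lambda>k. norm ((F ^^ k) l) < 1 / (4 * B')) sequentially"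
      using order_tendstoD(2)[OF tendsto_norm_zero[OF conv[of l]], of "1 / (4 * B')"] B' by auto
    then obtain k where k: "norm ((F ^^ k) l) < 1 / (4 * B')" by (auto dest: eventually_happens)
    have "(\<lambda>n. norm (x (r n) - l)) \<longlonglongrightarrow> 0"
      using l(2) by (simp add: o_def LIM_zero_iff tendsto_norm_zero_iff)
    then have "(\<lambda>n. M ^ k * norm (x (r n) - l)) \<longlonglongrightarrow> M ^ k * 0" by (intro tendsto_intros)
    then have "eventually (\<lambda>n. M ^ k * norm (x (r n) - l) < 1 / (4 * B')) sequentially"
      using order_tendstoD(2)[of _ "M ^ k * 0" sequentially "1 / (4 * B')"] B'(1) by simp
    then have "eventually (\<lambda>n. M ^ k * norm (x (r n) - l) < 1 / (4 * B') \<and> k \<le> n) sequentially"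
      using eventually_ge_at_top eventually_conj by blast
    then obtain n where n: "M ^ k * norm (x (r n) - l) < 1 / (4 * B')" "k \<le> n"
      by (auto dest: eventually_happens)
    have kr: "k \<le> r n" using n(2) seq_suble[OF l(1), of n] by simp
    have "norm ((F ^^ k) (x (r n))) \<le> norm ((F ^^ k) l) + norm ((F ^^ k) (x (r n)) - (F ^^ k) l)"
      by (rule norm_triangle_sub)
    also have "\<dots> \<le> 1 / (4 * B') + 1 / (4 * B')"
      using k n(1) funpow_lipschitz[OF lip, of k "x (r n)" l] by (intro add_mono) linarith+
    finally have "norm ((F ^^ k) (x (r n))) \<le> 1 / (2 * B')" by simp
    then have "B' * norm ((F ^^ k) (x (r n))) \<le> 1 / 2" using B'(1) by (simp add: field_simps)
    moreover have "(F ^^ r n) (x (r n)) = (F ^^ (r n - k)) ((F ^^ k) (x (r n)))"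
      using kr by (metis comp_apply funpow_add le_add_diff_inverse2)
    ultimately show False using B'(2)[of "r n - k" "(F ^^ k) (x (r n))"] x(2)[of "r n"] by simp
  qed
  then obtain m where m1: "\<And>x. norm x = 1 \<Longrightarrow> norm ((F ^^ m) x) \<le> 1 / 2" by blast
  have m: "norm ((F ^^ m) x) \<le> norm x / 2" for x
  proof (cases "x = 0")
    case True
    then show ?thesis using homk[of 0 m 0] by simp
  next
    case False
    have "norm ((F ^^ m) x) = norm ((F ^^ m) (norm x *\<^sub>R (inverse (norm x) *\<^sub>R x)))" using False by simp
    also have "\<dots> = norm x * norm ((F ^^ m) (inverse (norm x) *\<^sub>R x))" by (simp only: homk norm_ge_zero norm_scaleR abs_norm_cancel)
    also have "\<dots> \<le> norm x * (1 / 2)" using False by (intro mult_left_mono m1) auto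
    finally show ?thesis by simp
  qed
  obtain x1 :: 'a where "norm x1 = 1" using vector_choose_size[of 1] by auto
  then have "m \<noteq> 0" using m[of x1] by (intro notI) simp
  then have m0: "0 < m" by simp
  \<comment> \<open>With \<open>t ^ m = 2\<close> the term \<open>t ^ m * norm ((F ^^ m) x)\<close>
    is at most \<open>norm x\<close>, so shifting the weighted sum by one step does not increase
    it.\<close>
  define t where "t = root m (2::real)"
  have t: "1 < t" "t ^ m = 2" using m0 by (auto simp: t_def)
  define U where "U x = (\<Sum>j<m. t ^ j * norm ((F ^^ j) x))" for x
  define L where "L = (\<Sum>j<m. t ^ j * M ^ j)"
  show ?thesis
  proof (rule exI[of _ U], rule exI[of _ "1 / t"], rule exI[of _ L], intro conjI allI)
    show "0 \<le> 1 / t" "1 / t < 1" using t by auto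
    show "0 \<le> L" unfolding L_def using t lip(2) by (intro sum_nonneg) auto
    show "norm x \<le> U x" for x
    proof -
      have "t ^ 0 * norm ((F ^^ 0) x) \<le> U x" unfolding U_def
        using m0 t by (intro member_le_sum) auto
      then show ?thesis by simp
    qed
    show "\<bar>U x - U y\<bar> \<le> L * norm (x - y)" for x y
    proof -
      have "\<bar>U x - U y\<bar> \<le> (\<Sum>j<m. \<bar>t ^ j * norm ((F ^^ j) x) - t ^ j * norm ((F ^^ j) y)\<bar>)"
        unfolding U_def sum_subtractf[symmetric] by (rule sum_abs)
      also have "\<dots> \<le> (\<Sum>j<m. t ^ j * (M ^ j * norm (x - y)))"
      proof (rule sum_mono)
        fix j
        have "\<bar>t ^ j * norm ((F ^^ j) x) - t ^ j * norm ((F ^^ j) y)\<bar> = t ^ j * \<bar>norm ((F ^^ j) x) - norm ((F ^^ j) y)\<bar>"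
          using t by (simp add: abs_mult right_diff_distrib[symmetric])
        also have "\<dots> \<le> t ^ j * (M ^ j * norm (x - y))"
          using t by (intro mult_left_mono order_trans[OF norm_triangle_ineq3] funpow_lipschitz lip) auto
        finally show "\<bar>t ^ j * norm ((F ^^ j) x) - t ^ j * norm ((F ^^ j) y)\<bar> \<le> t ^ j * (M ^ j * norm (x - y))" .
      qed
      finally show ?thesis by (simp add: L_def sum_distrib_right mult.assoc)
    qed
    show "U (F x) \<le> 1 / t * U x" for x
    proof -
      have "t * U (F x) = (\<Sum>j<m. t ^ Suc j * norm ((F ^^ Suc j) x))"
        unfolding U_def sum_distrib_left by (simp add: funpow_swap1 mult.assoc)
      also have "\<dots> = (\<Sum>j<Suc m. t ^ j * norm ((F ^^ j) x)) - norm x"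
        by (subst sum.lessThan_Suc_shift) simp
      also have "\<dots> = U x + 2 * norm ((F ^^ m) x) - norm x" by (simp add: U_def t)
      also have "\<dots> \<le> U x" using m[of x] by simp
      finally show ?thesis using t by (simp add: field_simps)
    qed
  qed
qed

text \<open>The bounds on \<eta> keep \<open>1 - \<eta> * \<alpha>\<close> and every
  \<open>1 - \<eta> * v$i\<close> positive, so that one Euler step preserves nonnegative vectors
  under \<open>S\<close> and does not overshoot the queue.\<close>

locale fluid =
  fixes \<alpha> \<eta> :: real and p v :: "real^'d::finite" and P :: "real^'d^'d"
  assumes alpha_pos: "\<alpha> > 0" and p_nonneg: "p$i \<ge> 0" and p_sum: "(\<Sum>i\<in>UNIV. p$i) = 1"
    and v_pos: "v$i > 0" and P_nonneg: "P$i$j \<ge> 0" and P_substoch: "(\<Sum>j\<in>UNIV. P$i$j) \<le> 1"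
    and IP_inv: "invertible (mat 1 - P)"
    and eta_pos: "\<eta> > 0" and eta_alpha: "\<eta> * \<alpha> < 1" and eta_v: "\<eta> * v$i < 1"
begin

text \<open>\<open>F\<close> is one noiseless Euler step without the constant term \<open>-\<beta> p\<close>, \<open>s\<close> the queue \<open>(e'x)\<^sup>+\<close> and \<open>res x = x - p (e'x)\<^sup>+\<close>
  the state of service; \<open>S = I - \<eta> R\<close> is a substochastic flow (acting on columns) and \<open>ell\<close> is the mass that
  it loses in one step.\<close>

definition R where "R = transpose (mat 1 - P) ** diag_mat v"
definition S where "S y = y - \<eta> *\<^sub>R (R *v y)"
definition ell where "ell y = \<eta> * (ones \<bullet> (R *v y))"
definition s where "s x = max 0 (ones \<bullet> x)"
definition res where "res x = x - s x *\<^sub>R p"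
definition F where "F x = x + \<eta> *\<^sub>R (- (R *v x) + s x *\<^sub>R ((R - \<alpha> *\<^sub>R mat 1) *v p))"
definition l1 :: "real^'d \<Rightarrow> real" where "l1 y = (\<Sum>i\<in>UNIV. \<bar>y$i\<bar>)"
definition pos_part :: "real^'d \<Rightarrow> real^'d" where "pos_part y = (\<chi> i. max 0 (y$i))"

section \<open>The substochastic flow and the mass it loses\<close>

lemma ones_inner: "ones \<bullet> y = (\<Sum>i\<in>UNIV. y$i)"
  by (simp add: ones_def inner_vec_def)

lemma R_nth: "(R *v y)$i = v$i * y$i - (\<Sum>j\<in>UNIV. P$j$i * v$j * y$j)"
proof -
  have D: "diag_mat v *v y = (\<chi> j. v$j * y$j)"
  proof -
    have "(\<Sum>j\<in>UNIV. (if i = j then v$i else 0) * y$j) = (\<Sum>j\<in>UNIV. if i = j then v$j * y$j else 0)" for i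
      by (intro sum.cong) auto
    then show ?thesis by (simp add: vec_eq_iff matrix_vector_mult_def diag_mat_def)
  qed
  have "(R *v y)$i = (\<Sum>j\<in>UNIV. (mat 1 - P)$j$i * (v$j * y$j))"
    unfolding R_def matrix_vector_mul_assoc[symmetric] D by (simp add: matrix_vector_mult_def transpose_def)
  also have "\<dots> = (\<Sum>j\<in>UNIV. (if j = i then v$j * y$j else 0) - P$j$i * v$j * y$j)"
    by (intro sum.cong) (auto simp: mat_def algebra_simps)
  also have "\<dots> = v$i * y$i - (\<Sum>j\<in>UNIV. P$j$i * v$j * y$j)" by (simp add: sum_subtractf)
  finally show ?thesis .
qed

lemma S_nth: "(S y)$i = (1 - \<eta> * v$i) * y$i + \<eta> * (\<Sum>j\<in>UNIV. P$j$i * v$j * y$j)"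
  by (simp add: S_def R_nth algebra_simps)

lemma S_diff: "S (x - y) = S x - S y"
  by (simp add: S_def matrix_vector_mult_diff_distrib scaleR_right_diff_distrib)

lemma ell_diff: "ell (x - y) = ell x - ell y"
  by (simp add: ell_def matrix_vector_mult_diff_distrib inner_diff_right algebra_simps)

lemma S_ge:
  assumes "\<And>j. 0 \<le> y$j" shows "(1 - \<eta> * v$i) * y$i \<le> (S y)$i"
  unfolding S_nth using assms v_pos P_nonneg eta_pos by (auto intro!: mult_nonneg_nonneg sum_nonneg simp: less_imp_le)

lemma S_nonneg: "(\<And>j. 0 \<le> y$j) \<Longrightarrow> 0 \<le> (S y)$i"
  using S_ge[of y i] eta_v[of i] by (smt (verit) mult_nonneg_nonneg)

lemma ones_S: "ones \<bullet> S y = ones \<bullet> y - ell y"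
  by (simp add: S_def ell_def inner_diff_right)

text \<open>Interchanging the sums expresses the loss through the exit probabilities, the deficits
  of the row sums of \<open>P\<close>, which are nonnegative.\<close>

lemma ell_eq: "ell y = \<eta> * (\<Sum>i\<in>UNIV. v$i * (1 - (\<Sum>j\<in>UNIV. P$i$j)) * y$i)"
proof -
  have "ones \<bullet> (R *v y) = (\<Sum>i\<in>UNIV. v$i * y$i) - (\<Sum>i\<in>UNIV. \<Sum>j\<in>UNIV. P$j$i * v$j * y$j)"
    by (simp add: ones_inner R_nth sum_subtractf)
  also have "(\<Sum>i\<in>UNIV. \<Sum>j\<in>UNIV. P$j$i * v$j * y$j) = (\<Sum>j\<in>UNIV. \<Sum>i\<in>UNIV. P$j$i * v$j * y$j)"
    by (rule sum.swap)
  also have "(\<Sum>i\<in>UNIV. v$i * y$i) - \<dots> = (\<Sum>i\<in>UNIV. v$i * (1 - (\<Sum>j\<in>UNIV. P$i$j)) * y$i)"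
    unfolding sum_subtractf[symmetric]
    by (intro sum.cong) (auto simp: algebra_simps sum_distrib_left sum_distrib_right)
  finally show ?thesis by (simp add: ell_def)
qed

lemma ell_nonneg: "(\<And>j. 0 \<le> y$j) \<Longrightarrow> 0 \<le> ell y"
  unfolding ell_eq using eta_pos v_pos P_substoch
  by (intro mult_nonneg_nonneg sum_nonneg) (auto simp: less_imp_le)

lemma ell_le: "(\<And>j. 0 \<le> y$j) \<Longrightarrow> ell y \<le> ones \<bullet> y"
  using S_nonneg[of y] ones_S[of y] by (smt (verit) ones_inner sum_nonneg)

lemma ones_p: "ones \<bullet> p = 1" by (simp add: ones_inner p_sum)

lemma s_nonneg: "0 \<le> s x" by (simp add: s_def)

lemma ones_res: "ones \<bullet> res x = min 0 (ones \<bullet> x)"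
  by (simp add: res_def inner_diff_right ones_p s_def)

text \<open>The reinjection term cancels the action of \<open>R\<close> on the queue part of
  \<open>x\<close>, so the flow acts on the residual alone and the queue shrinks along
  \<open>p\<close> by \<open>1 - \<eta> * \<alpha>\<close>.\<close>

lemma F_eq: "F x = S (res x) + ((1 - \<eta> * \<alpha>) * s x) *\<^sub>R p"
proof -
  have Rr: "R *v res x = R *v x - s x *\<^sub>R (R *v p)"
    by (simp add: res_def matrix_vector_mult_diff_distrib matrix_vector_mult_scaleR)
  have rp: "(R - \<alpha> *\<^sub>R mat 1) *v p = R *v p - \<alpha> *\<^sub>R p"
    unfolding matrix_vector_mult_diff_rdistrib scaleR_matrix_vector_assoc[symmetric] by simp
  show ?thesis unfolding F_def S_def Rr rp
    by (simp add: res_def algebra_simps)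
qed

lemma ones_F: "ones \<bullet> F x = (1 - \<eta> * \<alpha>) * s x + min 0 (ones \<bullet> x) - ell (res x)"
  by (simp add: F_eq inner_add_right ones_S ones_res ones_p)

text \<open>Whatever the signs of \<open>ones \<bullet> x\<close> before and after the step, a fraction \<open>\<theta>\<close> of the mass leaving
  the network is reinjected with profile \<open>p\<close>.\<close>

lemma res_F:
  "\<exists>\<theta>. 0 \<le> \<theta> \<and> \<theta> \<le> 1 \<and> res (F x) = S (res x) + (\<theta> * ell (res x)) *\<^sub>R p \<and>
     (ones \<bullet> x < 0 \<and> ones \<bullet> F x < 0 \<longrightarrow> \<theta> = 0)"
proof -
  let ?a = "(1 - \<eta> * \<alpha>) * s x" and ?l = "ell (res x)"
  define \<delta> where "\<delta> = ?a - s (F x)"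
  have r: "res (F x) = S (res x) + \<delta> *\<^sub>R p"
    unfolding res_def[of "F x"] by (subst F_eq) (simp add: \<delta>_def scaleR_diff_left algebra_simps)
  have a: "0 \<le> ?a" using eta_alpha s_nonneg[of x] by (intro mult_nonneg_nonneg) auto
  have x: "?a = 0 \<or> min 0 (ones \<bullet> x) = 0" by (auto simp: s_def)
  have d: "\<delta> = min ?a (?l - min 0 (ones \<bullet> x))"
    unfolding \<delta>_def s_def[of "F x"] ones_F by (auto simp: max_def min_def)
  have between: "(0 \<le> \<delta> \<and> \<delta> \<le> ?l) \<or> (?l \<le> \<delta> \<and> \<delta> \<le> 0)"
    using a x unfolding d by (auto simp: min_def split: if_splits)
  \<comment> \<open>The loss of a signed residual can be negative. In either case \<delta> lies
    between 0 and the loss, so the quotient is in the unit interval; a zero loss forces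
    \<open>\<delta> = 0\<close>, consistent with the value 0.\<close>
  define \<theta> where "\<theta> = (if ?l = 0 then 0 else \<delta> / ?l)"
  have "0 \<le> \<theta>" "\<theta> \<le> 1" "\<theta> * ?l = \<delta>"
    using between by (auto simp: \<theta>_def divide_le_eq zero_le_divide_iff)
  moreover have "\<theta> = 0" if "ones \<bullet> x < 0" "ones \<bullet> F x < 0"
    using that by (simp add: \<theta>_def \<delta>_def s_def)
  ultimately show ?thesis using r by metis
qed

section \<open>Decrease of the l1 norm of the residual and its equality case\<close>

lemma pos_part_nonneg: "0 \<le> (pos_part y)$i" by (simp add: pos_part_def)

lemma pos_part_decomp: "y = pos_part y - pos_part (- y)"
  by (auto simp: pos_part_def vec_eq_iff max_def)

lemma l1_pos_part: "l1 y = ones \<bullet> pos_part y + ones \<bullet> pos_part (- y)"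
  unfolding l1_def ones_inner sum.distrib[symmetric] by (intro sum.cong) (auto simp: pos_part_def)

lemma ones_pos_part_nonneg: "0 \<le> ones \<bullet> pos_part y"
  unfolding ones_inner by (intro sum_nonneg) (simp add: pos_part_nonneg)

lemma l1_nonneg: "0 \<le> l1 y" by (simp add: l1_def sum_nonneg)

lemma l1_diff:
  assumes "\<And>i. 0 \<le> A$i" "\<And>i. 0 \<le> B$i"
  shows "l1 (A - B) = ones \<bullet> A + ones \<bullet> B - 2 * (\<Sum>i\<in>UNIV. min (A$i) (B$i))"
  unfolding l1_def ones_inner sum.distrib[symmetric] sum_distrib_left sum_subtractf[symmetric]
  using assms by (intro sum.cong) (auto simp: min_def abs_if)

definition step :: "real \<Rightarrow> real^'d \<Rightarrow> real^'d" where "step \<theta> u = S u + (\<theta> * ell u) *\<^sub>R p"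

lemma step_nonneg: "0 \<le> \<theta> \<Longrightarrow> (\<And>i. 0 \<le> u$i) \<Longrightarrow> 0 \<le> (step \<theta> u)$i"
  by (simp add: step_def S_nonneg ell_nonneg p_nonneg)

lemma ones_step: "ones \<bullet> step \<theta> u = ones \<bullet> u - (1 - \<theta>) * ell u"
  by (simp add: step_def inner_add_right ones_S ones_p algebra_simps)

lemma step_decomp: "step \<theta> y = step \<theta> (pos_part y) - step \<theta> (pos_part (- y))"
  by (subst pos_part_decomp[of y]) (simp add: step_def S_diff ell_diff algebra_simps)

text \<open>Positive and negative parts are moved separately and stay nonnegative. The norm drops by
  the mass lost without reinjection plus twice the overlap of the two images. Equality therefore
  forces disjoint images and \<open>(1 - \<theta>) * ell = 0\<close> on both parts, where
  \<open>step \<theta>\<close> then agrees with \<open>step 1\<close>.\<close>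

lemma l1_step:
  assumes "0 \<le> \<theta>" "\<theta> \<le> 1"
  shows "l1 (step \<theta> y) \<le> l1 y"
    and "l1 (step \<theta> y) = l1 y \<Longrightarrow> pos_part (step \<theta> y) = step 1 (pos_part y) \<and> pos_part (- step \<theta> y) = step 1 (pos_part (- y))"
proof -
  let ?A = "step \<theta> (pos_part y)" and ?B = "step \<theta> (pos_part (- y))"
  have nn: "0 \<le> ?A$i" "0 \<le> ?B$i" for i using assms by (auto intro!: step_nonneg pos_part_nonneg)
  have l: "0 \<le> (1 - \<theta>) * ell (pos_part y)" "0 \<le> (1 - \<theta>) * ell (pos_part (- y))"
    using assms by (auto intro!: mult_nonneg_nonneg ell_nonneg pos_part_nonneg)
  have m: "0 \<le> (\<Sum>i\<in>UNIV. min (?A$i) (?B$i))" using nn by (intro sum_nonneg) auto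
  have eq: "l1 (step \<theta> y) = l1 y - (1 - \<theta>) * ell (pos_part y) - (1 - \<theta>) * ell (pos_part (- y)) - 2 * (\<Sum>i\<in>UNIV. min (?A$i) (?B$i))"
    unfolding step_decomp[of \<theta> y] l1_diff[OF nn] l1_pos_part[of y] ones_step by simp
  show "l1 (step \<theta> y) \<le> l1 y" unfolding eq using l m by linarith
  assume "l1 (step \<theta> y) = l1 y"
  then have z: "(1 - \<theta>) * ell (pos_part y) = 0" "(1 - \<theta>) * ell (pos_part (- y)) = 0" "(\<Sum>i\<in>UNIV. min (?A$i) (?B$i)) = 0"
    using eq l m by linarith+
  have mz: "min (?A$i) (?B$i) = 0" for i
    using z(3) nn sum_nonneg_eq_0_iff[of UNIV "\<lambda>i. min (?A$i) (?B$i)"] by simp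
  have one: "step \<theta> (pos_part y) = step 1 (pos_part y)" "step \<theta> (pos_part (- y)) = step 1 (pos_part (- y))"
    using z by (auto simp: step_def)
  have "pos_part (?A - ?B) = ?A" "pos_part (- (?A - ?B)) = ?B"
  proof -
    have "max 0 (?A$i - ?B$i) = ?A$i \<and> max 0 (?B$i - ?A$i) = ?B$i" for i
      using mz[of i] nn[of i] by (auto simp: min_def max_def split: if_splits)
    then show "pos_part (?A - ?B) = ?A" "pos_part (- (?A - ?B)) = ?B" by (auto simp: pos_part_def vec_eq_iff)
  qed
  then show "pos_part (step \<theta> y) = step 1 (pos_part y) \<and> pos_part (- step \<theta> y) = step 1 (pos_part (- y))"
    unfolding step_decomp[of \<theta> y] one by simp
qed

text \<open>\<open>w$i\<close> is the expected number of services that a job at station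
  \<open>i\<close> still needs before leaving the network.\<close>

definition w where "w = (SOME w. (mat 1 - P) *v w = ones)"

lemma w_eq: "w$i - (\<Sum>j\<in>UNIV. P$i$j * w$j) = 1"
proof -
  have "(mat 1 - P) *v w = ones"
    unfolding w_def
  proof (rule someI_ex)
    obtain B where "(mat 1 - P) ** B = mat 1" using IP_inv by (auto simp: invertible_def)
    then have "(mat 1 - P) *v (B *v ones) = ones" by (simp add: matrix_vector_mul_assoc)
    then show "\<exists>w. (mat 1 - P) *v w = ones" by blast
  qed
  then have "((mat 1 - P) *v w)$i = 1" by (simp add: ones_def)
  moreover have "((mat 1 - P) *v w)$i = w$i - (\<Sum>j\<in>UNIV. P$i$j * w$j)"
    by (simp add: matrix_vector_mult_diff_rdistrib) (simp add: matrix_vector_mult_def)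
  ultimately show ?thesis by simp
qed

text \<open>Minimum principle: a negative minimum at \<open>k\<close> would satisfy
  \<open>w$k \<ge> 1 + w$k\<close>, since row sums are at most 1.\<close>

lemma w_nonneg: "0 \<le> w$i"
proof -
  define k where "k = arg_min_on (\<lambda>i. w$i) UNIV"
  have k: "w$k \<le> w$j" for j unfolding k_def by (rule arg_min_least) auto
  have "0 \<le> w$k"
  proof (rule ccontr)
    assume neg: "\<not> 0 \<le> w$k"
    have "w$k = 1 + (\<Sum>j\<in>UNIV. P$k$j * w$j)" using w_eq[of k] by simp
    also have "\<dots> \<ge> 1 + (\<Sum>j\<in>UNIV. P$k$j * w$k)"
      using k P_nonneg by (intro add_left_mono sum_mono mult_left_mono) auto
    also have "(\<Sum>j\<in>UNIV. P$k$j * w$k) = (\<Sum>j\<in>UNIV. P$k$j) * w$k" by (simp add: sum_distrib_right)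
    also have "1 * w$k \<le> (\<Sum>j\<in>UNIV. P$k$j) * w$k"
      using neg P_substoch[of k] by (intro mult_right_mono_neg) auto
    finally show False by simp
  qed
  then show ?thesis using k[of i] by linarith
qed

text \<open>Since \<open>w - P *v w = ones\<close>, the content weighted by \<open>w\<close>
  decreases by exactly the service completed in the step.\<close>

lemma w_S: "w \<bullet> S y = w \<bullet> y - \<eta> * (v \<bullet> y)"
proof -
  have "w \<bullet> (R *v y) = (\<Sum>i\<in>UNIV. w$i * (v$i * y$i)) - (\<Sum>i\<in>UNIV. \<Sum>j\<in>UNIV. w$i * (P$j$i * v$j * y$j))"
    by (simp add: inner_vec_def R_nth right_diff_distrib sum_subtractf sum_distrib_left)
  also have "(\<Sum>i\<in>UNIV. \<Sum>j\<in>UNIV. w$i * (P$j$i * v$j * y$j)) = (\<Sum>j\<in>UNIV. \<Sum>i\<in>UNIV. w$i * (P$j$i * v$j * y$j))"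
    by (rule sum.swap)
  also have "(\<Sum>i\<in>UNIV. w$i * (v$i * y$i)) - \<dots> = (\<Sum>i\<in>UNIV. (w$i - (\<Sum>j\<in>UNIV. P$i$j * w$j)) * (v$i * y$i))"
    unfolding sum_subtractf[symmetric]
    by (intro sum.cong) (auto simp: left_diff_distrib sum_distrib_right intro!: sum.cong)
  also have "\<dots> = v \<bullet> y" by (simp add: w_eq inner_vec_def)
  finally show ?thesis by (simp add: S_def inner_diff_right)
qed

text \<open>As long as no mass leaves, \<open>w \<bullet> u k\<close> decreases linearly.\<close>

lemma mass_leaves:
  assumes u: "\<And>k i. 0 \<le> (u k)$i" "\<And>k. u (Suc k) = S (u k)" and m: "\<And>k. ones \<bullet> u k = m"
  shows "m = 0"
proof (rule ccontr)
  assume "m \<noteq> 0"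
  moreover have "0 \<le> m" using m[of 0] u(1) by (auto simp: ones_inner intro: sum_nonneg)
  ultimately have mp: "0 < m" by simp
  define vm where "vm = Min (range (\<lambda>i. v$i))"
  have vm: "0 < vm" "vm \<le> v$i" for i using v_pos by (auto simp: vm_def)
  have vu: "vm * m \<le> v \<bullet> u k" for k
  proof -
    have "vm * m = (\<Sum>i\<in>UNIV. vm * (u k)$i)" by (simp add: m[symmetric, of k] ones_inner sum_distrib_left)
    also have "\<dots> \<le> (\<Sum>i\<in>UNIV. v$i * (u k)$i)" using vm u by (intro sum_mono mult_right_mono) auto
    finally show ?thesis by (simp add: inner_vec_def)
  qed
  have "w \<bullet> u k \<le> w \<bullet> u 0 - real k * (\<eta> * (vm * m))" for k
  proof (induction k)
    case (Suc k)
    have "\<eta> * (vm * m) \<le> \<eta> * (v \<bullet> u k)" using vu eta_pos by (intro mult_left_mono) auto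
    then show ?case using Suc by (simp add: u(2) w_S algebra_simps)
  qed simp
  moreover have "0 \<le> w \<bullet> u k" for k
    unfolding inner_vec_def using w_nonneg u(1) by (intro sum_nonneg) auto
  moreover obtain k where "w \<bullet> u 0 < real k * (\<eta> * (vm * m))"
    using reals_Archimedean3[of "\<eta> * (vm * m)"] eta_pos vm mp by auto
  ultimately show False by (smt (verit))
qed

text \<open>\<open>step 1\<close> reinjects all lost mass, so the total is conserved, and by
  \<open>mass_leaves\<close> some loss must occur. The reinjection charges \<open>j\<close>, and
  afterwards \<open>S\<close> retains at least the fraction \<open>1 - \<eta> * v$j\<close> of it in
  each step.\<close>

lemma mass_reaches:
  assumes u: "\<And>k i. 0 \<le> (u k)$i" "\<And>k. u (Suc k) = step 1 (u k)" and m: "ones \<bullet> u 0 \<noteq> 0" and j: "0 < p$j"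
  shows "\<exists>K. \<forall>k\<ge>K. 0 < (u k)$j"
proof -
  have mk: "ones \<bullet> u k = ones \<bullet> u 0" for k by (induction k) (auto simp: u(2) ones_step)
  have "\<exists>k. ell (u k) \<noteq> 0"
  proof (rule ccontr)
    assume "\<not> ?thesis"
    then have "u (Suc k) = S (u k)" for k by (simp add: u(2) step_def)
    then show False using mass_leaves[OF u(1) _ mk] m by blast
  qed
  then obtain k where k: "0 < ell (u k)" using ell_nonneg[OF u(1)] by (metis order_le_less)
  have "0 < (u (Suc k + n))$j" for n
  proof (induction n)
    case 0
    have "0 \<le> (S (u k))$j" by (rule S_nonneg[OF u(1)])
    then show ?case using k j by (simp add: u(2) step_def add_nonneg_pos)
  next
    case (Suc n)
    have "0 < (1 - \<eta> * v$j) * (u (Suc k + n))$j" using Suc eta_v[of j] by simp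
    also have "\<dots> \<le> (S (u (Suc k + n)))$j" by (rule S_ge[OF u(1)])
    also have "\<dots> \<le> (u (Suc k + Suc n))$j"
      using ell_nonneg[OF u(1)] p_nonneg by (simp add: u(2)[of "Suc k + n", simplified] step_def)
    finally show ?case .
  qed
  then show ?thesis by (intro exI[of _ "Suc k"]) (metis le_Suc_ex)
qed

lemma l1_eq_0: "l1 y = 0 \<Longrightarrow> y = 0"
  using sum_nonneg_eq_0_iff[of UNIV "\<lambda>i. \<bar>y$i\<bar>"] by (simp add: l1_def vec_eq_iff)

text \<open>LaSalle's principle: if the norm never decreases, no mass is lost and the positive and negative parts
  of the residual never cancel. Both parts, if nonzero, would eventually charge any coordinate \<open>j\<close> with \<open>p$j > 0\<close>.\<close>

lemma stationary_residual:
  assumes c: "\<And>k. l1 (res ((F ^^ k) x)) = l1 (res x)"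
  shows "res x = 0"
proof -
  define X where "X k = (F ^^ k) x" for k
  define y where "y k = res (X k)" for k
  have X: "X (Suc k) = F (X k)" for k by (simp add: X_def)
  obtain \<theta> where \<theta>: "\<And>k. 0 \<le> \<theta> k" "\<And>k. \<theta> k \<le> 1" "\<And>k. y (Suc k) = step (\<theta> k) (y k)"
      "\<And>k. ones \<bullet> X k < 0 \<Longrightarrow> ones \<bullet> X (Suc k) < 0 \<Longrightarrow> \<theta> k = 0"
  proof -
    have "\<forall>k. \<exists>t. 0 \<le> t \<and> t \<le> 1 \<and> y (Suc k) = step t (y k) \<and> (ones \<bullet> X k < 0 \<and> ones \<bullet> X (Suc k) < 0 \<longrightarrow> t = 0)"
      using res_F unfolding y_def X step_def by blast
    from choice[OF this] show ?thesis using that by blast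
  qed
  have n1y: "l1 (y k) = l1 (y 0)" for k using c unfolding y_def X_def by simp
  define u where "u k = pos_part (y k)" for k
  define z where "z k = pos_part (- y k)" for k
  have uz: "u (Suc k) = step 1 (u k)" "z (Suc k) = step 1 (z k)" for k
    using l1_step(2)[OF \<theta>(1,2), of k "y k"] n1y[of k] n1y[of "Suc k"] unfolding \<theta>(3)[symmetric] u_def z_def by auto
  have nn: "0 \<le> (u k)$i" "0 \<le> (z k)$i" for k i by (auto simp: u_def z_def pos_part_nonneg)
  have disj: "(u k)$i = 0 \<or> (z k)$i = 0" for k i by (auto simp: u_def z_def pos_part_def)
  have "\<exists>j. 0 < p$j" using p_sum p_nonneg by (metis less_eq_real_def sum.neutral zero_neq_one)
  then obtain j where j: "0 < p$j" by blast
  have mz: "ones \<bullet> z k = ones \<bullet> z 0" "ones \<bullet> u k = ones \<bullet> u 0" for k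
    by (induction k) (auto simp: uz ones_step)
  have yo: "ones \<bullet> y k = ones \<bullet> u k - ones \<bullet> z k" for k
    by (subst pos_part_decomp) (simp add: u_def z_def inner_diff_right)
  \<comment> \<open>The total of a residual is never positive, so a nonzero positive part requires a
    nonzero negative one. Both would then charge \<open>j\<close> at a common time, against
    disjointness.\<close>
  have u0: "ones \<bullet> u 0 = 0"
  proof (rule ccontr)
    assume a: "ones \<bullet> u 0 \<noteq> 0"
    have "ones \<bullet> z 0 = 0"
    proof (rule ccontr)
      assume b: "ones \<bullet> z 0 \<noteq> 0"
      obtain K1 where K1: "\<And>k. k \<ge> K1 \<Longrightarrow> 0 < (u k)$j" using mass_reaches[OF nn(1) uz(1) a j] by auto
      obtain K2 where K2: "\<And>k. k \<ge> K2 \<Longrightarrow> 0 < (z k)$j" using mass_reaches[OF nn(2) uz(2) b j] by auto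
      show False using K1[of "max K1 K2"] K2[of "max K1 K2"] disj[of "max K1 K2" j] by simp
    qed
    then have "ones \<bullet> y 0 > 0" using yo[of 0] a ones_pos_part_nonneg[of "y 0"] by (simp add: u_def)
    then show False using ones_res[of "X 0"] by (simp add: y_def)
  qed
  \<comment> \<open>With the positive part gone, a nonzero negative part keeps
    \<open>ones \<bullet> X k\<close> negative forever. Then nothing is reinjected, and
    \<open>mass_leaves\<close> applies.\<close>
  have "ones \<bullet> z 0 = 0"
  proof (rule ccontr)
    assume b: "ones \<bullet> z 0 \<noteq> 0"
    then have bp: "0 < ones \<bullet> z 0" using ones_pos_part_nonneg[of "- y 0"] by (simp add: z_def)
    have yneg: "ones \<bullet> y k < 0" for k using yo[of k] mz[of k] u0 bp by simp
    have neg: "ones \<bullet> X k < 0" for k using ones_res[of "X k"] yneg[of k] by (simp add: y_def min_def split: if_splits)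
    have u0k: "u k = 0" for k
    proof -
      have "(\<Sum>i\<in>UNIV. (u k)$i) = 0" using mz(2)[of k] u0 by (simp add: ones_inner)
      then show ?thesis using nn(1) sum_nonneg_eq_0_iff[of UNIV "\<lambda>i. (u k)$i"] by (simp add: vec_eq_iff)
    qed
    have yz: "y k = - z k" for k using pos_part_decomp[of "y k"] u0k[of k] by (simp add: u_def z_def)
    have "y (Suc k) = S (y k)" for k using \<theta>(3)[of k] \<theta>(4)[OF neg neg, of k] by (simp add: step_def)
    then have "z (Suc k) = S (z k)" for k
      using yz[of k] yz[of "Suc k"] S_diff[of 0 "z k"] S_diff[of 0 0] by simp
    then show False using mass_leaves[OF nn(2) _ mz(1)] b by blast
  qed
  then have "l1 (y 0) = 0" using u0 l1_pos_part[of "y 0"] by (simp add: u_def z_def)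
  then show ?thesis using l1_eq_0 by (simp add: y_def X_def)
qed

section \<open>Boundedness and convergence of orbits of the noiseless step\<close>

lemma l1_le_norm: "l1 x \<le> real CARD('d) * norm x"
proof -
  have "l1 x \<le> (\<Sum>i\<in>(UNIV::'d set). norm x)"
    unfolding l1_def using component_le_norm_cart by (intro sum_mono)
  then show ?thesis by simp
qed

lemma norm_le_l1: "norm x \<le> l1 x"
  unfolding l1_def by (rule norm_le_l1_cart)

lemma norm_p: "norm p \<le> 1"
  using norm_le_l1[of p] p_nonneg p_sum by (simp add: l1_def)

lemma abs_ones_le: "\<bar>ones \<bullet> x\<bar> \<le> l1 x"
  unfolding ones_inner l1_def by (rule sum_abs)

lemma l1_res_le: "l1 (res x) \<le> 2 * l1 x"
proof -
  have "l1 (res x) \<le> (\<Sum>i\<in>UNIV. \<bar>x$i\<bar> + s x * p$i)"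
    unfolding l1_def res_def using s_nonneg[of x] p_nonneg
    by (intro sum_mono) (auto simp: intro!: order_trans[OF abs_triangle_ineq4])
  also have "\<dots> = l1 x + s x" by (simp add: l1_def sum.distrib sum_distrib_left[symmetric] p_sum)
  also have "s x \<le> l1 x" using abs_ones_le[of x] l1_nonneg[of x] by (auto simp: s_def)
  finally show ?thesis by simp
qed

lemma norm_le_res_s: "norm x \<le> l1 (res x) + s x"
proof -
  have "norm x = norm (res x + s x *\<^sub>R p)" by (simp add: res_def)
  also have "\<dots> \<le> norm (res x) + norm (s x *\<^sub>R p)" by (rule norm_triangle_ineq)
  also have "\<dots> \<le> l1 (res x) + s x * 1"
    using norm_p s_nonneg[of x] by (intro add_mono norm_le_l1) (auto simp: mult_left_le)
  finally show ?thesis by simp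
qed

lemma l1_res_F: "l1 (res (F x)) \<le> l1 (res x)"
  using res_F[of x] l1_step(1) unfolding step_def by metis

text \<open>A signed residual can lose negative mass and so feed the queue, but by no more than its
  l1 norm.\<close>

lemma s_F: "s (F x) \<le> (1 - \<eta> * \<alpha>) * s x + l1 (res x)"
proof -
  have "\<bar>ell (res x)\<bar> \<le> l1 (res x)"
  proof -
    have "ell (res x) = ell (pos_part (res x)) - ell (pos_part (- res x))" by (subst pos_part_decomp) (rule ell_diff)
    then show ?thesis
      using ell_nonneg[OF pos_part_nonneg, of "res x"] ell_nonneg[OF pos_part_nonneg, of "- res x"]
        ell_le[OF pos_part_nonneg, of "res x"] ell_le[OF pos_part_nonneg, of "- res x"] l1_pos_part[of "res x"] by linarith
  qed
  moreover have "0 \<le> (1 - \<eta> * \<alpha>) * s x" using eta_alpha s_nonneg[of x] by (intro mult_nonneg_nonneg) auto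
  ultimately show ?thesis unfolding s_def[of "F x"] ones_F using l1_nonneg[of "res x"] by linarith
qed

lemma l1_res_orbit: "l1 (res ((F ^^ k) x)) \<le> l1 (res x)"
  by (induction k) (auto intro: order_trans[OF l1_res_F])

lemma s_orbit: "s ((F ^^ k) x) \<le> s x + l1 (res x) / (\<eta> * \<alpha>)"
proof (induction k)
  case 0
  show ?case using l1_nonneg alpha_pos eta_pos by simp
next
  case (Suc k)
  have "s ((F ^^ Suc k) x) \<le> (1 - \<eta> * \<alpha>) * s ((F ^^ k) x) + l1 (res x)"
    using s_F[of "(F ^^ k) x"] l1_res_orbit[of k x] by simp
  also have "\<dots> \<le> (1 - \<eta> * \<alpha>) * (s x + l1 (res x) / (\<eta> * \<alpha>)) + l1 (res x)"
    using Suc eta_alpha by (intro add_right_mono mult_left_mono) auto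
  also have "\<dots> = (1 - \<eta> * \<alpha>) * s x + l1 (res x) / (\<eta> * \<alpha>)"
    using alpha_pos eta_pos by (simp add: field_simps)
  also have "\<dots> \<le> 1 * s x + l1 (res x) / (\<eta> * \<alpha>)"
    using alpha_pos eta_pos s_nonneg by (intro add_right_mono mult_right_mono) auto
  finally show ?case by simp
qed

definition Bd where "Bd = (3 + 2 / (\<eta> * \<alpha>)) * real CARD('d)"

lemma orbit_bound: "norm ((F ^^ k) x) \<le> Bd * norm x"
proof -
  have "norm ((F ^^ k) x) \<le> l1 (res x) + (s x + l1 (res x) / (\<eta> * \<alpha>))"
    using norm_le_res_s[of "(F ^^ k) x"] l1_res_orbit[of k x] s_orbit[of k x] by linarith
  also have "\<dots> \<le> 2 * l1 x + (l1 x + 2 * l1 x / (\<eta> * \<alpha>))"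
    using l1_res_le[of x] abs_ones_le[of x] l1_nonneg[of x] alpha_pos eta_pos
    by (intro add_mono divide_right_mono) (auto simp: s_def)
  also have "\<dots> = (3 + 2 / (\<eta> * \<alpha>)) * l1 x" by (simp add: distrib_right)
  also have "\<dots> \<le> (3 + 2 / (\<eta> * \<alpha>)) * (real CARD('d) * norm x)"
    using alpha_pos eta_pos by (intro mult_left_mono l1_le_norm) auto
  finally show ?thesis by (simp add: Bd_def mult.assoc)
qed

lemma F_lipschitz: "\<exists>M\<ge>0. \<forall>x y. norm (F x - F y) \<le> M * norm (x - y)"
proof -
  obtain B where B: "B > 0" "\<And>x. norm (R *v x) \<le> norm x * B"
    using bounded_linear.pos_bounded[OF matrix_vector_mul_bounded_linear[of R]] by blast
  define q where "q = (R - \<alpha> *\<^sub>R mat 1) *v p"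
  define M where "M = 1 + \<eta> * (B + real CARD('d) * norm q)"
  have "norm (F x - F y) \<le> M * norm (x - y)" for x y
  proof -
    have sd: "\<bar>s x - s y\<bar> \<le> real CARD('d) * norm (x - y)"
    proof -
      have "\<bar>s x - s y\<bar> \<le> \<bar>ones \<bullet> (x - y)\<bar>" by (auto simp: s_def inner_diff_right)
      also have "\<dots> \<le> real CARD('d) * norm (x - y)" using abs_ones_le l1_le_norm order_trans by blast
      finally show ?thesis .
    qed
    have Fq: "F x = x + \<eta> *\<^sub>R (- (R *v x) + s x *\<^sub>R q)" for x by (simp add: F_def q_def)
    have "F x - F y = (x - y) + \<eta> *\<^sub>R (- (R *v (x - y)) + (s x - s y) *\<^sub>R q)"
      unfolding Fq by (simp add: matrix_vector_mult_diff_distrib algebra_simps)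
    also have "norm \<dots> \<le> norm (x - y) + \<eta> * (norm (R *v (x - y)) + \<bar>s x - s y\<bar> * norm q)"
      using eta_pos by (intro order_trans[OF norm_triangle_ineq] add_left_mono)
        (auto intro!: order_trans[OF norm_triangle_ineq4] order_trans[OF norm_triangle_ineq] mult_left_mono simp: add.commute)
    also have "\<dots> \<le> norm (x - y) + \<eta> * (norm (x - y) * B + (real CARD('d) * norm (x - y)) * norm q)"
      using eta_pos B sd by (intro add_left_mono mult_left_mono add_mono mult_right_mono) auto
    also have "\<dots> = M * norm (x - y)" by (simp add: M_def algebra_simps)
    finally show ?thesis .
  qed
  moreover have "0 \<le> M" using B eta_pos by (simp add: M_def)
  ultimately show ?thesis by blast
qed

lemma F_hom: "0 \<le> c \<Longrightarrow> F (c *\<^sub>R x) = c *\<^sub>R F x"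
proof -
  assume c: "0 \<le> c"
  have "s (c *\<^sub>R x) = c * s x" using c by (simp add: s_def max_mult_distrib_left)
  then show ?thesis by (simp add: F_def matrix_vector_mult_scaleR algebra_simps)
qed

lemma F_cont: "continuous_on UNIV F"
proof -
  obtain M where M: "0 \<le> M" "\<And>x y. norm (F x - F y) \<le> M * norm (x - y)" using F_lipschitz by blast
  then have "M-lipschitz_on UNIV F" by (intro lipschitz_onI) (auto simp: dist_norm)
  then show ?thesis by (rule lipschitz_on_continuous_on)
qed

text \<open>Along the orbit of a limit point \<open>xs\<close> the norm of the residual is constant,
  equal to the limit \<open>l\<close>. By \<open>stationary_residual\<close> it is 0, so the
  residuals tend to 0, and the queue is then a contraction by \<open>1 - \<eta> * \<alpha>\<close>
  with vanishing forcing.\<close>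

lemma orbit_tendsto_0: "(\<lambda>k. (F ^^ k) x) \<longlonglongrightarrow> 0"
proof -
  define f where "f k = l1 (res ((F ^^ k) x))" for k
  have dec: "decseq f" unfolding f_def by (rule decseq_SucI) (simp add: l1_res_F)
  obtain l where l: "f \<longlonglongrightarrow> l"
  proof -
    have "\<forall>i. 0 \<le> f i" by (simp add: f_def l1_nonneg)
    from decseq_convergent[OF dec this] show ?thesis using that by blast
  qed
  have "bounded (range (\<lambda>k. (F ^^ k) x))"
    using orbit_bound by (auto simp: bounded_iff intro: exI[of _ "Bd * norm x"])
  then obtain xs r where r: "strict_mono r" "((\<lambda>k. (F ^^ k) x) \<circ> r) \<longlonglongrightarrow> xs"
    using bounded_imp_convergent_subsequence by blast
  have contj: "continuous_on UNIV (F ^^ j)" for j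
  proof (induction j)
    case (Suc j)
    then show ?case using continuous_on_compose2[OF F_cont Suc] by (simp add: o_def)
  qed (simp add: id_def)
  have contn: "continuous_on UNIV (\<lambda>x. l1 (res x))"
    unfolding l1_def res_def s_def by (intro continuous_intros)
  have "l1 (res ((F ^^ j) xs)) = l" for j
  proof (rule LIMSEQ_unique)
    have "(\<lambda>k. l1 (res ((F ^^ j) ((F ^^ r k) x)))) \<longlonglongrightarrow> l1 (res ((F ^^ j) xs))"
      using r(2) by (intro continuous_on_tendsto_compose[OF continuous_on_compose2[OF contn contj]]) (auto simp: o_def)
    then show "(\<lambda>k. f (r k + j)) \<longlonglongrightarrow> l1 (res ((F ^^ j) xs))"
      by (simp add: f_def funpow_add add.commute)
    show "(\<lambda>k. f (r k + j)) \<longlonglongrightarrow> l"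
      by (rule filterlim_compose[OF LIMSEQ_ignore_initial_segment[OF l] filterlim_subseq[OF r(1)]])
  qed
  from this this[of 0] have "res xs = 0" by (intro stationary_residual) simp
  then have "l = 0" using \<open>\<And>j. l1 (res ((F ^^ j) xs)) = l\<close>[of 0] by (simp add: l1_def)
  then have f0: "f \<longlonglongrightarrow> 0" using l by simp
  have s0: "(\<lambda>k. s ((F ^^ k) x)) \<longlonglongrightarrow> 0"
  proof (rule perturbed_contraction_tendsto_0[OF s_nonneg _ _ _ f0])
    show "s ((F ^^ Suc k) x) \<le> (1 - \<eta> * \<alpha>) * s ((F ^^ k) x) + f k" for k
      using s_F[of "(F ^^ k) x"] by (simp add: f_def)
  qed (use alpha_pos eta_pos eta_alpha in auto)
  have "(\<lambda>k. f k + s ((F ^^ k) x)) \<longlonglongrightarrow> 0" using tendsto_add[OF f0 s0] by simp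
  then show ?thesis
    by (rule Lim_null_comparison[rotated]) (use norm_le_res_s in \<open>simp add: f_def\<close>)
qed

lemma fluid_lyapunov:
  "\<exists>U r L. 0 \<le> r \<and> r < 1 \<and> 0 \<le> L \<and> (\<forall>x. norm x \<le> U x) \<and>
     (\<forall>x y. \<bar>U x - U y\<bar> \<le> L * norm (x - y)) \<and> (\<forall>x. U (F x) \<le> r * U x)"
proof -
  obtain M where M: "0 \<le> M" "\<And>x y. norm (F x - F y) \<le> M * norm (x - y)" using F_lipschitz by blast
  show ?thesis by (rule homogeneous_lyapunov[OF F_hom M(2,1) orbit_bound orbit_tendsto_0])
qed

end

section \<open>Gaussian kernels and path space\<close>

abbreviation "std_normal \<equiv> density lborel (normal_density 0 1)"

lemma prob_space_std_normal: "prob_space std_normal"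
  by (rule prob_space_normal_density) simp

lemma vec_lambda_measurable[measurable]:
  assumes "\<And>i. f i \<in> borel_measurable M"
  shows "(\<lambda>\<omega>. (\<chi> i. f i \<omega>) :: real^'d) \<in> borel_measurable M"
  unfolding borel_measurable_euclidean_space[where 'c="real^'d"]
  using assms by (auto simp: Basis_vec_def inner_axis)

lemma PiM_vec_measurable[measurable]:
  assumes "\<And>i. sets (M i) = sets borel"
  shows "(\<lambda>\<omega>. (\<chi> i. \<omega> i) :: real^'d::finite) \<in> borel_measurable (PiM UNIV M)"
proof (rule vec_lambda_measurable)
  fix i
  show "(\<lambda>\<omega>. \<omega> i) \<in> borel_measurable (PiM UNIV M)"
    using measurable_component_singleton[of i UNIV M] assms[of i] by (simp cong: measurable_cong_sets)
qed

lemma sets_std_gauss[simp, measurable_cong]: "sets std_gauss = sets borel"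
  by (simp add: std_gauss_def)

lemma space_std_gauss[simp]: "space std_gauss = UNIV"
  by (simp add: std_gauss_def)

lemma prob_space_std_gauss: "prob_space (std_gauss :: (real^'d::finite) measure)"
  unfolding std_gauss_def
proof (rule prob_space.prob_space_distr)
  show "prob_space (Pi\<^sub>M (UNIV::'d set) (\<lambda>_. std_normal))"
    by (intro prob_space_PiM prob_space_std_normal)
qed (rule PiM_vec_measurable, simp)

lemma integrable_norm_std_gauss: "integrable (std_gauss :: (real^'d::finite) measure) norm"
proof (rule Bochner_Integration.integrable_bound)
  let ?G = "Pi\<^sub>M (UNIV::'d set) (\<lambda>_. std_normal)"
  have "integrable std_gauss (\<lambda>z::real^'d. \<bar>z$i\<bar>)" for i
  proof -
    have "integrable std_normal (\<lambda>z::real. \<bar>z\<bar>)"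
      using integrable_std_normal_moment_abs[of 1] by (subst integrable_density) (auto simp: normal_density_nonneg)
    then have "integrable (distr ?G std_normal (\<lambda>\<omega>. \<omega> i)) (\<lambda>z. \<bar>z\<bar>)"
      by (subst distr_PiM_component) (auto intro: prob_space_std_normal)
    then have "integrable ?G (\<lambda>\<omega>. \<bar>\<omega> i\<bar>)"
      by (subst (asm) integrable_distr_eq) (auto simp: measurable_component_singleton)
    then show ?thesis unfolding std_gauss_def
      by (subst integrable_distr_eq) (auto intro!: PiM_vec_measurable borel_measurable_abs)
  qed
  then show "integrable (std_gauss :: (real^'d) measure) (\<lambda>z. \<Sum>i\<in>UNIV. \<bar>z$i\<bar>)"
    by (intro Bochner_Integration.integrable_sum)
  show "AE z in std_gauss. norm (norm (z::real^'d)) \<le> norm (\<Sum>i\<in>UNIV. \<bar>z$i\<bar>)"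
    by (intro AE_I2) (use norm_le_l1_cart in \<open>auto intro: order_trans\<close>)
qed simp

text \<open>On the unit interval every shift by at most \<open>r\<close> leaves the normal density
  at least at its value in \<open>r + 1\<close>; the minorizing law is uniform on that
  interval.\<close>

lemma normal_shift_minorized:
  fixes \<phi> :: "real \<Rightarrow> ennreal"
  assumes [measurable]: "\<phi> \<in> borel_measurable borel" and u: "\<bar>u\<bar> \<le> r"
  shows "ennreal (normal_density 0 1 (r + 1)) * (\<integral>\<^sup>+y. \<phi> y \<partial>density lborel (indicator {0..1}))
     \<le> (\<integral>\<^sup>+y. \<phi> y \<partial>distr std_normal borel (\<lambda>z. z + u))"
proof -
  let ?n = "normal_density 0 1" and ?c = "normal_density 0 1 (r + 1)"
  have "ennreal ?c * (\<integral>\<^sup>+y. \<phi> y \<partial>density lborel (indicator {0..1})) = (\<integral>\<^sup>+y. ennreal ?c * (indicator {0..1} y * \<phi> y) \<partial>lborel)"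
    by (subst nn_integral_density) (auto simp: nn_integral_cmult)
  also have "\<dots> \<le> (\<integral>\<^sup>+y. ennreal (?n (y - u)) * \<phi> y \<partial>lborel)"
  proof (rule nn_integral_mono)
    fix y :: real
    have "?c \<le> ?n (y - u)" if "0 \<le> y" "y \<le> 1"
    proof -
      have "\<bar>y - u\<bar> \<le> \<bar>r + 1\<bar>" using that u by auto
      then have "(y - u)\<^sup>2 \<le> (r + 1)\<^sup>2" by (simp add: abs_le_square_iff)
      then show ?thesis by (simp add: normal_density_def divide_right_mono)
    qed
    then show "ennreal ?c * (indicator {0..1} y * \<phi> y) \<le> ennreal (?n (y - u)) * \<phi> y"
      by (auto simp: indicator_def intro!: mult_right_mono ennreal_leI)
  qed
  also have "\<dots> = (\<integral>\<^sup>+z. ennreal (?n z) * \<phi> (z + u) \<partial>lborel)"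
    by (subst nn_integral_real_affine[where c=1 and t=u]) (auto simp: add.commute)
  also have "\<dots> = (\<integral>\<^sup>+y. \<phi> y \<partial>distr std_normal borel (\<lambda>z. z + u))"
    by (subst nn_integral_distr) (auto simp: nn_integral_density)
  finally show ?thesis .
qed

text \<open>By Fubini's theorem minorizations multiply over independent coordinates, one factor
  \<open>c\<close> for each.\<close>

lemma PiM_minorized:
  fixes A B :: "'i \<Rightarrow> 'b measure"
  assumes I: "finite I" and A: "\<And>i. prob_space (A i)" and B: "\<And>i. prob_space (B i)"
    and sets: "\<And>i. sets (A i) = sets (B i)"
    and le: "\<And>i \<phi>. \<phi> \<in> borel_measurable (B i) \<Longrightarrow> c * (\<integral>\<^sup>+y. \<phi> y \<partial>B i) \<le> (\<integral>\<^sup>+y. \<phi> y \<partial>A i)"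
    and \<phi>: "\<phi> \<in> borel_measurable (PiM I B)"
  shows "c ^ card I * (\<integral>\<^sup>+y. \<phi> y \<partial>PiM I B) \<le> (\<integral>\<^sup>+y. \<phi> y \<partial>PiM I A)"
  using I \<phi>
proof (induction I arbitrary: \<phi> rule: finite_induct)
  case empty
  interpret A: product_sigma_finite A by (intro product_sigma_finite.intro prob_space_imp_sigma_finite A)
  interpret B: product_sigma_finite B by (intro product_sigma_finite.intro prob_space_imp_sigma_finite B)
  show ?case by (simp add: A.nn_integral_empty B.nn_integral_empty)
next
  case (insert i I)
  interpret A: product_sigma_finite A by (intro product_sigma_finite.intro prob_space_imp_sigma_finite A)
  interpret B: product_sigma_finite B by (intro product_sigma_finite.intro prob_space_imp_sigma_finite B)
  have setsP: "sets (PiM J A) = sets (PiM J B)" for J by (intro sets_PiM_cong) (auto simp: sets)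
  have [measurable]: "\<phi> \<in> borel_measurable (PiM (insert i I) B)" by (rule insert.prems)
  have mA: "\<phi> \<in> borel_measurable (PiM (insert i I) A)" using insert.prems setsP by (simp cong: measurable_cong_sets)
  have m2: "(\<lambda>x. \<integral>\<^sup>+y. \<phi> (x(i := y)) \<partial>B i) \<in> borel_measurable (PiM I B)"
    by (rule sigma_finite_measure.borel_measurable_nn_integral[OF prob_space_imp_sigma_finite[OF B]]) measurable
  have m3: "(\<lambda>y. \<phi> (x(i := y))) \<in> borel_measurable (B i)" if "x \<in> space (PiM I B)" for x
    using that by (intro measurable_compose[OF _ insert.prems] measurable_fun_upd[where J=I]) auto
  have "c ^ card (insert i I) * (\<integral>\<^sup>+y. \<phi> y \<partial>PiM (insert i I) B)
      = c * (c ^ card I * (\<integral>\<^sup>+x. (\<integral>\<^sup>+y. \<phi> (x(i := y)) \<partial>B i) \<partial>PiM I B))"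
    using insert by (simp add: B.product_nn_integral_insert mult.assoc)
  also have "\<dots> \<le> c * (\<integral>\<^sup>+x. (\<integral>\<^sup>+y. \<phi> (x(i := y)) \<partial>B i) \<partial>PiM I A)"
    by (intro mult_left_mono insert.IH m2) simp
  also have "\<dots> = (\<integral>\<^sup>+x. c * (\<integral>\<^sup>+y. \<phi> (x(i := y)) \<partial>B i) \<partial>PiM I A)"
    using m2 setsP[of I] by (intro nn_integral_cmult[symmetric]) (simp cong: measurable_cong_sets)
  also have "\<dots> \<le> (\<integral>\<^sup>+x. (\<integral>\<^sup>+y. \<phi> (x(i := y)) \<partial>A i) \<partial>PiM I A)"
    using sets_eq_imp_space_eq[OF setsP[of I]] by (intro nn_integral_mono le m3) simp
  also have "\<dots> = (\<integral>\<^sup>+y. \<phi> y \<partial>PiM (insert i I) A)"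
    using insert mA by (simp add: A.product_nn_integral_insert)
  finally show ?case .
qed

lemma PiM_shift:
  fixes u :: "'i::finite \<Rightarrow> real"
  shows "distr (PiM UNIV (\<lambda>_. std_normal)) (PiM UNIV (\<lambda>_. borel)) (\<lambda>\<omega> i. \<omega> i + u i)
     = PiM UNIV (\<lambda>i. distr std_normal borel (\<lambda>z. z + u i))"
proof (rule product_sigma_finite.PiM_eqI)
  show "product_sigma_finite (\<lambda>i::'i. distr std_normal borel (\<lambda>z. z + u i))"
    by (intro product_sigma_finite.intro prob_space_imp_sigma_finite prob_space.prob_space_distr prob_space_std_normal) simp
  interpret N: product_prob_space "\<lambda>_::'i. std_normal" UNIV
    by (intro product_prob_spaceI prob_space_std_normal)
  have meas: "(\<lambda>\<omega> i. \<omega> i + u i) \<in> PiM UNIV (\<lambda>_. std_normal) \<rightarrow>\<^sub>M PiM UNIV (\<lambda>_. borel)"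
    by (rule measurable_PiM_single') (auto intro!: borel_measurable_add simp: measurable_component_singleton cong: measurable_cong_sets)
  show "sets (distr (PiM UNIV (\<lambda>_. std_normal)) (PiM UNIV (\<lambda>_. borel)) (\<lambda>\<omega> i. \<omega> i + u i))
     = sets (PiM UNIV (\<lambda>i. distr std_normal borel (\<lambda>z. z + u i)))"
    by (auto intro!: sets_PiM_cong)
  fix A :: "'i \<Rightarrow> real set" assume A: "\<And>i. i \<in> UNIV \<Longrightarrow> A i \<in> sets (distr std_normal borel (\<lambda>z. z + u i))"
  then have [measurable]: "A i \<in> sets borel" for i by simp
  have pre: "(\<lambda>\<omega> i. \<omega> i + u i) -` Pi\<^sub>E UNIV A \<inter> space (PiM UNIV (\<lambda>_. std_normal)) = Pi\<^sub>E UNIV (\<lambda>i. {z. z + u i \<in> A i})"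
    by (auto simp: space_PiM PiE_def Pi_def)
  have "emeasure (distr (PiM UNIV (\<lambda>_. std_normal)) (PiM UNIV (\<lambda>_. borel)) (\<lambda>\<omega> i. \<omega> i + u i)) (Pi\<^sub>E UNIV A)
     = emeasure (PiM UNIV (\<lambda>_. std_normal)) (Pi\<^sub>E UNIV (\<lambda>i. {z. z + u i \<in> A i}))"
    unfolding pre[symmetric] by (rule emeasure_distr[OF meas]) (auto intro!: sets_PiM_I_finite)
  also have "\<dots> = (\<Prod>i\<in>UNIV. emeasure std_normal {z. z + u i \<in> A i})"
    by (rule N.emeasure_PiM) auto
  also have "\<dots> = (\<Prod>i\<in>UNIV. emeasure (distr std_normal borel (\<lambda>z. z + u i)) (A i))"
    by (intro prod.cong refl) (simp add: emeasure_distr vimage_def)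
  finally show "emeasure (distr (PiM UNIV (\<lambda>_. std_normal)) (PiM UNIV (\<lambda>_. borel)) (\<lambda>\<omega> i. \<omega> i + u i)) (Pi\<^sub>E UNIV A)
     = (\<Prod>i\<in>UNIV. emeasure (distr std_normal borel (\<lambda>z. z + u i)) (A i))" .
qed simp

text \<open>The uniform law on the unit cube minorizes all bounded shifts simultaneously. A shifted
  Gaussian is a product of shifted coordinates, so the one-dimensional bound applies to
  each.\<close>

lemma std_gauss_shift_minorized:
  "\<exists>\<epsilon>>0. \<exists>\<nu>::(real^'d::finite) measure. prob_space \<nu> \<and> sets \<nu> = sets borel \<and>
     (\<forall>u \<phi>. norm u \<le> r \<longrightarrow> \<phi> \<in> borel_measurable borel \<longrightarrow>
        ennreal \<epsilon> * (\<integral>\<^sup>+y. \<phi> y \<partial>\<nu>) \<le> (\<integral>\<^sup>+z. \<phi> (z + u) \<partial>std_gauss))"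
proof -
  let ?U = "\<lambda>_::'d. density lborel (indicator {0..1::real})"
  define c where "c = normal_density 0 1 (r + 1)"
  have c: "0 < c" by (simp add: c_def normal_density_pos)
  have U: "prob_space (?U i)" for i by (rule prob_spaceI) (simp add: emeasure_density)
  define \<nu> :: "(real^'d) measure" where "\<nu> = distr (PiM UNIV ?U) borel (\<lambda>\<omega>. \<chi> i. \<omega> i)"
  have vm: "(\<lambda>\<omega>. (\<chi> i. \<omega> i) :: real^'d) \<in> borel_measurable (PiM UNIV M)" if "\<And>i. sets (M i) = sets borel" for M
    by (rule PiM_vec_measurable[OF that])
  have \<nu>: "prob_space \<nu>" "sets \<nu> = sets borel"
    unfolding \<nu>_def by (auto intro!: prob_space.prob_space_distr prob_space_PiM U vm)
  have "ennreal (c ^ CARD('d)) * (\<integral>\<^sup>+y. \<phi> y \<partial>\<nu>) \<le> (\<integral>\<^sup>+z. \<phi> (z + u) \<partial>std_gauss)"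
    if u: "norm u \<le> r" and [measurable]: "\<phi> \<in> borel_measurable borel" for u :: "real^'d" and \<phi>
  proof -
    let ?A = "\<lambda>i. distr std_normal borel (\<lambda>z. z + u$i)"
    have A: "prob_space (?A i)" for i by (intro prob_space.prob_space_distr prob_space_std_normal) simp
    have ui: "\<bar>u$i\<bar> \<le> r" for i using component_le_norm_cart[of u i] u by linarith
    have "ennreal (c ^ CARD('d)) * (\<integral>\<^sup>+y. \<phi> y \<partial>\<nu>) = ennreal c ^ CARD('d) * (\<integral>\<^sup>+\<omega>. \<phi> (\<chi> i. \<omega> i) \<partial>PiM UNIV ?U)"
      unfolding \<nu>_def using c by (subst nn_integral_distr) (auto intro!: vm simp: ennreal_power)
    also have "\<dots> \<le> (\<integral>\<^sup>+\<omega>. \<phi> (\<chi> i. \<omega> i) \<partial>PiM UNIV ?A)"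
    proof (rule PiM_minorized[OF finite A U])
      show "ennreal c * (\<integral>\<^sup>+y. \<psi> y \<partial>?U i) \<le> (\<integral>\<^sup>+y. \<psi> y \<partial>?A i)" if "\<psi> \<in> borel_measurable (?U i)" for i and \<psi>
        unfolding c_def using that by (intro normal_shift_minorized ui) simp
      show "(\<lambda>\<omega>. \<phi> (\<chi> i. \<omega> i)) \<in> borel_measurable (PiM UNIV ?U)"
        by (rule measurable_compose[OF vm]) auto
    qed simp
    also have "\<dots> = (\<integral>\<^sup>+\<omega>. \<phi> (\<chi> i. \<omega> i + u$i) \<partial>PiM UNIV (\<lambda>_. std_normal))"
      unfolding PiM_shift[symmetric]
    proof (subst nn_integral_distr)
      show *: "(\<lambda>\<omega> i. \<omega> i + u$i) \<in> PiM UNIV (\<lambda>_. std_normal) \<rightarrow>\<^sub>M PiM UNIV (\<lambda>_. borel)"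
        by (rule measurable_PiM_single') (auto intro!: borel_measurable_add simp: measurable_component_singleton cong: measurable_cong_sets)
      have "(\<lambda>\<omega>. \<phi> (\<chi> i. \<omega> i)) \<in> borel_measurable (PiM UNIV (\<lambda>_. borel))"
        by (rule measurable_compose[OF vm]) auto
      then show "(\<lambda>\<omega>. \<phi> (\<chi> i. \<omega> i)) \<in> borel_measurable (distr (PiM UNIV (\<lambda>_. std_normal)) (PiM UNIV (\<lambda>_. borel)) (\<lambda>\<omega> i. \<omega> i + u$i))"
        by simp
    qed simp
    also have "\<dots> = (\<integral>\<^sup>+z. \<phi> (z + u) \<partial>std_gauss)"
      unfolding std_gauss_def by (subst nn_integral_distr) (auto intro!: vm nn_integral_cong arg_cong[of _ _ \<phi>] simp: vec_eq_iff)
    finally show ?thesis .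
  qed
  then show ?thesis using c \<nu> by (intro exI[of _ "c ^ CARD('d)"]) auto
qed

lemma matrix_vector_mult_measurable[measurable]:
  fixes A :: "real^'n::finite^'m::finite"
  assumes [measurable]: "f \<in> borel_measurable M" shows "(\<lambda>x. A *v f x) \<in> borel_measurable M"
proof -
  have "(\<lambda>z. A *v z) \<in> borel_measurable borel"
    by (intro borel_measurable_continuous_onI linear_continuous_on matrix_vector_mul_bounded_linear)
  from measurable_compose[OF assms this] show ?thesis .
qed

text \<open>As \<open>U\<close> is Lipschitz, the noise raises its mean by at most \<open>L\<close>
  times the mean of \<open>norm (A *v z)\<close>, which gives the drift condition. The right inverse
  \<open>B\<close> rewrites \<open>b x + A *v z\<close> as \<open>A *v (z + B *v b x)\<close>, so on
  a bounded set the dependence on \<open>x\<close> is a bounded shift of the Gaussian.\<close>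

lemma gaussian_harris_chain:
  fixes b :: "real^'d::finite \<Rightarrow> real^'d" and A B :: "real^'d^'d"
  assumes b: "continuous_on UNIV b" and AB: "A ** B = mat 1"
    and r: "0 \<le> r" "r < 1" and L: "0 \<le> L" and U: "\<And>x. norm x \<le> U x" "\<And>x y. \<bar>U x - U y\<bar> \<le> L * norm (x - y)"
    and dec: "\<And>x. U (b x) \<le> r * U x + c" "0 \<le> c"
  shows "\<exists>C. harris_chain (\<lambda>x. distr std_gauss borel (\<lambda>z. b x + A *v z)) (\<lambda>x. 1 + U x) r C"
proof -
  interpret G: prob_space "std_gauss :: (real^'d) measure" by (rule prob_space_std_gauss)
  let ?K = "\<lambda>x. distr std_gauss borel (\<lambda>z. b x + A *v z)"
  define m where "m = (\<integral>z. norm (A *v z) \<partial>(std_gauss :: (real^'d) measure))"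
  have [measurable]: "b \<in> borel_measurable borel" using b by (rule borel_measurable_continuous_onI)
  have "continuous_on UNIV U"
  proof -
    have "L-lipschitz_on UNIV U" using U(2) L by (intro lipschitz_onI) (auto simp: dist_norm)
    then show ?thesis by (rule lipschitz_on_continuous_on)
  qed
  then have Um[measurable]: "U \<in> borel_measurable borel" by (rule borel_measurable_continuous_onI)
  have U0: "0 \<le> U x" for x using U(1)[of x] norm_ge_zero order_trans by blast
  have Ai: "integrable std_gauss (\<lambda>z. norm (A *v z))"
  proof -
    obtain M where M: "\<And>z. norm (A *v z) \<le> norm z * M"
      using bounded_linear.bounded[OF matrix_vector_mul_bounded_linear[of A]] by blast
    show ?thesis
    proof (rule Bochner_Integration.integrable_bound)
      show "integrable (std_gauss :: (real^'d) measure) (\<lambda>z. norm z * M)"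
        using integrable_norm_std_gauss by (rule integrable_mult_left)
      show "AE z in std_gauss. norm (norm (A *v z)) \<le> norm (norm z * M)"
        using M by (intro AE_I2) (auto intro: order_trans[OF _ abs_ge_self])
    qed measurable
  qed
  have bound: "U (b x + A *v z) \<le> U (b x) + L * norm (A *v z)" for x z
    using U(2)[of "b x + A *v z" "b x"] by (simp add: abs_le_iff)
  have Ui: "integrable std_gauss (\<lambda>z. U (b x + A *v z))" for x
  proof (rule Bochner_Integration.integrable_bound)
    show "integrable std_gauss (\<lambda>z. U (b x) + L * norm (A *v z))" using Ai by simp
    show "AE z in std_gauss. norm (U (b x + A *v z)) \<le> norm (U (b x) + L * norm (A *v z))"
      using bound U0 by (intro AE_I2) (auto intro: order_trans[OF _ abs_ge_self])
  qed measurable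
  have Uint: "(\<integral>z. U (b x + A *v z) \<partial>std_gauss) \<le> r * U x + c + L * m" for x
  proof -
    have "(\<integral>z. U (b x + A *v z) \<partial>std_gauss) \<le> (\<integral>z. U (b x) + L * norm (A *v z) \<partial>std_gauss)"
      using Ai by (intro integral_mono Ui bound) simp
    also have "\<dots> = U (b x) + L * m" using Ai G.prob_space by (simp add: m_def)
    finally show ?thesis using dec(1)[of x] by linarith
  qed
  have m0: "0 \<le> m" by (simp add: m_def)
  have "harris_chain ?K (\<lambda>x. 1 + U x) r (1 + c + L * m)"
  proof (rule harris_chain.intro)
    show "?K \<in> borel \<rightarrow>\<^sub>M subprob_algebra borel"
    proof (rule measurable_distr2[where M=std_gauss])
      show "case_prod (\<lambda>x z. b x + A *v z) \<in> borel \<Otimes>\<^sub>M std_gauss \<rightarrow>\<^sub>M borel" by measurable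
      show "(\<lambda>x. std_gauss) \<in> borel \<rightarrow>\<^sub>M subprob_algebra (std_gauss :: (real^'d) measure)"
        by (rule measurable_const) (simp add: space_subprob_algebra G.subprob_space_axioms prob_space_imp_subprob_space prob_space_std_gauss)
    qed
    show "prob_space (?K x)" for x by (rule G.prob_space_distr) measurable
    show "(\<lambda>x. 1 + U x) \<in> borel_measurable borel" by measurable
    show "1 \<le> 1 + U x" for x using U0 by simp
    show "integrable (?K x) (\<lambda>x. 1 + U x)" for x
      using Ui[of x] by (subst integrable_distr_eq) (auto simp: G.integrable_const)
    show "0 \<le> r" "r < 1" by (fact r)+
    show "0 \<le> 1 + c + L * m" using dec L m0 by simp
    show "(\<integral>y. 1 + U y \<partial>?K x) \<le> r * (1 + U x) + (1 + c + L * m)" for x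
    proof -
      have "(\<integral>y. 1 + U y \<partial>?K x) = 1 + (\<integral>z. U (b x + A *v z) \<partial>std_gauss)"
        using Ui[of x] G.prob_space by (subst integral_distr) (auto)
      then show ?thesis using Uint[of x] r by (simp add: algebra_simps)
    qed
    fix R :: real
    have "bounded (b ` cball 0 R)"
      by (intro compact_imp_bounded compact_continuous_image continuous_on_subset[OF b]) auto
    then obtain q where q: "\<And>x. norm x \<le> R \<Longrightarrow> norm (b x) \<le> q"
      unfolding bounded_iff by (auto simp: dist_norm) (metis mem_cball_0)
    obtain M where M: "0 < M" "\<And>z. norm (B *v z) \<le> norm z * M"
      using bounded_linear.pos_bounded[OF matrix_vector_mul_bounded_linear[of B]] by blast
    obtain \<epsilon> and \<nu> :: "(real^'d) measure" where \<epsilon>: "0 < \<epsilon>" and \<nu>: "prob_space \<nu>" "sets \<nu> = sets borel"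
      and min: "\<And>u \<phi>. norm u \<le> q * M \<Longrightarrow> \<phi> \<in> borel_measurable borel \<Longrightarrow>
        ennreal \<epsilon> * (\<integral>\<^sup>+y. \<phi> y \<partial>\<nu>) \<le> (\<integral>\<^sup>+z. \<phi> (z + u) \<partial>std_gauss)"
      using std_gauss_shift_minorized[of "q * M"] by metis
    have [measurable_cong]: "sets \<nu> = sets borel" by (rule \<nu>)
    show "\<exists>\<epsilon>>0. \<exists>\<nu>. prob_space \<nu> \<and> sets \<nu> = sets borel \<and> (\<forall>x \<phi>. 1 + U x \<le> R \<longrightarrow> \<phi> \<in> borel_measurable borel \<longrightarrow>
         ennreal \<epsilon> * (\<integral>\<^sup>+y. \<phi> y \<partial>\<nu>) \<le> (\<integral>\<^sup>+y. \<phi> y \<partial>?K x))"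
    proof (intro exI[of _ \<epsilon>] exI[of _ "distr \<nu> borel (\<lambda>z. A *v z)"] conjI allI impI \<epsilon>)
      show "prob_space (distr \<nu> borel (\<lambda>z. A *v z))" using \<nu> by (intro prob_space.prob_space_distr) measurable
      fix x and \<phi> :: "real^'d \<Rightarrow> ennreal" assume x: "1 + U x \<le> R" and [measurable]: "\<phi> \<in> borel_measurable borel"
      have "norm x \<le> R" using x U(1)[of x] by linarith
      then have "norm (B *v b x) \<le> q * M" using M q order_trans mult_right_mono by (metis less_imp_le)
      then have "ennreal \<epsilon> * (\<integral>\<^sup>+y. \<phi> (A *v y) \<partial>\<nu>) \<le> (\<integral>\<^sup>+z. \<phi> (A *v (z + B *v b x)) \<partial>std_gauss)"
        by (rule min) measurable
      also have "\<dots> = (\<integral>\<^sup>+z. \<phi> (b x + A *v z) \<partial>std_gauss)"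
        by (simp add: matrix_vector_right_distrib matrix_vector_mul_assoc AB add.commute)
      finally show "ennreal \<epsilon> * (\<integral>\<^sup>+y. \<phi> y \<partial>distr \<nu> borel (\<lambda>z. A *v z)) \<le> (\<integral>\<^sup>+y. \<phi> y \<partial>?K x)"
        by (subst (1 2) nn_integral_distr) auto
    qed simp
  qed
  then show ?thesis by blast
qed

section \<open>Innovation sequences and the Markov property of the chain\<close>

lemma prob_space_path: "prob_space (path_space :: (nat \<Rightarrow> real^'d) measure)"
  unfolding path_space_def by (intro prob_space_PiM prob_space_std_gauss)

lemma coordinate_meas: "(\<lambda>\<omega>. \<omega> k) \<in> borel_measurable (path_space :: (nat \<Rightarrow> real^'d) measure)"
  unfolding path_space_def using measurable_component_singleton[of k UNIV "\<lambda>_. std_gauss :: (real^'d) measure"]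
  by (simp cong: measurable_cong_sets)

text \<open>An i.i.d. sequence is an independent head followed by a copy of itself; conditioning on
  the first innovation rests on this.\<close>

lemma path_split:
  "distr (std_gauss \<Otimes>\<^sub>M path_space) path_space (\<lambda>(s, \<omega>). case_nat s \<omega>) = (path_space :: (nat \<Rightarrow> real^'d) measure)"
  "(\<lambda>(s, \<omega>). case_nat s \<omega>) \<in> std_gauss \<Otimes>\<^sub>M path_space \<rightarrow>\<^sub>M (path_space :: (nat \<Rightarrow> real^'d) measure)"
proof -
  interpret sequence_space "std_gauss :: (real^'d) measure"
    unfolding sequence_space_def by (intro product_prob_spaceI prob_space_std_gauss)
  show "distr (std_gauss \<Otimes>\<^sub>M path_space) path_space (\<lambda>(s, \<omega>). case_nat s \<omega>) = (path_space :: (nat \<Rightarrow> real^'d) measure)"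
    unfolding path_space_def by (rule PiM_iter)
  show "(\<lambda>(s, \<omega>). case_nat s \<omega>) \<in> std_gauss \<Otimes>\<^sub>M path_space \<rightarrow>\<^sub>M (path_space :: (nat \<Rightarrow> real^'d) measure)"
    unfolding path_space_def by measurable
qed

text \<open>\<open>em_chain\<close> reads innovations from index 1 on. Dropping coordinate 0
  preserves the law because, in the head-tail split, it is the projection onto the tail.\<close>

lemma path_shift:
  "distr path_space path_space (\<lambda>\<omega> n. \<omega> (Suc n)) = (path_space :: (nat \<Rightarrow> real^'d) measure)"
  "(\<lambda>\<omega> n. \<omega> (Suc n)) \<in> path_space \<rightarrow>\<^sub>M (path_space :: (nat \<Rightarrow> real^'d) measure)"
proof -
  show m: "(\<lambda>\<omega> n. \<omega> (Suc n)) \<in> path_space \<rightarrow>\<^sub>M (path_space :: (nat \<Rightarrow> real^'d) measure)"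
    unfolding path_space_def
    by (rule measurable_PiM_single') (auto intro: measurable_component_singleton)
  interpret S: prob_space "path_space :: (nat \<Rightarrow> real^'d) measure" by (rule prob_space_path)
  interpret G: prob_space "std_gauss :: (real^'d) measure" by (rule prob_space_std_gauss)
  have "distr path_space path_space (\<lambda>\<omega> n. \<omega> (Suc n)) =
     distr (distr (std_gauss \<Otimes>\<^sub>M path_space) path_space (\<lambda>(s, \<omega>). case_nat s \<omega>)) path_space (\<lambda>(\<omega> :: nat \<Rightarrow> real^'d) n. \<omega> (Suc n))"
    by (simp add: path_split)
  also have "\<dots> = distr (std_gauss \<Otimes>\<^sub>M path_space) path_space ((\<lambda>\<omega> n. \<omega> (Suc n)) \<circ> (\<lambda>(s, \<omega>). case_nat s \<omega>))"
    by (rule distr_distr[OF m path_split(2)])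
  also have "(\<lambda>\<omega> n. \<omega> (Suc n)) \<circ> (\<lambda>(s, \<omega>). case_nat s \<omega>) = (snd :: (real^'d) \<times> (nat \<Rightarrow> real^'d) \<Rightarrow> _)"
    by auto
  also have "distr (std_gauss \<Otimes>\<^sub>M path_space) path_space (snd :: (real^'d) \<times> (nat \<Rightarrow> real^'d) \<Rightarrow> _) = (path_space :: (nat \<Rightarrow> real^'d) measure)"
  proof (rule measure_eqI)
    fix A assume "A \<in> sets (distr (std_gauss \<Otimes>\<^sub>M path_space) path_space (snd :: (real^'d) \<times> (nat \<Rightarrow> real^'d) \<Rightarrow> _))"
    then have A: "A \<in> sets path_space" by simp
    have "snd -` A \<inter> space (std_gauss \<Otimes>\<^sub>M path_space) = space (std_gauss :: (real^'d) measure) \<times> A"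
      using sets.sets_into_space[OF A] by (auto simp: space_pair_measure)
    then show "emeasure (distr (std_gauss \<Otimes>\<^sub>M path_space) path_space (snd :: (real^'d) \<times> (nat \<Rightarrow> real^'d) \<Rightarrow> _)) A = emeasure path_space A"
      using A G.emeasure_space_1 by (simp add: emeasure_distr S.emeasure_pair_measure_Times)
  qed simp
  finally show "distr path_space path_space (\<lambda>\<omega> n. \<omega> (Suc n)) = (path_space :: (nat \<Rightarrow> real^'d) measure)" .
qed

context
  fixes g :: "real^'d::finite \<Rightarrow> real^'d" and \<sigma> :: "real^'d^'d" and \<eta> :: real
  assumes g_meas[measurable]: "g \<in> borel_measurable borel"
begin

definition em_step :: "real^'d \<Rightarrow> real^'d \<Rightarrow> real^'d" where
  "em_step x z = x + \<eta> *\<^sub>R g x + sqrt \<eta> *\<^sub>R (\<sigma> *v z)"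

text \<open>The chain with its noise indexed from \<open>0\<close>; \<open>em_chain\<close> ignores coordinate \<open>0\<close> of the path.\<close>

primrec driven :: "real^'d \<Rightarrow> nat \<Rightarrow> (nat \<Rightarrow> real^'d) \<Rightarrow> real^'d" where
  "driven x 0 \<theta> = x"
| "driven x (Suc k) \<theta> = em_step (driven x k \<theta>) (\<theta> k)"

lemma em_chain_driven: "em_chain g \<sigma> \<eta> x k \<omega> = driven x k (\<lambda>n. \<omega> (Suc n))"
  by (induction k) (auto simp: em_step_def)

lemma driven_case_nat: "driven x (Suc k) (case_nat z \<theta>) = driven (em_step x z) k \<theta>"
  by (induction k) auto

lemma em_step_meas[measurable]:
  assumes [measurable]: "f \<in> borel_measurable M" "h \<in> borel_measurable M"
  shows "(\<lambda>\<omega>. em_step (f \<omega>) (h \<omega>)) \<in> borel_measurable M"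
  unfolding em_step_def by measurable

lemma driven_meas[measurable]: "driven x k \<in> borel_measurable path_space"
proof (induction k)
  case (Suc k)
  have "(\<lambda>\<theta>. em_step (driven x k \<theta>) (\<theta> k)) \<in> borel_measurable path_space"
    by (rule em_step_meas[OF Suc coordinate_meas])
  then show ?case by simp
qed simp

lemma em_kernel_eq: "em_kernel g \<sigma> \<eta> x = distr std_gauss borel (em_step x)"
  unfolding em_kernel_def em_step_def ..

lemma em_kernel_measurable: "em_kernel g \<sigma> \<eta> \<in> borel \<rightarrow>\<^sub>M subprob_algebra borel"
  unfolding em_kernel_eq[abs_def]
proof (rule measurable_distr2[where M=std_gauss])
  show "case_prod em_step \<in> borel \<Otimes>\<^sub>M std_gauss \<rightarrow>\<^sub>M borel" by measurable
  show "(\<lambda>x. std_gauss) \<in> borel \<rightarrow>\<^sub>M subprob_algebra (std_gauss :: (real^'d) measure)"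
    by (rule measurable_const) (simp add: space_subprob_algebra prob_space_imp_subprob_space prob_space_std_gauss)
qed

text \<open>The Markov property by induction: splitting off the first innovation \<open>s\<close>
  leaves the product for the chain restarted at \<open>em_step x s\<close>. The bound on
  \<open>w\<close> gives the integrability for Fubini's theorem.\<close>

lemma driven_product:
  fixes w :: "real^'d \<Rightarrow> complex"
  assumes w[measurable]: "w \<in> borel_measurable borel" and b: "\<And>x. norm (w x) \<le> b"
  shows "(\<integral>\<theta>. (\<Prod>k<n. w (driven x (Suc k) \<theta>)) \<partial>path_space)
     = ((\<lambda>\<phi> x. \<integral>y. w y * \<phi> y \<partial>em_kernel g \<sigma> \<eta> x) ^^ n) (\<lambda>_. 1) x"
proof -
  define R where "R n = ((\<lambda>\<phi> x. \<integral>y. w y * \<phi> y \<partial>em_kernel g \<sigma> \<eta> x) ^^ n) (\<lambda>_. 1)" for n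
  define E where "E n x = (\<integral>\<theta>. (\<Prod>k<n. w (driven x (Suc k) \<theta>)) \<partial>path_space)" for n x
  have R_Suc: "R (Suc n) = (\<lambda>x. \<integral>y. w y * R n y \<partial>em_kernel g \<sigma> \<eta> x)" for n by (simp add: R_def)
  have R_meas: "R n \<in> borel_measurable borel" for n
  proof (induction n)
    case (Suc n)
    have [measurable]: "R n \<in> borel_measurable borel" by (rule Suc)
    show ?case unfolding R_Suc by (rule measurable_compose[OF em_kernel_measurable]) measurable
  qed (simp add: R_def)
  interpret S: prob_space "path_space :: (nat \<Rightarrow> real^'d) measure" by (rule prob_space_path)
  interpret G: prob_space "std_gauss :: (real^'d) measure" by (rule prob_space_std_gauss)
  interpret GS: pair_prob_space "std_gauss :: (real^'d) measure" "path_space :: (nat \<Rightarrow> real^'d) measure" ..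
  have "E n x = R n x" for n x
  proof (induction n arbitrary: x)
    case 0
    then show ?case using S.prob_space by (simp add: E_def R_def)
  next
    case (Suc n)
    define Z where "Z \<theta> = (\<Prod>k<Suc n. w (driven x (Suc k) \<theta>))" for \<theta>
    have Zm[measurable]: "Z \<in> borel_measurable path_space" unfolding Z_def by measurable
    have Zb: "norm (Z \<theta>) \<le> b ^ Suc n" for \<theta>
      unfolding Z_def prod_norm[symmetric] using prod_mono[of "{..<Suc n}" "\<lambda>k. norm (w (driven x (Suc k) \<theta>))" "\<lambda>_. b"] b by simp
    have int: "integrable (std_gauss \<Otimes>\<^sub>M path_space) (\<lambda>p. Z (case p of (s, \<omega>) \<Rightarrow> case_nat s \<omega>))"
    proof (rule GS.P.integrable_const_bound[of _ "b ^ Suc n"])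
      show "AE p in std_gauss \<Otimes>\<^sub>M path_space. norm (Z (case p of (s, \<omega>) \<Rightarrow> case_nat s \<omega>)) \<le> b ^ Suc n"
        by (intro AE_I2 Zb)
    qed (rule measurable_compose[OF path_split(2) Zm])
    have Zs: "(\<integral>\<omega>. Z (case_nat s \<omega>) \<partial>path_space) = w (em_step x s) * E n (em_step x s)" for s
    proof -
      have "Z (case_nat s \<omega>) = w (em_step x s) * (\<Prod>k<n. w (driven (em_step x s) (Suc k) \<omega>))" for \<omega>
        unfolding Z_def prod.lessThan_Suc_shift driven_case_nat by simp
      then show ?thesis unfolding E_def by simp
    qed
    have step: "em_step x \<in> std_gauss \<rightarrow>\<^sub>M borel" unfolding em_step_def[abs_def] by measurable
    have wR: "(\<lambda>y. w y * R n y) \<in> borel_measurable borel" by (rule borel_measurable_times[OF w R_meas])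
    have "E (Suc n) x = (\<integral>\<theta>. Z \<theta> \<partial>distr (std_gauss \<Otimes>\<^sub>M path_space) path_space (\<lambda>(s, \<omega>). case_nat s \<omega>))"
      unfolding path_split(1) by (simp only: E_def Z_def)
    also have "\<dots> = (\<integral>p. Z (case p of (s, \<omega>) \<Rightarrow> case_nat s \<omega>) \<partial>(std_gauss \<Otimes>\<^sub>M path_space))"
      by (rule integral_distr[OF path_split(2) Zm])
    also have "\<dots> = (\<integral>s. (\<integral>\<omega>. Z (case_nat s \<omega>) \<partial>path_space) \<partial>std_gauss)"
      using GS.integral_fst'[OF int] by simp
    also have "\<dots> = (\<integral>s. w (em_step x s) * R n (em_step x s) \<partial>std_gauss)"
      by (simp only: Zs Suc.IH)
    also have "\<dots> = (\<integral>y. w y * R n y \<partial>em_kernel g \<sigma> \<eta> x)"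
      unfolding em_kernel_eq[of x] by (rule integral_distr[OF step wR, symmetric])
    finally show ?case by (simp only: R_Suc)
  qed
  then show ?thesis by (simp only: E_def R_def)
qed

lemma em_chain_mgf:
  fixes h :: "real^'d \<Rightarrow> real" and t :: complex
  assumes h[measurable]: "h \<in> borel_measurable borel" and b: "\<And>x. \<bar>h x\<bar> \<le> b"
  shows "(\<integral>\<omega>. exp (t * of_real (\<Sum>k=1..n. h (em_chain g \<sigma> \<eta> x k \<omega>))) \<partial>path_space)
     = ((\<lambda>\<phi> x. \<integral>y. exp (t * of_real (h y)) * \<phi> y \<partial>em_kernel g \<sigma> \<eta> x) ^^ n) (\<lambda>_. 1) x"
proof -
  define w where "w y = exp (t * complex_of_real (h y))" for y
  have [measurable]: "w \<in> borel_measurable borel" unfolding w_def by measurable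
  have wb: "norm (w y) \<le> exp (norm t * b)" for y
  proof -
    have "norm (w y) \<le> exp (norm (t * of_real (h y)))" unfolding w_def by (rule norm_exp)
    also have "\<dots> \<le> exp (norm t * b)" using b by (simp add: norm_mult mult_left_mono)
    finally show ?thesis .
  qed
  have ex: "exp (t * of_real (\<Sum>k=1..n. h (em_chain g \<sigma> \<eta> x k \<omega>))) = (\<Prod>k<n. w (driven x (Suc k) (\<lambda>n. \<omega> (Suc n))))" for \<omega>
  proof -
    have "(\<Sum>k=1..n. h (em_chain g \<sigma> \<eta> x k \<omega>)) = (\<Sum>k<n. h (driven x (Suc k) (\<lambda>n. \<omega> (Suc n))))"
      unfolding em_chain_driven by (rule sum.reindex_bij_witness[where i=Suc and j="\<lambda>k. k - 1"]) auto
    then show ?thesis by (simp add: w_def exp_sum sum_distrib_left del: driven.simps)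
  qed
  have "(\<integral>\<omega>. exp (t * of_real (\<Sum>k=1..n. h (em_chain g \<sigma> \<eta> x k \<omega>))) \<partial>path_space)
     = (\<integral>\<theta>. (\<Prod>k<n. w (driven x (Suc k) \<theta>)) \<partial>distr path_space path_space (\<lambda>\<omega> n. \<omega> (Suc n)))"
    unfolding ex by (rule integral_distr[OF path_shift(2), symmetric]) measurable
  also have "\<dots> = (\<integral>\<theta>. (\<Prod>k<n. w (driven x (Suc k) \<theta>)) \<partial>path_space)" by (simp only: path_shift(1))
  also have "\<dots> = ((\<lambda>\<phi> x. \<integral>y. w y * \<phi> y \<partial>em_kernel g \<sigma> \<eta> x) ^^ n) (\<lambda>_. 1) x"
    by (rule driven_product[OF _ wb]) measurable
  finally show ?thesis by (simp add: w_def)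
qed

lemma em_chain_meas[measurable]: "em_chain g \<sigma> \<eta> x k \<in> borel_measurable path_space"
proof -
  have "(\<lambda>\<omega>. driven x k (\<lambda>n. \<omega> (Suc n))) \<in> borel_measurable path_space"
    by (rule measurable_compose[OF path_shift(2)]) measurable
  then show ?thesis by (simp add: em_chain_driven[abs_def])
qed

end

section \<open>The Euler--Maruyama chain\<close>

text \<open>Everything specific to the queueing drift enters through the Harris assumption, so this
  part holds for any measurable drift whose Euler kernel satisfies it.\<close>

lemma em_limit_theorems:
  fixes g :: "real^'d::finite \<Rightarrow> real^'d" and h :: "real^'d \<Rightarrow> real"
  assumes chain: "harris_chain (em_kernel g \<sigma> \<eta>) W r C" and g: "g \<in> borel_measurable borel"
    and inv: "invariant_prob g \<sigma> \<eta> \<mu>" and h: "h \<in> borel_measurable borel" "bounded (range h)"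
  shows "let mh = (\<integral>y. h y \<partial>\<mu>);
              hc = (\<lambda>y. h y - mh);
              Pop = em_op g \<sigma> \<eta>;
              f = (\<lambda>y. - (\<Sum>k. (Pop ^^ k) hc y));
              V = (\<integral>y. (f y)\<^sup>2 \<partial>\<mu>) - (\<integral>y. (Pop f y)\<^sup>2 \<partial>\<mu>)
          in (\<forall>y. summable (\<lambda>k. (Pop ^^ k) hc y)) \<and>
             (\<forall>y. Pop f y - f y = hc y) \<and>
             (\<forall>x. weak_conv_m
                   (\<lambda>n. distr path_space borel
                      (\<lambda>\<omega>. sqrt (real n) * (emp_avg g \<sigma> \<eta> x h n \<omega> - mh)))
                   (gauss_law V)) \<and>
             (\<lambda>k. (\<integral>y. (Pop ^^ (Suc k)) h y * hc y \<partial>\<mu>))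
                sums ((V - (\<integral>y. (hc y)\<^sup>2 \<partial>\<mu>)) / 2) \<and>
             (\<forall>x (a::nat \<Rightarrow> real) (A::real set).
                filterlim a at_top sequentially \<and>
                (\<lambda>n. a n / sqrt (real n)) \<longlonglongrightarrow> 0 \<and> A \<in> sets borel \<longrightarrow>
                (let pr = (\<lambda>n. elog (measure path_space
                            {\<omega>\<in>space path_space.
                              sqrt (real n) / a n * (emp_avg g \<sigma> \<eta> x h n \<omega> - mh) \<in> A})
                             / ereal ((a n)\<^sup>2))
                 in - (INF z\<in>interior A. mdp_rate V z) \<le> liminf pr \<and>
                    liminf pr \<le> limsup pr \<and>
                    limsup pr \<le> - (INF z\<in>closure A. mdp_rate V z)))"
proof -
  interpret chain: harris_chain "em_kernel g \<sigma> \<eta>" W r C by (rule chain)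
  have inv': "chain.invariant \<mu>" using inv by (simp add: chain.invariant_def invariant_prob_def)
  interpret stat: stationary_chain "em_kernel g \<sigma> \<eta>" W r C \<mu>
    by (intro stationary_chain.intro stationary_chain_axioms.intro chain inv')
  have Pop: "em_op g \<sigma> \<eta> = chain.T" by (simp add: em_op_def chain.T_def fun_eq_iff)
  define mh where "mh = (\<integral>y. h y \<partial>\<mu>)"
  define hc where "hc y = h y - mh" for y
  obtain b where b: "\<And>x. \<bar>h x\<bar> \<le> b" using h(2) by (auto simp: bounded_iff)
  have b0: "0 \<le> b" using b[of undefined] by linarith
  have hb: "chain.bnd b h" using h(1) b b0 by (intro chain.bnd_bounded) auto
  have hi: "integrable \<mu> h" by (rule stat.bnd_int_\<mu>[OF hb])
  have mhb: "\<bar>mh\<bar> \<le> b"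
  proof -
    have "\<bar>mh\<bar> \<le> (\<integral>y. \<bar>h y\<bar> \<partial>\<mu>)" unfolding mh_def by (rule integral_abs_bound)
    also have "\<dots> \<le> (\<integral>y. b \<partial>\<mu>)" using hi b by (intro integral_mono) auto
    finally show ?thesis by simp
  qed
  have [measurable]: "h \<in> borel_measurable borel" by (rule h(1))
  have hcm[measurable]: "hc \<in> borel_measurable borel" unfolding hc_def by measurable
  \<comment> \<open>Centring can double the bound \<open>b\<close>; the added 1 meets the
    normalization of \<open>H\<close>.\<close>
  interpret obs: centred_observable "em_kernel g \<sigma> \<eta>" W r C \<mu> hc "2 * b + 1"
  proof (intro centred_observable.intro centred_observable_axioms.intro stat.stationary_chain_axioms hcm)
    show "\<bar>hc x\<bar> \<le> 2 * b + 1" for x using b[of x] mhb by (simp add: hc_def)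
    show "1 \<le> 2 * b + 1" using b0 by simp
    show "(\<integral>x. hc x \<partial>\<mu>) = 0" using hi by (simp add: hc_def mh_def)
  qed
  define S where "S x n \<omega> = (\<Sum>k=1..n. hc (em_chain g \<sigma> \<eta> x k \<omega>))" for x n \<omega>
  have sums: "partial_sums (em_kernel g \<sigma> \<eta>) W r C \<mu> hc (2 * b + 1) path_space (S x) x" for x
  proof (intro partial_sums.intro partial_sums_axioms.intro obs.centred_observable_axioms prob_space_path)
    show "S x n \<in> borel_measurable path_space" for n
      unfolding S_def by (intro borel_measurable_sum measurable_compose[OF em_chain_meas[OF g] hcm])
    show "\<bar>S x n \<omega>\<bar> \<le> real n * (2 * b + 1)" for n \<omega>
    proof -
      have "\<bar>S x n \<omega>\<bar> \<le> (\<Sum>k=1..n. \<bar>hc (em_chain g \<sigma> \<eta> x k \<omega>)\<bar>)" unfolding S_def by (rule sum_abs)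
      also have "\<dots> \<le> (\<Sum>k=1..n. 2 * b + 1)" by (intro sum_mono obs.g_le)
      finally show ?thesis by simp
    qed
    show "(\<integral>\<omega>. exp (t * of_real (S x n \<omega>)) \<partial>path_space) = obs.tilted t n x" for t n
      unfolding S_def em_chain_mgf[OF g hcm obs.g_le] obs.tilted_def chain.T_def ..
  qed
  \<comment> \<open>At \<open>n = 0\<close> both sides are 0, by \<open>sqrt 0 = 0\<close> and
    division by zero.\<close>
  have avg: "sqrt (real n) * (emp_avg g \<sigma> \<eta> x h n \<omega> - mh) = S x n \<omega> / sqrt (real n)" for x n \<omega>
  proof (cases "n = 0")
    case False
    have "S x n \<omega> = real n * (emp_avg g \<sigma> \<eta> x h n \<omega> - mh)"
      using False by (simp add: S_def hc_def emp_avg_def sum_subtractf right_diff_distrib)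
    then have "S x n \<omega> / sqrt (real n) = (real n / sqrt (real n)) * (emp_avg g \<sigma> \<eta> x h n \<omega> - mh)" by simp
    also have "real n / sqrt (real n) = sqrt (real n)" by (rule real_div_sqrt) simp
    finally show ?thesis ..
  qed simp
  have f: "- (\<Sum>k. (em_op g \<sigma> \<eta> ^^ k) hc y) = obs.poisson y" for y
    by (simp add: Pop obs.poisson_def)
  have var: "(\<integral>y. (obs.poisson y)\<^sup>2 \<partial>\<mu>) - (\<integral>y. (em_op g \<sigma> \<eta> obs.poisson y)\<^sup>2 \<partial>\<mu>) = obs.asymp_var"
    unfolding Pop by (rule obs.poisson_variance)
  have cov0: "(\<integral>y. (hc y)\<^sup>2 \<partial>\<mu>) = obs.cov 0" by (simp add: obs.cov_def power2_eq_square)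
  \<comment> \<open>\<open>h\<close> and \<open>hc\<close> differ by the constant \<open>mh\<close>,
    which the kernel preserves and which integrates to 0 against \<open>hc\<close>.\<close>
  have covk: "(\<integral>y. (em_op g \<sigma> \<eta> ^^ Suc k) h y * hc y \<partial>\<mu>) = obs.cov (Suc k)" for k
  proof -
    have hcb: "chain.bnd (2 * b + 1) hc" using obs.g_le b0 by (intro chain.bnd_bounded hcm) auto
    have "h = (\<lambda>y. hc y + mh)" by (simp add: hc_def)
    then have "(chain.T ^^ Suc k) h = (\<lambda>y. (chain.T ^^ Suc k) hc y + mh)"
      using chain.Tpow_add[OF hcb chain.bnd_const[of mh], of "Suc k"] by (simp only: chain.Tpow_const)
    then have "(\<integral>y. (em_op g \<sigma> \<eta> ^^ Suc k) h y * hc y \<partial>\<mu>) = (\<integral>y. hc y * (chain.T ^^ Suc k) hc y + mh * hc y \<partial>\<mu>)"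
      unfolding Pop by (intro Bochner_Integration.integral_cong) (simp_all only: algebra_simps)
    also have "\<dots> = (\<integral>y. hc y * (chain.T ^^ Suc k) hc y \<partial>\<mu>) + (\<integral>y. mh * hc y \<partial>\<mu>)"
    proof (rule Bochner_Integration.integral_add)
      show "integrable \<mu> (\<lambda>y. hc y * (chain.T ^^ Suc k) hc y)"
        by (rule stat.bnd_int_\<mu>[OF chain.bnd_mult[OF hcm _ obs.Tpow_g_bnd, of "2 * b + 1"]]) (use obs.g_le in simp)
      show "integrable \<mu> (\<lambda>y. mh * hc y)" using stat.bnd_int_\<mu>[OF hcb] by simp
    qed
    also have "(\<integral>y. mh * hc y \<partial>\<mu>) = 0" using obs.g_mean by simp
    finally show ?thesis unfolding obs.cov_def by simp
  qed
  show ?thesis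
    unfolding Let_def mh_def[symmetric] hc_def[symmetric] f var
  proof (intro conjI allI impI)
    show "summable (\<lambda>k. (em_op g \<sigma> \<eta> ^^ k) hc y)" for y unfolding Pop by (rule obs.Tpow_g_summable)
    show "em_op g \<sigma> \<eta> obs.poisson y - obs.poisson y = hc y" for y unfolding Pop by (rule obs.poisson_equation)
    show "weak_conv_m (\<lambda>n. distr path_space borel (\<lambda>\<omega>. sqrt (real n) * (emp_avg g \<sigma> \<eta> x h n \<omega> - mh))) (gauss_law obs.asymp_var)" for x
      unfolding avg by (rule partial_sums.clt[OF sums])
    show "(\<lambda>k. (\<integral>y. (em_op g \<sigma> \<eta> ^^ Suc k) h y * hc y \<partial>\<mu>)) sums ((obs.asymp_var - (\<integral>y. (hc y)\<^sup>2 \<partial>\<mu>)) / 2)"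
      unfolding covk cov0 by (rule obs.cov_sums)
    fix x and a :: "nat \<Rightarrow> real" and A :: "real set"
    assume as: "filterlim a at_top sequentially \<and> (\<lambda>n. a n / sqrt (real n)) \<longlonglongrightarrow> 0 \<and> A \<in> sets borel"
    interpret quadratic_mgf path_space "\<lambda>n \<omega>. S x n \<omega> / (sqrt (real n) * a n)" "\<lambda>n. (a n)\<^sup>2" obs.asymp_var
      using as by (intro partial_sums.moderate_mgf[OF sums]) auto
    have Y: "sqrt (real n) / a n * (emp_avg g \<sigma> \<eta> x h n \<omega> - mh) = S x n \<omega> / (sqrt (real n) * a n)" for n \<omega>
      using avg[of n x \<omega>] by (metis divide_divide_eq_left times_divide_eq_left)
    show "- (INF z\<in>interior A. mdp_rate obs.asymp_var z) \<le> liminf (\<lambda>n. elog (measure path_space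
        {\<omega> \<in> space path_space. sqrt (real n) / a n * (emp_avg g \<sigma> \<eta> x h n \<omega> - mh) \<in> A}) / ereal ((a n)\<^sup>2))"
      unfolding Y using as by (intro ldp_lower) auto
    show "limsup (\<lambda>n. elog (measure path_space
        {\<omega> \<in> space path_space. sqrt (real n) / a n * (emp_avg g \<sigma> \<eta> x h n \<omega> - mh) \<in> A}) / ereal ((a n)\<^sup>2))
        \<le> - (INF z\<in>closure A. mdp_rate obs.asymp_var z)"
      unfolding Y using as by (intro ldp_upper) auto
    show "liminf (\<lambda>n. elog (measure path_space
        {\<omega> \<in> space path_space. sqrt (real n) / a n * (emp_avg g \<sigma> \<eta> x h n \<omega> - mh) \<in> A}) / ereal ((a n)\<^sup>2))
      \<le> limsup (\<lambda>n. elog (measure path_space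
        {\<omega> \<in> space path_space. sqrt (real n) / a n * (emp_avg g \<sigma> \<eta> x h n \<omega> - mh) \<in> A}) / ereal ((a n)\<^sup>2))"
      by (rule Liminf_le_Limsup) simp
  qed
qed

text \<open>Ellipticity makes the kernel of \<open>\<sigma> ** transpose \<sigma>\<close> trivial;
  for square matrices the resulting left inverse is also a right inverse.\<close>

lemma elliptic_right_inverse:
  fixes \<sigma> :: "real^'d::finite^'d"
  assumes "\<exists>c>0. \<forall>\<xi>::real^'d. \<xi> \<bullet> ((\<sigma> ** transpose \<sigma>) *v \<xi>) \<ge> c * (\<xi> \<bullet> \<xi>)"
  obtains B where "\<sigma> ** B = mat 1"
proof -
  obtain c where c: "0 < c" "\<And>\<xi>::real^'d. \<xi> \<bullet> ((\<sigma> ** transpose \<sigma>) *v \<xi>) \<ge> c * (\<xi> \<bullet> \<xi>)" using assms by blast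
  have "\<xi> = 0" if "(\<sigma> ** transpose \<sigma>) *v \<xi> = 0" for \<xi> :: "real^'d"
  proof -
    have "\<xi> \<bullet> \<xi> \<le> 0" using c(2)[of \<xi>] that c(1) by (simp add: mult_le_0_iff)
    then have "\<xi> \<bullet> \<xi> = 0" using inner_ge_zero[of \<xi>] by linarith
    then show ?thesis by simp
  qed
  then obtain N where "N ** (\<sigma> ** transpose \<sigma>) = mat 1" using matrix_left_invertible_ker[of "\<sigma> ** transpose \<sigma>"] by blast
  then have "(\<sigma> ** transpose \<sigma>) ** N = mat 1" by (simp add: matrix_left_right_inverse)
  then show ?thesis using that[of "transpose \<sigma> ** N"] by (simp add: matrix_mul_assoc)
qed

text \<open>Smallness of the step is expressed by a threshold below which existence and uniqueness
  of the invariant law belong to the conclusion. Stating the covariance series with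
  \<open>sums\<close> asserts its convergence together with its value.\<close>

theorem theorem1p4:
  fixes \<alpha> \<beta> ca2 :: real
    and p v :: "real^'d::finite"
    and P \<sigma> :: "real^'d^'d"
  assumes alpha_pos: "\<alpha> > 0"
    and p_nonneg: "\<forall>i. p$i \<ge> 0" and p_sum: "(\<Sum>i\<in>UNIV. p$i) = 1"
    and v_pos: "\<forall>i. v$i > 0"
    and P_nonneg: "\<forall>i j. P$i$j \<ge> 0"
    and P_substoch: "\<forall>i. (\<Sum>j\<in>UNIV. P$i$j) \<le> 1"
    and P_diag: "\<forall>i. P$i$i = 0"
    and IP_inv: "invertible (mat 1 - P)"
    and R_gamma: "ones \<bullet> (matrix_inv (transpose (mat 1 - P) ** diag_mat v) *v p) = 1"
    and ca2_pos: "ca2 > 0"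
    and sigma_cov: "let R = transpose (mat 1 - P) ** diag_mat v; \<gamma> = matrix_inv R *v p in
        \<sigma> ** transpose \<sigma> = ca2 *\<^sub>R diag_mat p + H0 p
          + (\<Sum>k\<in>UNIV. (\<gamma>$k * v$k) *\<^sub>R Hk P k)
          + transpose (mat 1 - P) ** diag_mat v ** diag_mat \<gamma> ** (mat 1 - P)"
    and elliptic: "\<exists>c>0. \<forall>\<xi>::real^'d. \<xi> \<bullet> ((\<sigma> ** transpose \<sigma>) *v \<xi>) \<ge> c * (\<xi> \<bullet> \<xi>)"
  shows "\<exists>\<eta>0>0. \<forall>\<eta>. 0 < \<eta> \<and> \<eta> < \<eta>0 \<longrightarrow>
    (let g = drift \<alpha> \<beta> p (transpose (mat 1 - P) ** diag_mat v) in
     (\<exists>!\<mu>. invariant_prob g \<sigma> \<eta> \<mu>) \<and>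
     (\<forall>\<mu>. invariant_prob g \<sigma> \<eta> \<mu> \<longrightarrow>
       (\<forall>h::real^'d \<Rightarrow> real. h \<in> borel_measurable borel \<and> bounded (range h) \<longrightarrow>
         (let mh = (\<integral>y. h y \<partial>\<mu>);
              hc = (\<lambda>y. h y - mh);
              Pop = em_op g \<sigma> \<eta>;
              f = (\<lambda>y. - (\<Sum>k. (Pop ^^ k) hc y));
              V = (\<integral>y. (f y)\<^sup>2 \<partial>\<mu>) - (\<integral>y. (Pop f y)\<^sup>2 \<partial>\<mu>)
          in (\<forall>y. summable (\<lambda>k. (Pop ^^ k) hc y)) \<and>
             (\<forall>y. Pop f y - f y = hc y) \<and>
             (\<forall>x. weak_conv_m
                   (\<lambda>n. distr path_space borel
                      (\<lambda>\<omega>. sqrt (real n) * (emp_avg g \<sigma> \<eta> x h n \<omega> - mh)))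
                   (gauss_law V)) \<and>
             (\<lambda>k. (\<integral>y. (Pop ^^ (Suc k)) h y * hc y \<partial>\<mu>))
                sums ((V - (\<integral>y. (hc y)\<^sup>2 \<partial>\<mu>)) / 2) \<and>
             (\<forall>x (a::nat \<Rightarrow> real) (A::real set).
                filterlim a at_top sequentially \<and>
                (\<lambda>n. a n / sqrt (real n)) \<longlonglongrightarrow> 0 \<and> A \<in> sets borel \<longrightarrow>
                (let pr = (\<lambda>n. elog (measure path_space
                            {\<omega>\<in>space path_space.
                              sqrt (real n) / a n * (emp_avg g \<sigma> \<eta> x h n \<omega> - mh) \<in> A})
                             / ereal ((a n)\<^sup>2))
                 in - (INF z\<in>interior A. mdp_rate V z) \<le> liminf pr \<and>
                    liminf pr \<le> limsup pr \<and>
                    limsup pr \<le> - (INF z\<in>closure A. mdp_rate V z)))))))"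
proof -
  define Rm where "Rm = transpose (mat 1 - P) ** diag_mat v"
  define g where "g = drift \<alpha> \<beta> p Rm"
  \<comment> \<open>Steps below \<open>1 / N\<close> satisfy \<open>\<eta> * \<alpha> < 1\<close>
    and all \<open>\<eta> * v$i < 1\<close> at once.\<close>
  define N where "N = \<alpha> + (\<Sum>i\<in>UNIV. v$i)"
  have N: "0 < N" "\<alpha> \<le> N" "v$i \<le> N" for i
  proof -
    have "v$i \<le> (\<Sum>i\<in>UNIV. v$i)" using v_pos by (intro member_le_sum) (auto simp: less_imp_le)
    then show "v$i \<le> N" using alpha_pos by (simp add: N_def)
    have "0 \<le> (\<Sum>i\<in>UNIV. v$i)" using v_pos by (intro sum_nonneg) (auto simp: less_imp_le)
    then show "0 < N" "\<alpha> \<le> N" using alpha_pos by (auto simp: N_def)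
  qed
  obtain B where B: "\<sigma> ** B = mat 1" by (rule elliptic_right_inverse[OF elliptic])
  have chain: "\<exists>W r C. harris_chain (em_kernel g \<sigma> \<eta>) W r C" and gm: "g \<in> borel_measurable borel"
    if \<eta>: "0 < \<eta>" "\<eta> < 1 / N" for \<eta>
  proof -
    have lt: "\<eta> * y < 1" if "y \<le> N" for y
    proof -
      have "\<eta> * y \<le> \<eta> * N" using that \<eta> by (intro mult_left_mono) auto
      also have "\<dots> < 1" using \<eta> N by (simp add: field_simps)
      finally show ?thesis .
    qed
    interpret fluid \<alpha> \<eta> p v P
      using alpha_pos p_nonneg p_sum v_pos P_nonneg P_substoch IP_inv \<eta> lt[OF N(2)] lt[OF N(3)]
      by unfold_locales auto
    have RR: "R = Rm" unfolding R_def Rm_def ..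
    define b where "b x = x + \<eta> *\<^sub>R g x" for x
    \<comment> \<open>The constant drift only translates the homogeneous step; as \<open>U\<close>
      is Lipschitz, this adds a constant to the drift condition.\<close>
    have bF: "b x = F x - (\<eta> * \<beta>) *\<^sub>R p" for x
      by (simp add: b_def g_def drift_def F_def RR s_def algebra_simps)
    have bcont: "continuous_on UNIV b" unfolding bF by (intro continuous_intros F_cont)
    have "g = (\<lambda>x. (1 / \<eta>) *\<^sub>R (b x - x))" using \<eta> by (simp add: b_def fun_eq_iff)
    moreover have "continuous_on UNIV (\<lambda>x. (1 / \<eta>) *\<^sub>R (b x - x))" by (intro continuous_intros bcont)
    ultimately show "g \<in> borel_measurable borel" by (simp add: borel_measurable_continuous_onI)
    obtain U r L where U: "0 \<le> r" "r < 1" "0 \<le> L" "\<And>x. norm x \<le> U x"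
      "\<And>x y. \<bar>U x - U y\<bar> \<le> L * norm (x - y)" "\<And>x. U (F x) \<le> r * U x"
      using fluid_lyapunov by blast
    have dec: "U (b x) \<le> r * U x + L * norm ((\<eta> * \<beta>) *\<^sub>R p)" for x
      using U(5)[of "b x" "F x"] U(6)[of x] by (simp add: bF abs_le_iff)
    have AB: "(sqrt \<eta> *\<^sub>R \<sigma>) ** ((1 / sqrt \<eta>) *\<^sub>R B) = mat 1"
    proof -
      have "((sqrt \<eta> *\<^sub>R \<sigma>) ** ((1 / sqrt \<eta>) *\<^sub>R B)) *v x = mat 1 *v x" for x
      proof -
        have "((sqrt \<eta> *\<^sub>R \<sigma>) ** ((1 / sqrt \<eta>) *\<^sub>R B)) *v x = (\<sigma> ** B) *v x"
          unfolding matrix_vector_mul_assoc[symmetric] scaleR_matrix_vector_assoc[symmetric] matrix_vector_mult_scaleR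
          using \<eta> by simp
        then show ?thesis by (simp add: B)
      qed
      then show ?thesis by (rule matrix_eq[THEN iffD2, rule_format])
    qed
    have "0 \<le> L * norm ((\<eta> * \<beta>) *\<^sub>R p)" using U(3) by simp
    from gaussian_harris_chain[OF bcont AB U(1,2,3,4,5) dec this]
    obtain C where "harris_chain (\<lambda>x. distr std_gauss borel (\<lambda>z. b x + (sqrt \<eta> *\<^sub>R \<sigma>) *v z)) (\<lambda>x. 1 + U x) r C" by blast
    moreover have "(\<lambda>x. distr std_gauss borel (\<lambda>z. b x + (sqrt \<eta> *\<^sub>R \<sigma>) *v z)) = em_kernel g \<sigma> \<eta>"
      unfolding em_kernel_def b_def scaleR_matrix_vector_assoc[symmetric] ..
    ultimately show "\<exists>W r C. harris_chain (em_kernel g \<sigma> \<eta>) W r C" by metis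
  qed
  have uniq: "\<exists>!\<mu>. invariant_prob g \<sigma> \<eta> \<mu>" if \<eta>: "0 < \<eta>" "\<eta> < 1 / N" for \<eta>
  proof -
    obtain W r C where "harris_chain (em_kernel g \<sigma> \<eta>) W r C" using chain[OF \<eta>] by blast
    then interpret harris_chain "em_kernel g \<sigma> \<eta>" W r C .
    have "invariant_prob g \<sigma> \<eta> \<mu> \<longleftrightarrow> invariant \<mu>" for \<mu> by (simp add: invariant_def invariant_prob_def)
    then show ?thesis using exists_invariant invariant_unique by metis
  qed
  show ?thesis
    unfolding Rm_def[symmetric] g_def[symmetric] Let_def[of g]
  proof (intro exI[of _ "1 / N"] conjI allI impI, goal_cases)
    case 1
    show ?case using N by simp
  next
    case (2 \<eta>)
    then show ?case by (intro uniq) auto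
  next
    case (3 \<eta> \<mu> h)
    obtain W r C where W: "harris_chain (em_kernel g \<sigma> \<eta>) W r C" using chain 3 by blast
    show ?case by (rule em_limit_theorems[OF W]) (use gm 3 in auto)
  qed
qed

end
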